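(* Let $X$ be a compact oriented manifold with Riemannian metric $g$, let $B$ be a $2$-form on $X$, let $H$ be a closed $3$-form on $X$, and let $H'=H-dB$. Then $$\tau_g(X,H')=(\det\varepsilon_B)\big(\tau_{(g,B)}(X,H)\big)\in\det H^\bullet(X,H').$$
   Context: $X$ is smooth without boundary, $n=\dim X$; $H$, $B$ are real. $\Omega^{\bar0}(X)$, $\Omega^{\bar1}(X)$ are the even- and odd-degree forms, bars denoting integers modulo 2. $d^H_{\bar k}$ is $d^H=d+H\wedge\cdot$ acting on $\Omega^{\bar k}(X)$, and $H^{\bar k}(X,H)=\ker d^H_{\bar k}/\operatorname{im}d^H_{\overline{k+1}}$, $k=0,1$. The map $\varepsilon_B=e^B\wedge\cdot$ satisfies $\varepsilon_B\circ d^H=d^{H'}\circ\varepsilon_B$ and induces $\det\varepsilon_B\colon\det H^\bullet(X,H)\to\det H^\bullet(X,H')$, where $\det H^\bullet(X,H)=\det H^{\bar0}(X,H)\otimes(\det H^{\bar1}(X,H))^{-1}$, $\det V$ is the top exterior power of $V$, $L^{-1}=L^*$ for a line $L$, and $v^{-1}\in L^{-1}$ is dual to $0\neq v\in L$. Born–Infeld metric of the generalized metric $(g,B)$: let $\sigma$ be the linear isomorphism of $\Omega^\bullet(X)$ reversing the order of wedge products of $1$-forms. Choose a local oriented $g$-orthonormal frame $e_1,\dots,e_n$ and put $\hat e_i=\iota_{e_i}+\iota_{e_i}(g+B)\wedge\cdot$, where $\iota_{e_i}(g+B)$ is the $1$-form $g(e_i,\cdot)+B(e_i,\cdot)$. Define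 $\star_{(g,B)}\omega=\sigma(\hat e_n\cdots\hat e_1\omega)$ and $(\omega,\omega')_{(g,B)}=\int_X\omega\wedge\star_{(g,B)}\overline{\omega'}$ on $\Omega^\bullet(X)^{\mathbb C}$; this is a scalar product, equal to the usual $L^2$ one of $g$ when $B=0$. Let $(d^H_{\bar k})^\dagger_{(g,B)}$ be the adjoint of $d^H_{\bar k}$ with respect to $(\cdot,\cdot)_{(g,B)}$ and $(\Delta^H_{\bar k})_{(g,B)}=(d^H_{\bar k})^\dagger_{(g,B)}d^H_{\bar k}+d^H_{\overline{k+1}}(d^H_{\overline{k+1}})^\dagger_{(g,B)}$. Let $(\eta^H_{\bar k})_{(g,B)}$ be the unit volume element (wedge product of an orthonormal basis for the Born–Infeld metric) of $\ker(\Delta^H_{\bar k})_{(g,B)}\cong H^{\bar k}(X,H)$. For a semi-positive self-adjoint $A$ put $\zeta(s,A)=\operatorname{Tr}'A^{-s}$ (trace on $(\ker A)^\perp$, meromorphically continued) and $\operatorname{Det}'A=e^{-\zeta'(0,A)}$; the zeta-functions used below are holomorphic at $s=0$. The twisted analytic torsion under the generalized metric is $$\tau_{(g,B)}(X,H)=\big(\operatorname{Det}'(d^H_{\bar0})^\dagger_{(g,B)}d^H_{\bar0}\big)^{1/2}\big(\operatorname{Det}'(d^H_{\bar1})^\dagger_{(g,B)}d^H_{\bar1}\big)^{-1/2}(\eta^H_{\bar0})_{(g,B)}\otimes(\eta^H_{\bar1})_{(g,B)}^{-1},$$ and $\tau_g(X,H')=\tau_{(g,0)}(X,H')$. Torsions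 are defined up to a phase (sign in the real case) and equality means equality up to such a phase. *)

theory Defs
  imports
    "HOL-Complex_Analysis.Complex_Analysis"
    "HOL-Library.Function_Algebras"
    "HOL-Algebra.AbelCoset"
    "HOL-Algebra.Module"
    "Jordan_Normal_Form.Determinant"
    "Jordan_Normal_Form.Conjugate"
begin

section \<open>Scalars\<close>

text \<open>
  The field of coefficients of forms and of scalars of cohomology: the real or the complex
  numbers.  By the Gelfand--Mazur theorem these are the only models of the class, so that a
  statement about an arbitrary type of the class is a statement about both cases.
\<close>

class real_or_complex =
  conjugatable_field + real_normed_field + banach + second_countable_topology +
  assumes mult_conjugate: "x * conjugate x = (norm x)\<^sup>2 *\<^sub>R 1"

instance real :: real_or_complex
  by standard (simp add: power2_eq_square)

instance complex :: real_or_complex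
proof
  fix x :: complex
  show "x * conjugate x = (norm x)\<^sup>2 *\<^sub>R 1"
    using complex_norm_square[of x] by (simp add: conjugate_complex_def scaleR_conv_of_real)
qed


section \<open>Linear algebra: quotients, exterior powers, tensor products\<close>

text \<open>
  Vector spaces over \<^typ>\<open>'k\<close> are records of HOL-Algebra; the ring multiplication of the record is
  irrelevant and left unspecified.
\<close>

definition space_on :: "('k \<Rightarrow> 'v \<Rightarrow> 'v) \<Rightarrow> 'v set \<Rightarrow> ('k, 'v::ab_group_add) module" where
  "space_on sc S = \<lparr>carrier = S, mult = undefined, one = undefined, zero = 0, add = (+),
     smult = sc\<rparr>"

definition fun_space :: "('a \<Rightarrow> 'k::field) set \<Rightarrow> ('k, 'a \<Rightarrow> 'k) module" where
  "fun_space S = space_on (\<lambda>a f x. a * f x) S"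

text \<open>Scalar multiplication adds the subspace again because \<open>0 \<odot> S\<close> is \<open>{0}\<close> and not a coset.\<close>

definition quotient_space :: "('k, 'v) module \<Rightarrow> 'v set \<Rightarrow> ('k, 'v set) module" where
  "quotient_space V W = \<lparr>carrier = a_rcosets\<^bsub>V\<^esub> W, mult = undefined, one = undefined, zero = W,
     add = set_add V, smult = (\<lambda>a S. W <+>\<^bsub>V\<^esub> ((\<lambda>v. a \<odot>\<^bsub>V\<^esub> v) ` S))\<rparr>"

text \<open>Functions on a carrier are extended by \<open>0\<close>, so that they are equal iff they agree on it.\<close>

definition dual_space :: "('k::field, 'v) module \<Rightarrow> ('k, 'v \<Rightarrow> 'k) module" where
  "dual_space V = fun_space {\<phi>.
     (\<forall>x\<in>carrier V. \<forall>y\<in>carrier V. \<phi> (x \<oplus>\<^bsub>V\<^esub> y) = \<phi> x + \<phi> y) \<and>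
     (\<forall>a. \<forall>x\<in>carrier V. \<phi> (a \<odot>\<^bsub>V\<^esub> x) = a * \<phi> x) \<and>
     (\<forall>x. x \<notin> carrier V \<longrightarrow> \<phi> x = 0)}"

definition tuples :: "nat \<Rightarrow> ('k, 'v) module \<Rightarrow> 'v list set" where
  "tuples d V = {vs. length vs = d \<and> set vs \<subseteq> carrier V}"

definition alternating :: "nat \<Rightarrow> ('k::field, 'v) module \<Rightarrow> ('v list \<Rightarrow> 'k) set" where
  "alternating d V = {h.
     (\<forall>vs\<in>tuples d V. \<forall>i<d. \<forall>x\<in>carrier V. \<forall>y\<in>carrier V.
        h (vs[i := x \<oplus>\<^bsub>V\<^esub> y]) = h (vs[i := x]) + h (vs[i := y])) \<and>
     (\<forall>vs\<in>tuples d V. \<forall>i<d. \<forall>a. \<forall>x\<in>carrier V. h (vs[i := a \<odot>\<^bsub>V\<^esub> x]) = a * h (vs[i := x])) \<and>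
     (\<forall>vs\<in>tuples d V. \<not> distinct vs \<longrightarrow> h vs = 0) \<and>
     (\<forall>vs. vs \<notin> tuples d V \<longrightarrow> h vs = 0)}"

text \<open>
  For finite-dimensional \<open>V\<close> the exterior power is the dual of the space of alternating
  multilinear functions, the element \<open>v\<^sub>1 \<and> \<dots> \<and> v\<^sub>d\<close> being evaluation at \<open>(v\<^sub>1, \<dots>, v\<^sub>d)\<close>.
  In the same way \<open>L \<otimes> M\<close> is the dual of the space of bilinear functions on \<open>L \<times> M\<close>.
\<close>

definition exterior_power ::
  "nat \<Rightarrow> ('k::field, 'v) module \<Rightarrow> ('k, ('v list \<Rightarrow> 'k) \<Rightarrow> 'k) module" where
  "exterior_power d V = dual_space (fun_space (alternating d V))"

definition wedge_list :: "('k::field, 'v) module \<Rightarrow> 'v list \<Rightarrow> ('v list \<Rightarrow> 'k) \<Rightarrow> 'k" where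
  "wedge_list V vs = (\<lambda>h. if h \<in> alternating (length vs) V then h vs else 0)"

definition top_degree :: "('k::field, 'v) module \<Rightarrow> nat" where
  "top_degree V = (GREATEST d. carrier (exterior_power d V) \<noteq> {0})"

definition det_space :: "('k::field, 'v) module \<Rightarrow> ('k, ('v list \<Rightarrow> 'k) \<Rightarrow> 'k) module" where
  "det_space V = exterior_power (top_degree V) V"

definition bilinear_forms ::
  "('k::field, 'v) module \<Rightarrow> ('k, 'w) module \<Rightarrow> ('v \<times> 'w \<Rightarrow> 'k) set" where
  "bilinear_forms V W = {\<beta>.
     (\<forall>w\<in>carrier W. (\<lambda>v. \<beta> (v, w)) \<in> carrier (dual_space V)) \<and>
     (\<forall>v\<in>carrier V. (\<lambda>w. \<beta> (v, w)) \<in> carrier (dual_space W)) \<and>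
     (\<forall>p. p \<notin> carrier V \<times> carrier W \<longrightarrow> \<beta> p = 0)}"

definition tensor_space ::
  "('k::field, 'v) module \<Rightarrow> ('k, 'w) module \<Rightarrow> ('k, ('v \<times> 'w \<Rightarrow> 'k) \<Rightarrow> 'k) module" where
  "tensor_space V W = dual_space (fun_space (bilinear_forms V W))"

definition tensor_elt ::
  "('k::field, 'v) module \<Rightarrow> ('k, 'w) module \<Rightarrow> 'v \<Rightarrow> 'w \<Rightarrow> ('v \<times> 'w \<Rightarrow> 'k) \<Rightarrow> 'k" where
  "tensor_elt V W v w = (\<lambda>\<beta>. if \<beta> \<in> bilinear_forms V W then \<beta> (v, w) else 0)"

text \<open>Maps induced by linear maps; for duals of lines, by an isomorphism.\<close>

definition det_map ::
  "('k::field, 'v) module \<Rightarrow> ('k, 'w) module \<Rightarrow> ('v \<Rightarrow> 'w) \<Rightarrow>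
     (('v list \<Rightarrow> 'k) \<Rightarrow> 'k) \<Rightarrow> ('w list \<Rightarrow> 'k) \<Rightarrow> 'k" where
  "det_map V W f \<Phi> = (\<lambda>h. if h \<in> alternating (top_degree V) W
     then \<Phi> (\<lambda>vs. if vs \<in> tuples (top_degree V) V then h (map f vs) else 0) else 0)"

definition inverse_dual_map ::
  "('k::field, 'v) module \<Rightarrow> ('k, 'w) module \<Rightarrow> ('v \<Rightarrow> 'w) \<Rightarrow> ('v \<Rightarrow> 'k) \<Rightarrow> 'w \<Rightarrow> 'k" where
  "inverse_dual_map V W f \<phi> =
     (\<lambda>w. if w \<in> carrier W then \<phi> (inv_into (carrier V) f w) else 0)"

definition tensor_map ::
  "('k::field, 'v) module \<Rightarrow> ('k, 'w) module \<Rightarrow> ('k, 'v') module \<Rightarrow> ('k, 'w') module \<Rightarrow>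
     ('v \<Rightarrow> 'v') \<Rightarrow> ('w \<Rightarrow> 'w') \<Rightarrow> (('v \<times> 'w \<Rightarrow> 'k) \<Rightarrow> 'k) \<Rightarrow> ('v' \<times> 'w' \<Rightarrow> 'k) \<Rightarrow> 'k" where
  "tensor_map V W V' W' f f' t = (\<lambda>\<beta>. if \<beta> \<in> bilinear_forms V' W'
     then t (\<lambda>(v, w). if v \<in> carrier V \<and> w \<in> carrier W then \<beta> (f v, f' w) else 0) else 0)"


section \<open>The exterior algebra of the dual of $\mathbb{R}^n$\<close>

text \<open>
  \<open>\<alpha> I\<close> is the coefficient of \<open>dx\<^sup>I = dx\<^sup>i\<^sup>1 \<and> \<dots> \<and> dx\<^sup>i\<^sup>k\<close>, where \<open>I = {i1 < \<dots> < ik}\<close>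
  is a set of coordinates \<open>0, \<dots>, n - 1\<close>.  A tangent vector is given by its coordinates.
\<close>

type_synonym 'k ext = "nat set \<Rightarrow> 'k"

definition ext_one :: "'k::field ext" where
  "ext_one = (\<lambda>I. if I = {} then 1 else 0)"

definition covector :: "nat \<Rightarrow> (nat \<Rightarrow> 'k::field) \<Rightarrow> 'k ext" where
  "covector n a = (\<lambda>I. \<Sum>i<n. if I = {i} then a i else 0)"

definition wedge :: "'k::field ext \<Rightarrow> 'k ext \<Rightarrow> 'k ext" where
  "wedge \<alpha> \<beta> = (\<lambda>K. \<Sum>I\<in>Pow K.
     (-1) ^ card {(i, j). i \<in> I \<and> j \<in> K - I \<and> j < i} * \<alpha> I * \<beta> (K - I))"

definition interior_mult :: "nat \<Rightarrow> (nat \<Rightarrow> real) \<Rightarrow> 'k::real_field ext \<Rightarrow> 'k ext" where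
  "interior_mult n v \<alpha> = (\<lambda>I. \<Sum>i\<in>{..<n} - I.
     of_real (v i) * (-1) ^ card {j \<in> I. j < i} * \<alpha> (insert i I))"

definition reversal :: "'k::field ext \<Rightarrow> 'k ext" where
  "reversal \<alpha> = (\<lambda>I. (-1) ^ (card I * (card I - 1) div 2) * \<alpha> I)"

text \<open>\<open>e\<^sup>b\<close> for \<open>b\<close> of degree 2; the powers of exponent greater than \<open>n\<close> vanish.\<close>

definition ext_exp :: "nat \<Rightarrow> 'k::field_char_0 ext \<Rightarrow> 'k ext" where
  "ext_exp n b = (\<lambda>I. \<Sum>k\<le>n. (wedge b ^^ k) ext_one I / fact k)"

text \<open>Pullback along the linear map with matrix \<open>J\<close>: \<open>dx\<^sup>k \<mapsto> \<Sum>\<^sub>i J k i dx\<^sup>i\<close>.\<close>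

definition ext_pullback :: "nat \<Rightarrow> (nat \<Rightarrow> nat \<Rightarrow> real) \<Rightarrow> 'k::real_field ext \<Rightarrow> 'k ext" where
  "ext_pullback n J \<alpha> = (\<lambda>I. \<Sum>K\<in>Pow {..<n}. \<alpha> K *
     foldr (\<lambda>k. wedge (covector n (\<lambda>i. of_real (J k i)))) (sorted_list_of_set K) ext_one I)"

definition oriented_orthonormal_frame ::
  "nat \<Rightarrow> (nat \<Rightarrow> nat \<Rightarrow> real) \<Rightarrow> (nat \<Rightarrow> nat \<Rightarrow> real) \<Rightarrow> bool" where
  "oriented_orthonormal_frame n G e \<longleftrightarrow>
     (\<forall>i<n. \<forall>j<n. (\<Sum>k<n. \<Sum>l<n. G k l * e i k * e j l) = (if i = j then 1 else 0)) \<and>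
     Determinant.det (mat n n (\<lambda>(i, j). e i j)) > 0"

text \<open>The operator \<open>\<iota>\<^sub>v + \<iota>\<^sub>v(G + b) \<and> _\<close>.\<close>

definition hat_op ::
  "nat \<Rightarrow> (nat \<Rightarrow> nat \<Rightarrow> real) \<Rightarrow> 'k::real_field ext \<Rightarrow> (nat \<Rightarrow> real) \<Rightarrow> 'k ext \<Rightarrow> 'k ext" where
  "hat_op n G b v \<alpha> = interior_mult n v \<alpha> +
     wedge (covector n (\<lambda>j. of_real (\<Sum>k<n. v k * G k j)) + interior_mult n v b) \<alpha>"

text \<open>
  The value at a point depends on the frame only through its value there, and does not depend on
  the choice of the frame.  Note that \<open>fold\<close> applies the operator of index \<open>0\<close> first.
\<close>

definition born_infeld_star ::
  "nat \<Rightarrow> (nat \<Rightarrow> nat \<Rightarrow> real) \<Rightarrow> 'k::real_field ext \<Rightarrow> 'k ext \<Rightarrow> 'k ext" where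
  "born_infeld_star n G b \<alpha> = (let e = (SOME e. oriented_orthonormal_frame n G e) in
     reversal (fold (\<lambda>i. hat_op n G b (e i)) [0..<n] \<alpha>))"


section \<open>Oriented manifolds\<close>

text \<open>
  Coordinate space of dimension \<open>n\<close> is \<open>{..<n} \<rightarrow>\<^sub>E UNIV\<close>, so that \<open>n\<close> is a term and
  \<open>n = 0\<close> is allowed; its points have the value \<^term>\<open>undefined\<close> at indices \<open>\<ge> n\<close>.
  Its topology is the one induced by the product topology and its measure is
  \<open>Pi\<^sub>M {..<n} (\<lambda>_. lborel)\<close>.
\<close>

definition coord_space :: "nat \<Rightarrow> (nat \<Rightarrow> real) set" where
  "coord_space n = ({..<n} \<rightarrow>\<^sub>E UNIV)"

definition partial_deriv ::
  "nat \<Rightarrow> ((nat \<Rightarrow> real) \<Rightarrow> 'k::real_normed_vector) \<Rightarrow> (nat \<Rightarrow> real) \<Rightarrow> 'k" where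
  "partial_deriv i f x = vector_derivative (\<lambda>t. f (x(i := t))) (at (x i))"

primrec Ck_on ::
  "nat \<Rightarrow> (nat \<Rightarrow> real) set \<Rightarrow> nat \<Rightarrow> ((nat \<Rightarrow> real) \<Rightarrow> 'k::real_normed_vector) \<Rightarrow> bool" where
  "Ck_on n S 0 f = continuous_on S f"
| "Ck_on n S (Suc k) f = (continuous_on S f \<and>
     (\<forall>i<n. (\<forall>x\<in>S. (\<lambda>t. f (x(i := t))) differentiable at (x i)) \<and>
            Ck_on n S k (partial_deriv i f)))"

text \<open>\<open>S\<close> is meant to be open in \<open>coord_space n\<close>.\<close>

definition smooth_on ::
  "nat \<Rightarrow> (nat \<Rightarrow> real) set \<Rightarrow> ((nat \<Rightarrow> real) \<Rightarrow> 'k::real_normed_vector) \<Rightarrow> bool" where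
  "smooth_on n S f \<longleftrightarrow> (\<forall>k. Ck_on n S k f)"

text \<open>A chart is a domain with a coordinate map.\<close>

type_synonym 'x chart = "'x set \<times> ('x \<Rightarrow> nat \<Rightarrow> real)"

definition chart_image :: "'x chart \<Rightarrow> (nat \<Rightarrow> real) set" where
  "chart_image c = snd c ` fst c"

definition chart_inv :: "'x chart \<Rightarrow> (nat \<Rightarrow> real) \<Rightarrow> 'x" where
  "chart_inv c = inv_into (fst c) (snd c)"

definition transition :: "'x chart \<Rightarrow> 'x chart \<Rightarrow> (nat \<Rightarrow> real) \<Rightarrow> nat \<Rightarrow> real" where
  "transition c c' x = snd c' (chart_inv c x)"

definition overlap :: "'x chart \<Rightarrow> 'x chart \<Rightarrow> (nat \<Rightarrow> real) set" where
  "overlap c c' = snd c ` (fst c \<inter> fst c')"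

definition jacobian :: "'x chart \<Rightarrow> 'x chart \<Rightarrow> (nat \<Rightarrow> real) \<Rightarrow> nat \<Rightarrow> nat \<Rightarrow> real" where
  "jacobian c c' x k i = partial_deriv i (\<lambda>y. transition c c' y k) x"

record 'x mfd =
  mtop :: "'x topology"
  mdim :: nat
  atlas :: "'x chart set"

definition compact_oriented_manifold :: "'x mfd \<Rightarrow> bool" where
  "compact_oriented_manifold X \<longleftrightarrow>
     Hausdorff_space (mtop X) \<and> second_countable (mtop X) \<and> compact_space (mtop X) \<and>
     (\<Union>c\<in>atlas X. fst c) = topspace (mtop X) \<and>
     (\<forall>c\<in>atlas X. openin (mtop X) (fst c) \<and>
        openin (top_of_set (coord_space (mdim X))) (chart_image c) \<and>
        homeomorphic_map (subtopology (mtop X) (fst c)) (top_of_set (chart_image c)) (snd c)) \<and>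
     (\<forall>c\<in>atlas X. \<forall>c'\<in>atlas X.
        (\<forall>k<mdim X. smooth_on (mdim X) (overlap c c') (\<lambda>x. transition c c' x k)) \<and>
        (\<forall>x\<in>overlap c c'.
           Determinant.det (mat (mdim X) (mdim X) (\<lambda>(k, i). jacobian c c' x k i)) > 0))"

text \<open>\<open>g c x i j\<close> is the component \<open>g(\<partial>\<^sub>i, \<partial>\<^sub>j)\<close> in the chart \<open>c\<close> at the point of coordinates \<open>x\<close>.\<close>

type_synonym 'x metric_tensor = "'x chart \<Rightarrow> (nat \<Rightarrow> real) \<Rightarrow> nat \<Rightarrow> nat \<Rightarrow> real"

definition riemannian_metric :: "'x mfd \<Rightarrow> 'x metric_tensor \<Rightarrow> bool" where
  "riemannian_metric X g \<longleftrightarrow>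
     (\<forall>c\<in>atlas X.
        (\<forall>i<mdim X. \<forall>j<mdim X. smooth_on (mdim X) (chart_image c) (\<lambda>x. g c x i j)) \<and>
        (\<forall>x\<in>chart_image c.
           (\<forall>i<mdim X. \<forall>j<mdim X. g c x i j = g c x j i) \<and>
           (\<forall>v. (\<exists>i<mdim X. v i \<noteq> 0) \<longrightarrow>
              (\<Sum>i<mdim X. \<Sum>j<mdim X. g c x i j * v i * v j) > 0))) \<and>
     (\<forall>c\<in>atlas X. \<forall>c'\<in>atlas X. \<forall>x\<in>overlap c c'. \<forall>i<mdim X. \<forall>j<mdim X.
        g c x i j = (\<Sum>k<mdim X. \<Sum>l<mdim X.
          jacobian c c' x k i * jacobian c c' x l j * g c' (transition c c' x) k l))"


section \<open>Differential forms\<close>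

text \<open>
  A differential form is the family of its local expressions in the charts of the atlas.  The
  expressions are \<open>0\<close> outside the images of the charts, so that equality of forms is equality of
  families.
\<close>

type_synonym ('x, 'k) form = "'x chart \<Rightarrow> (nat \<Rightarrow> real) \<Rightarrow> 'k ext"

definition form_scale :: "'k::field \<Rightarrow> ('x, 'k) form \<Rightarrow> ('x, 'k) form" where
  "form_scale a \<omega> = (\<lambda>c x I. a * \<omega> c x I)"

interpretation form: vector_space form_scale
  by standard (auto simp: form_scale_def fun_eq_iff algebra_simps)

definition forms :: "'x mfd \<Rightarrow> ('x, 'k::real_normed_field) form set" where
  "forms X = {\<omega>.
     (\<forall>c x I. \<not> (c \<in> atlas X \<and> x \<in> chart_image c \<and> I \<subseteq> {..<mdim X}) \<longrightarrow> \<omega> c x I = 0) \<and>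
     (\<forall>c\<in>atlas X. \<forall>I. smooth_on (mdim X) (chart_image c) (\<lambda>x. \<omega> c x I)) \<and>
     (\<forall>c\<in>atlas X. \<forall>c'\<in>atlas X. \<forall>x\<in>overlap c c'.
        \<omega> c x = ext_pullback (mdim X) (jacobian c c' x) (\<omega> c' (transition c c' x)))}"

definition forms_of_degree :: "'x mfd \<Rightarrow> nat \<Rightarrow> ('x, 'k::real_normed_field) form set" where
  "forms_of_degree X p = {\<omega> \<in> forms X. \<forall>c x I. \<omega> c x I \<noteq> 0 \<longrightarrow> card I = p}"

text \<open>Here \<open>k\<close> stands for its residue class modulo 2.\<close>

definition forms_of_parity :: "'x mfd \<Rightarrow> nat \<Rightarrow> ('x, 'k::real_normed_field) form set" where
  "forms_of_parity X k = {\<omega> \<in> forms X. \<forall>c x I. \<omega> c x I \<noteq> 0 \<longrightarrow> card I mod 2 = k mod 2}"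

definition embed_form :: "('x, real) form \<Rightarrow> ('x, 'k::real_normed_field) form" where
  "embed_form \<omega> = (\<lambda>c x I. of_real (\<omega> c x I))"

definition conj_form :: "('x, 'k::real_or_complex) form \<Rightarrow> ('x, 'k) form" where
  "conj_form \<omega> = (\<lambda>c x I. conjugate (\<omega> c x I))"

definition wedge_form :: "('x, 'k::field) form \<Rightarrow> ('x, 'k) form \<Rightarrow> ('x, 'k) form" where
  "wedge_form \<omega> \<omega>' = (\<lambda>c x. wedge (\<omega> c x) (\<omega>' c x))"

text \<open>\<open>d\<omega> = \<Sum>\<^sub>i dx\<^sup>i \<and> \<partial>\<omega>/\<partial>x\<^sup>i\<close> in each chart.\<close>

definition ext_deriv :: "'x mfd \<Rightarrow> ('x, 'k::real_normed_field) form \<Rightarrow> ('x, 'k) form" where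
  "ext_deriv X \<omega> = (\<lambda>c x I. if c \<in> atlas X \<and> x \<in> chart_image c
     then \<Sum>i<mdim X. wedge (covector (mdim X) (\<lambda>j. if j = i then 1 else 0))
            (\<lambda>K. partial_deriv i (\<lambda>y. \<omega> c y K) x) I
     else 0)"

definition partition_of_unity ::
  "'x mfd \<Rightarrow> 'x chart set \<Rightarrow> ('x chart \<Rightarrow> 'x \<Rightarrow> real) \<Rightarrow> bool" where
  "partition_of_unity X F \<rho> \<longleftrightarrow> finite F \<and> F \<subseteq> atlas X \<and>
     (\<forall>c\<in>F. (\<forall>p\<in>topspace (mtop X). \<rho> c p \<ge> 0) \<and>
        mtop X closure_of {p \<in> topspace (mtop X). \<rho> c p \<noteq> 0} \<subseteq> fst c \<and>
        (\<forall>c'\<in>atlas X. smooth_on (mdim X) (chart_image c') (\<lambda>x. \<rho> c (chart_inv c' x)))) \<and>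
     (\<forall>p\<in>topspace (mtop X). (\<Sum>c\<in>F. \<rho> c p) = 1)"

text \<open>
  Integral over \<open>X\<close> of the component of top degree; it does not depend on the choice of the
  partition of unity.
\<close>

definition form_integral :: "'x mfd \<Rightarrow> ('x, 'k::real_or_complex) form \<Rightarrow> 'k" where
  "form_integral X \<omega> = (let (F, \<rho>) = (SOME (F, \<rho>). partition_of_unity X F \<rho>) in
     \<Sum>c\<in>F. set_lebesgue_integral (Pi\<^sub>M {..<mdim X} (\<lambda>_. lborel)) (chart_image c)
       (\<lambda>x. \<rho> c (chart_inv c x) *\<^sub>R \<omega> c x {..<mdim X}))"


section \<open>Twisted cohomology and torsion\<close>

definition twisted_d ::
  "'x mfd \<Rightarrow> ('x, real) form \<Rightarrow> ('x, 'k::real_normed_field) form \<Rightarrow> ('x, 'k) form" where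
  "twisted_d X H \<omega> = ext_deriv X \<omega> + wedge_form (embed_form H) \<omega>"

definition eps ::
  "'x mfd \<Rightarrow> ('x, real) form \<Rightarrow> ('x, 'k::real_normed_field) form \<Rightarrow> ('x, 'k) form" where
  "eps X B \<omega> = wedge_form (\<lambda>c x. ext_exp (mdim X) (embed_form B c x)) \<omega>"

definition cocycles ::
  "'x mfd \<Rightarrow> ('x, real) form \<Rightarrow> nat \<Rightarrow> ('k::real_normed_field, ('x, 'k) form) module" where
  "cocycles X H k = space_on form_scale {\<omega> \<in> forms_of_parity X k. twisted_d X H \<omega> = 0}"

definition coboundaries ::
  "'x mfd \<Rightarrow> ('x, real) form \<Rightarrow> nat \<Rightarrow> ('x, 'k::real_normed_field) form set" where
  "coboundaries X H k = twisted_d X H ` forms_of_parity X (Suc k)"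

definition cohomology ::
  "'x mfd \<Rightarrow> ('x, real) form \<Rightarrow> nat \<Rightarrow> ('k::real_normed_field, ('x, 'k) form set) module" where
  "cohomology X H k = quotient_space (cocycles X H k) (coboundaries X H k)"

definition coh_class ::
  "'x mfd \<Rightarrow> ('x, real) form \<Rightarrow> nat \<Rightarrow> ('x, 'k::real_normed_field) form \<Rightarrow> ('x, 'k) form set"
  where "coh_class X H k \<omega> = coboundaries X H k +>\<^bsub>cocycles X H k\<^esub> \<omega>"

type_synonym ('x, 'k) det_coh_elt = "(('x, 'k) form set list \<Rightarrow> 'k) \<Rightarrow> 'k"

type_synonym ('x, 'k) det_elt =
  "(('x, 'k) det_coh_elt \<times> (('x, 'k) det_coh_elt \<Rightarrow> 'k) \<Rightarrow> 'k) \<Rightarrow> 'k"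

definition det_cohomology ::
  "'x mfd \<Rightarrow> ('x, real) form \<Rightarrow> ('k::real_normed_field, ('x, 'k) det_elt) module" where
  "det_cohomology X H = tensor_space (det_space (cohomology X H 0))
     (dual_space (det_space (cohomology X H 1)))"

text \<open>The map induced on a cohomology class, which is a coset, is the image.\<close>

definition det_eps ::
  "'x mfd \<Rightarrow> ('x, real) form \<Rightarrow> ('x, real) form \<Rightarrow> ('x, real) form \<Rightarrow>
     ('x, 'k::real_normed_field) det_elt \<Rightarrow> ('x, 'k) det_elt" where
  "det_eps X B H H' =
    (let L = (\<lambda>k. det_space (cohomology X H k));
         L' = (\<lambda>k. det_space (cohomology X H' k));
         f = (\<lambda>k. det_map (cohomology X H k) (cohomology X H' k) ((`) (eps X B)))
     in tensor_map (L 0) (dual_space (L 1)) (L' 0) (dual_space (L' 1))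
          (f 0) (inverse_dual_map (L 1) (L' 1) (f 1)))"

definition born_infeld_product ::
  "'x mfd \<Rightarrow> 'x metric_tensor \<Rightarrow> ('x, real) form \<Rightarrow>
     ('x, 'k::real_or_complex) form \<Rightarrow> ('x, 'k) form \<Rightarrow> 'k" where
  "born_infeld_product X g B \<omega> \<omega>' = form_integral X
     (wedge_form \<omega> (\<lambda>c x. born_infeld_star (mdim X) (g c x) (embed_form B c x)
                             (conj_form \<omega>' c x)))"

text \<open>
  The value at \<open>\<beta>\<close> of the adjoint of \<open>T\<close>, defined on \<open>V\<close>.  The value \<open>0\<close> is only a convention
  for \<open>\<beta>\<close> outside the domain of the adjoint.
\<close>

definition adjoint_on ::
  "('v \<Rightarrow> 'v \<Rightarrow> 'k) \<Rightarrow> 'v set \<Rightarrow> ('v \<Rightarrow> 'v) \<Rightarrow> 'v \<Rightarrow> 'v::zero" where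
  "adjoint_on ip V T \<beta> =
    (let P = (\<lambda>\<alpha>. \<alpha> \<in> V \<and> (\<forall>\<gamma>\<in>V. ip (T \<gamma>) \<beta> = ip \<gamma> \<alpha>)) in if \<exists>!\<alpha>. P \<alpha> then THE \<alpha>. P \<alpha> else 0)"

definition twisted_d_adj ::
  "'x mfd \<Rightarrow> 'x metric_tensor \<Rightarrow> ('x, real) form \<Rightarrow> ('x, real) form \<Rightarrow> nat \<Rightarrow>
     ('x, 'k::real_or_complex) form \<Rightarrow> ('x, 'k) form" where
  "twisted_d_adj X g B H k =
     adjoint_on (born_infeld_product X g B) (forms_of_parity X k) (twisted_d X H)"

definition twisted_laplacian ::
  "'x mfd \<Rightarrow> 'x metric_tensor \<Rightarrow> ('x, real) form \<Rightarrow> ('x, real) form \<Rightarrow> nat \<Rightarrow>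
     ('x, 'k::real_or_complex) form \<Rightarrow> ('x, 'k) form" where
  "twisted_laplacian X g B H k \<omega> =
     twisted_d_adj X g B H k (twisted_d X H \<omega>) + twisted_d X H (twisted_d_adj X g B H (Suc k) \<omega>)"

definition harmonic_forms ::
  "'x mfd \<Rightarrow> 'x metric_tensor \<Rightarrow> ('x, real) form \<Rightarrow> ('x, real) form \<Rightarrow> nat \<Rightarrow>
     ('x, 'k::real_or_complex) form set" where
  "harmonic_forms X g B H k = {\<omega> \<in> forms_of_parity X k. twisted_laplacian X g B H k \<omega> = 0}"

definition orthonormal_basis ::
  "(('x, 'k::field) form \<Rightarrow> ('x, 'k) form \<Rightarrow> 'k) \<Rightarrow> ('x, 'k) form set \<Rightarrow>
     ('x, 'k) form list \<Rightarrow> bool" where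
  "orthonormal_basis ip V bs \<longleftrightarrow> form.span (set bs) = V \<and>
     (\<forall>i<length bs. \<forall>j<length bs. ip (bs ! i) (bs ! j) = (if i = j then 1 else 0))"

definition unit_volume_elements ::
  "'x mfd \<Rightarrow> 'x metric_tensor \<Rightarrow> ('x, real) form \<Rightarrow> ('x, real) form \<Rightarrow> nat \<Rightarrow>
     ('x, 'k::real_or_complex) det_coh_elt set" where
  "unit_volume_elements X g B H k = {\<eta> \<in> carrier (det_space (cohomology X H k)).
     \<exists>bs. orthonormal_basis (born_infeld_product X g B) (harmonic_forms X g B H k) bs \<and>
       \<eta> = wedge_list (cohomology X H k) (map (coh_class X H k) bs)}"

text \<open>
  Eigenvalues are counted with multiplicity, so that \<open>\<Sum>\<^sub>r\<^sub>>\<^sub>0 mult(r) r\<^sup>-\<^sup>s\<close> is the trace of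
  \<open>A\<^sup>-\<^sup>s\<close> on the orthogonal complement of the kernel of the semi-positive operator \<open>A\<close> on \<open>V\<close>;
  only eigenvalues contribute to the sum.
\<close>

definition eigen_mult ::
  "('x, 'k::real_normed_field) form set \<Rightarrow> (('x, 'k) form \<Rightarrow> ('x, 'k) form) \<Rightarrow> real \<Rightarrow> nat" where
  "eigen_mult V A r = form.dim {\<omega> \<in> V. A \<omega> = form_scale (of_real r) \<omega>}"

definition is_zeta ::
  "('x, 'k::real_normed_field) form set \<Rightarrow> (('x, 'k) form \<Rightarrow> ('x, 'k) form) \<Rightarrow>
     (complex \<Rightarrow> complex) \<Rightarrow> bool" where
  "is_zeta V A Z \<longleftrightarrow> Z nicely_meromorphic_on UNIV \<and>
     (\<exists>\<sigma>. \<forall>s. Re s > \<sigma> \<longrightarrow>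
        ((\<lambda>r. of_nat (eigen_mult V A r) * complex_of_real r powr (- s)) has_sum Z s) {0<..})"

definition zeta_function ::
  "('x, 'k::real_normed_field) form set \<Rightarrow> (('x, 'k) form \<Rightarrow> ('x, 'k) form) \<Rightarrow>
     complex \<Rightarrow> complex" where
  "zeta_function V A = (SOME Z. is_zeta V A Z)"

text \<open>The derivative of the zeta-function at \<open>0\<close> is a real number.\<close>

definition zeta_det ::
  "('x, 'k::real_normed_field) form set \<Rightarrow> (('x, 'k) form \<Rightarrow> ('x, 'k) form) \<Rightarrow> real" where
  "zeta_det V A = exp (- Re (deriv (zeta_function V A) 0))"

definition twisted_det ::
  "'k::real_or_complex itself \<Rightarrow> 'x mfd \<Rightarrow> 'x metric_tensor \<Rightarrow> ('x, real) form \<Rightarrow>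
     ('x, real) form \<Rightarrow> nat \<Rightarrow> real" where
  "twisted_det _ X g B H k = zeta_det (forms_of_parity X k :: ('x, 'k) form set)
     (\<lambda>\<omega>. twisted_d_adj X g B H k (twisted_d X H \<omega>))"

text \<open>
  The torsion is only defined up to a phase; the following set is the torsion as a class of
  elements of the determinant line modulo scalars of absolute value 1.  The functional \<open>\<phi>\<close> is
  the inverse of \<open>\<eta>1\<close>.
\<close>

definition torsion ::
  "'x mfd \<Rightarrow> 'x metric_tensor \<Rightarrow> ('x, real) form \<Rightarrow> ('x, real) form \<Rightarrow>
     ('x, 'k::real_or_complex) det_elt set" where
  "torsion X g B H =
    (let L0 = det_space (cohomology X H 0);
         L1inv = dual_space (det_space (cohomology X H 1));
         r = sqrt (twisted_det TYPE('k) X g B H 0) / sqrt (twisted_det TYPE('k) X g B H 1)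
     in {(u * of_real r) \<odot>\<^bsub>det_cohomology X H\<^esub> tensor_elt L0 L1inv \<eta>0 \<phi> | u \<eta>0 \<eta>1 \<phi>.
          norm u = 1 \<and>
          \<eta>0 \<in> unit_volume_elements X g B H 0 \<and>
          \<eta>1 \<in> unit_volume_elements X g B H 1 \<and>
          \<phi> \<in> carrier L1inv \<and> \<phi> \<eta>1 = 1})"

end

theory Submission
  imports Defs
begin

text \<open>
  The map \<open>\<epsilon>\<^sub>B = e\<^sup>B \<and> _\<close> carries everything of which the torsion of \<open>(g, B)\<close> and \<open>H\<close> is made to
  the corresponding object of \<open>g\<close> and \<open>H'\<close>.  It permutes the forms of each parity, with inverse
  \<open>\<epsilon>\<^sub>-\<^sub>B\<close>, and it has two properties from which the rest follows formally.

  It intertwines the differentials, \<open>d\<^sup>H\<^sup>' \<circ> \<epsilon>\<^sub>B = \<epsilon>\<^sub>B \<circ> d\<^sup>H\<close> (lemma \<open>eps_twisted_d\<close>), because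
  \<open>d (e\<^sup>B \<omega>) = dB \<and> e\<^sup>B \<omega> + e\<^sup>B d\<omega>\<close> and the first summand is what distinguishes \<open>H'\<close> from \<open>H\<close>.

  It is an isometry from the Born--Infeld product of \<open>(g, B)\<close> to that of \<open>(g, 0)\<close> (lemma
  \<open>born_infeld_product_eps\<close>).  This is a pointwise statement: conjugation by \<open>e\<^sup>B\<close> turns \<open>\<iota>\<^sub>v\<close> into
  \<open>\<iota>\<^sub>v - \<iota>\<^sub>vB \<and> _\<close>, hence the operators \<open>\<iota>\<^sub>v + \<iota>\<^sub>v(g + B) \<and> _\<close> of \<open>(g, B)\<close> into those of \<open>(g, 0)\<close>, and the
  reversal of products turns \<open>e\<^sup>B\<close> into \<open>e\<^sup>-\<^sup>B\<close>, so that the star operators satisfy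
  \<open>\<star>\<^sub>(\<^sub>g\<^sub>,\<^sub>B\<^sub>) = e\<^sup>B \<and> \<star>\<^sub>g (e\<^sup>B \<and> _)\<close>; as \<open>e\<^sup>B\<close> has even degree, it can be moved to the other factor
  of the integrand.

  Both computations are instances of one identity, \<open>op_exp_twist\<close>: if \<open>D b = b D + C\<close> and \<open>C\<close>
  commutes with \<open>b\<close>, then \<open>D e\<^sup>b = e\<^sup>b D + C e\<^sup>b\<close>.  It is applied to the contractions and to the
  exterior derivative, \<open>b\<close> being the product with \<open>B\<close>.

  The adjoint of the differential is determined by the differential and the product on the forms
  of a given parity.  So \<open>\<epsilon>\<^sub>B\<close> also intertwines adjoints and Laplacians, and maps eigenspaces to
  eigenspaces of the same dimension and harmonic forms to harmonic forms.  Hence the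
  zeta-determinants agree, the unit volume elements correspond under \<open>det \<epsilon>\<^sub>B\<close>, and the torsions
  correspond.
\<close>

section \<open>The exterior algebra\<close>

lemma sum_fun_apply: "(\<Sum>k\<in>A. f k) x = (\<Sum>k\<in>A. f k x)"
  by (induction A rule: infinite_finite_induct) auto

text \<open>
  The sign of the permutation that sorts the concatenation of \<open>I\<close> and \<open>J\<close>, each in increasing
  order: \<open>dx\<^sup>I \<and> dx\<^sup>J = shuffle_sign I J dx\<^sup>I\<^sup>\<union>\<^sup>J\<close> for disjoint \<open>I\<close> and \<open>J\<close>.
\<close>

definition shuffle_sign :: "nat set \<Rightarrow> nat set \<Rightarrow> 'k::field" where
  "shuffle_sign I J = (-1) ^ card {(i, j). i \<in> I \<and> j \<in> J \<and> j < i}"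

lemma finite_inversions:
  assumes "finite I" shows "finite {(i, j). i \<in> I \<and> j \<in> J \<and> j < (i::nat)}"
proof -
  have "{(i, j). i \<in> I \<and> j \<in> J \<and> j < i} \<subseteq> Sigma I (\<lambda>i. {..<i})" by auto
  then show ?thesis by (rule finite_subset) (use assms in auto)
qed

lemma shuffle_sign_Un_left:
  assumes "finite I" "finite J" "I \<inter> J = {}"
  shows "shuffle_sign (I \<union> J) L = shuffle_sign I L * (shuffle_sign J L :: 'k::field)"
proof -
  have "{(i, j). i \<in> I \<union> J \<and> j \<in> L \<and> j < i} =
    {(i, j). i \<in> I \<and> j \<in> L \<and> j < i} \<union> {(i, j). i \<in> J \<and> j \<in> L \<and> j < i}" by auto
  moreover have "card \<dots> = card {(i, j). i \<in> I \<and> j \<in> L \<and> j < i} + card {(i, j). i \<in> J \<and> j \<in> L \<and> j < i}"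
    by (rule card_Un_disjoint) (use assms finite_inversions in auto)
  ultimately show ?thesis by (simp add: shuffle_sign_def power_add)
qed

lemma shuffle_sign_Un_right:
  assumes "finite L" "I \<inter> J = {}"
  shows "shuffle_sign L (I \<union> J) = shuffle_sign L I * (shuffle_sign L J :: 'k::field)"
proof -
  have "{(i, j). i \<in> L \<and> j \<in> I \<union> J \<and> j < i} =
    {(i, j). i \<in> L \<and> j \<in> I \<and> j < i} \<union> {(i, j). i \<in> L \<and> j \<in> J \<and> j < i}" by auto
  moreover have "card \<dots> = card {(i, j). i \<in> L \<and> j \<in> I \<and> j < i} + card {(i, j). i \<in> L \<and> j \<in> J \<and> j < i}"
    by (rule card_Un_disjoint) (use assms finite_inversions in auto)
  ultimately show ?thesis by (simp add: shuffle_sign_def power_add)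
qed

text \<open>
  A pair of an element of \<open>I\<close> and one of \<open>J\<close> is an inversion for exactly one of the two orders of
  the sets.
\<close>

lemma shuffle_sign_swap:
  assumes "finite I" "finite J" "I \<inter> J = {}"
  shows "shuffle_sign J I = (-1) ^ (card I * card J) * (shuffle_sign I J :: 'k::field)"
proof -
  let ?A = "{(i, j). i \<in> I \<and> j \<in> J \<and> j < i}" and ?B = "{(i, j). i \<in> J \<and> j \<in> I \<and> j < i}"
  have swap: "prod.swap ` ?B = {(i, j). i \<in> I \<and> j \<in> J \<and> i < j}"
    by force
  have "i < j \<or> j < i" if "i \<in> I" "j \<in> J" for i j
    using that assms(3) by (metis disjoint_iff linorder_neqE_nat)
  then have un: "I \<times> J = ?A \<union> prod.swap ` ?B" unfolding swap by blast
  have "card (I \<times> J) = card ?A + card (prod.swap ` ?B)"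
    unfolding un by (rule card_Un_disjoint) (use assms finite_inversions in auto)
  also have "card (prod.swap ` ?B) = card ?B" by (rule card_image) (auto simp: inj_on_def)
  finally have *: "card I * card J = card ?A + card ?B" by (simp add: card_cartesian_product)
  show ?thesis unfolding shuffle_sign_def * by (simp add: power_add)
qed

lemma shuffle_sign_squared [simp]: "shuffle_sign I J * (shuffle_sign I J * x) = (x :: 'k::field)"
  by (simp add: shuffle_sign_def flip: mult.assoc power_mult_distrib)

lemma shuffle_sign_mult_self [simp]: "shuffle_sign I J * shuffle_sign I J = (1 :: 'k::field)"
  using shuffle_sign_squared[of I J 1] by simp

lemma shuffle_sign_empty [simp]: "shuffle_sign {} J = 1" "shuffle_sign I {} = 1"
  by (simp_all add: shuffle_sign_def)

lemma wedge_eq: "wedge \<alpha> \<beta> K = (\<Sum>I\<in>Pow K. shuffle_sign I (K - I) * \<alpha> I * \<beta> (K - I))"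
  by (simp add: wedge_def shuffle_sign_def)

lemma wedge_infinite: "infinite K \<Longrightarrow> wedge \<alpha> \<beta> K = 0"
  by (simp add: wedge_def finite_Pow_iff)

text \<open>
  Both sides are sums over the decompositions of \<open>K\<close> into three parts, with the same signs because
  \<open>shuffle_sign\<close> is multiplicative in each argument.  For infinite \<open>K\<close> all products vanish, so that the
  identity holds for arbitrary coefficient functions.
\<close>

lemma wedge_assoc: "wedge (wedge \<alpha> \<beta>) \<gamma> = wedge \<alpha> (wedge \<beta> \<gamma>)"
proof
  fix K
  show "wedge (wedge \<alpha> \<beta>) \<gamma> K = wedge \<alpha> (wedge \<beta> \<gamma>) K"
  proof (cases "finite K")
    case True
    have fin: "finite I" if "I \<subseteq> K" for I using that True finite_subset by auto
    have "wedge (wedge \<alpha> \<beta>) \<gamma> K = (\<Sum>M\<in>Pow K. \<Sum>I\<in>Pow M. shuffle_sign M (K - M) *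
        (shuffle_sign I (M - I) * \<alpha> I * \<beta> (M - I)) * \<gamma> (K - M))"
      by (simp add: wedge_eq sum_distrib_left sum_distrib_right)
    also have "\<dots> = (\<Sum>(M, I)\<in>Sigma (Pow K) Pow. shuffle_sign M (K - M) *
        (shuffle_sign I (M - I) * \<alpha> I * \<beta> (M - I)) * \<gamma> (K - M))"
      using True fin by (intro sum.Sigma) auto
    also have "\<dots> = (\<Sum>(I, J)\<in>Sigma (Pow K) (\<lambda>I. Pow (K - I)). shuffle_sign I (K - I) * \<alpha> I *
        (shuffle_sign J (K - I - J) * \<beta> J * \<gamma> (K - I - J)))"
    proof (rule sum.reindex_bij_witness[of _ "\<lambda>(I, J). (I \<union> J, I)" "\<lambda>(M, I). (I, M - I)"], goal_cases)
      case (5 p)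
      obtain M I where p: "p = (M, I)" by (cases p)
      define J L where "J = M - I" and "L = K - M"
      have MI: "I \<subseteq> M" "M \<subseteq> K" using 5 p by auto
      have e: "M = I \<union> J" "K - I = J \<union> L" "K - I - J = L" using MI by (auto simp: J_def L_def)
      have f: "finite I" "finite J" "finite L"
        using fin MI by (auto simp: J_def L_def True finite_subset)
      have "shuffle_sign M L * (shuffle_sign I J :: 'a) = shuffle_sign I (K - I) * shuffle_sign J L"
        unfolding e using f
        by (subst shuffle_sign_Un_left, (auto simp: J_def L_def)[3], subst shuffle_sign_Un_right)
           (use MI in \<open>auto simp: J_def L_def mult_ac\<close>)
      then have "shuffle_sign I (K - I) * shuffle_sign J L * (\<alpha> I * \<beta> J * \<gamma> L) =
          shuffle_sign M L * shuffle_sign I J * (\<alpha> I * \<beta> J * \<gamma> L)" by simp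
      then show ?case unfolding p prod.case J_def [symmetric] L_def [symmetric] e(3) by (simp only: mult_ac)
    qed auto
    also have "\<dots> = (\<Sum>I\<in>Pow K. \<Sum>J\<in>Pow (K - I). shuffle_sign I (K - I) * \<alpha> I *
        (shuffle_sign J (K - I - J) * \<beta> J * \<gamma> (K - I - J)))"
      using True fin by (intro sum.Sigma [symmetric]) auto
    also have "\<dots> = wedge \<alpha> (wedge \<beta> \<gamma>) K"
      by (simp add: wedge_eq sum_distrib_left)
    finally show ?thesis .
  qed (simp add: wedge_infinite)
qed

text \<open>
  The constant sign \<open>s\<close> covers the two cases that occur: an even factor, and two factors of
  degree 1.
\<close>

lemma wedge_graded_commute:
  assumes "\<And>I J. \<lbrakk>\<alpha> I \<noteq> 0; \<beta> J \<noteq> 0\<rbrakk> \<Longrightarrow> (-1) ^ (card I * card J) = (s :: 'k::field)"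
  shows "wedge \<alpha> \<beta> = (\<lambda>K. s * wedge \<beta> \<alpha> K)"
proof
  fix K
  show "wedge \<alpha> \<beta> K = s * wedge \<beta> \<alpha> K"
  proof (cases "finite K")
    case True
    have "wedge \<alpha> \<beta> K = (\<Sum>I\<in>Pow K. shuffle_sign (K - I) I * \<alpha> (K - I) * \<beta> I)"
      unfolding wedge_eq
      by (rule sum.reindex_bij_witness[of _ "\<lambda>I. K - I" "\<lambda>I. K - I"]) (auto simp: double_diff)
    also have "\<dots> = (\<Sum>I\<in>Pow K. s * (shuffle_sign I (K - I) * \<beta> I * \<alpha> (K - I)))"
    proof (rule sum.cong [OF refl])
      fix I assume "I \<in> Pow K"
      then have "shuffle_sign (K - I) I = (-1) ^ (card I * card (K - I)) * (shuffle_sign I (K - I) :: 'k)"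
        using True by (intro shuffle_sign_swap) (auto intro: finite_subset)
      then show "shuffle_sign (K - I) I * \<alpha> (K - I) * \<beta> I = s * (shuffle_sign I (K - I) * \<beta> I * \<alpha> (K - I))"
        using assms[of "K - I" I] by (cases "\<alpha> (K - I) = 0 \<or> \<beta> I = 0") (auto simp: mult_ac)
    qed
    also have "\<dots> = s * wedge \<beta> \<alpha> K" by (simp add: wedge_eq sum_distrib_left)
    finally show ?thesis .
  qed (simp add: wedge_infinite)
qed

definition even_ext :: "'k::field ext \<Rightarrow> bool" where
  "even_ext \<alpha> \<longleftrightarrow> (\<forall>I. \<alpha> I \<noteq> 0 \<longrightarrow> even (card I))"

lemma wedge_even_commute: "even_ext \<alpha> \<Longrightarrow> wedge \<alpha> \<beta> = wedge \<beta> \<alpha>"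
  using wedge_graded_commute[of \<alpha> \<beta> 1] by (auto simp: even_ext_def)

lemma wedge_even_left_commute:
  "even_ext \<alpha> \<Longrightarrow> wedge \<alpha> (wedge \<beta> \<gamma>) = wedge \<beta> (wedge \<alpha> \<gamma>)"
  by (metis wedge_assoc wedge_even_commute)

lemma even_ext_wedge:
  assumes "even_ext \<alpha>" "even_ext \<beta>" shows "even_ext (wedge \<alpha> \<beta>)"
  unfolding even_ext_def
proof (intro allI impI)
  fix K assume nz: "wedge \<alpha> \<beta> K \<noteq> 0"
  then have "finite K" using wedge_infinite by blast
  from nz obtain I where "I \<subseteq> K" "\<alpha> I \<noteq> 0" "\<beta> (K - I) \<noteq> 0"
    unfolding wedge_eq by (metis (no_types, lifting) PowD mult_eq_0_iff sum.neutral)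
  then show "even (card K)" using assms \<open>finite K\<close> unfolding even_ext_def
    by (metis card_Diff_subset card_mono dvd_diffD finite_subset)
qed

definition ext_scale :: "'k::field \<Rightarrow> 'k ext \<Rightarrow> 'k ext" where
  "ext_scale a \<alpha> = (\<lambda>I. a * \<alpha> I)"

interpretation ext: vector_space ext_scale
  by standard (auto simp: ext_scale_def fun_eq_iff algebra_simps)

lemma wedge_add_right: "wedge \<alpha> (\<beta> + \<gamma>) = wedge \<alpha> \<beta> + wedge \<alpha> \<gamma>"
  by (auto simp: wedge_def fun_eq_iff sum.distrib algebra_simps)
lemma wedge_add_left: "wedge (\<alpha> + \<beta>) \<gamma> = wedge \<alpha> \<gamma> + wedge \<beta> \<gamma>"
  by (auto simp: wedge_def fun_eq_iff sum.distrib algebra_simps)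
lemma wedge_scale_right: "wedge \<alpha> (ext_scale a \<beta>) = ext_scale a (wedge \<alpha> \<beta>)"
  by (auto simp: wedge_def ext_scale_def fun_eq_iff sum_distrib_left mult_ac)
lemma wedge_scale_left: "wedge (ext_scale a \<alpha>) \<beta> = ext_scale a (wedge \<alpha> \<beta>)"
  by (auto simp: wedge_def ext_scale_def fun_eq_iff sum_distrib_left mult_ac)
lemma wedge_zero_right [simp]: "wedge \<alpha> 0 = 0"
  by (auto simp: wedge_def fun_eq_iff)
lemma wedge_zero_left [simp]: "wedge 0 \<alpha> = 0"
  by (auto simp: wedge_def fun_eq_iff)
lemma wedge_minus_left: "wedge (- \<alpha>) \<beta> = - wedge \<alpha> \<beta>"
  by (auto simp: wedge_def fun_eq_iff simp flip: sum_negf)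
text \<open>
  The pointwise rules for sums of functions are switched off here and in similar places: the
  simplifier applies them to the eta-expanded arguments of \<open>wedge\<close> and then no longer recognizes
  these arguments as sums.
\<close>

lemma wedge_sum_left: "wedge (\<Sum>k\<in>A. f k) \<beta> = (\<Sum>k\<in>A. wedge (f k) \<beta>)"
  by (induction A rule: infinite_finite_induct) (simp_all add: wedge_add_left del: plus_fun_apply zero_fun_apply)
lemma wedge_sum_right: "wedge \<beta> (\<Sum>k\<in>A. f k) = (\<Sum>k\<in>A. wedge \<beta> (f k))"
  by (induction A rule: infinite_finite_induct) (simp_all add: wedge_add_right del: plus_fun_apply zero_fun_apply)

lemma wedge_one: assumes "finite K" shows "wedge ext_one \<alpha> K = \<alpha> K"
proof -
  have "wedge ext_one \<alpha> K = (\<Sum>I\<in>{{}}. shuffle_sign I (K - I) * ext_one I * \<alpha> (K - I))"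
    unfolding wedge_eq using assms by (intro sum.mono_neutral_right) (auto simp: ext_one_def)
  then show ?thesis by (simp add: ext_one_def)
qed

text \<open>
  Forms on \<open>\<real>\<^sup>n\<close> without components of degree less than \<open>p\<close>.  The filtration is multiplicative and
  trivial for \<open>p > n\<close>, which is how products of high degree are seen to vanish; for \<open>p = 0\<close> it is
  the whole exterior algebra, inside the space of all functions on sets of numbers.
\<close>

definition ext_filtration :: "nat \<Rightarrow> nat \<Rightarrow> 'k::field ext set" where
  "ext_filtration n p = {\<alpha>. \<forall>I. \<alpha> I \<noteq> 0 \<longrightarrow> I \<subseteq> {..<n} \<and> p \<le> card I}"

lemma ext_filtration_wedge:
  assumes "\<alpha> \<in> ext_filtration n p" "\<beta> \<in> ext_filtration n q"
  shows "wedge \<alpha> \<beta> \<in> ext_filtration n (p + q)"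
  unfolding ext_filtration_def mem_Collect_eq
proof (intro allI impI)
  fix K assume nz: "wedge \<alpha> \<beta> K \<noteq> 0"
  then have "finite K" using wedge_infinite by blast
  from nz obtain I where I: "I \<subseteq> K" "\<alpha> I \<noteq> 0" "\<beta> (K - I) \<noteq> 0"
    unfolding wedge_eq by (metis (no_types, lifting) PowD mult_eq_0_iff sum.neutral)
  then have "I \<subseteq> {..<n}" "p \<le> card I" "K - I \<subseteq> {..<n}" "q \<le> card (K - I)"
    using assms by (auto simp: ext_filtration_def)
  moreover have "card (K - I) = card K - card I" "card I \<le> card K"
    using I \<open>finite K\<close> by (auto simp: card_Diff_subset finite_subset card_mono)
  ultimately show "K \<subseteq> {..<n} \<and> p + q \<le> card K" by auto
qed

lemma ext_filtration_above: "n < p \<Longrightarrow> \<alpha> \<in> ext_filtration n p \<Longrightarrow> \<alpha> = 0"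
proof -
  assume "n < p" "\<alpha> \<in> ext_filtration n p"
  moreover have "card I \<le> n" if "I \<subseteq> {..<n}" for I using card_mono[OF _ that] by simp
  ultimately have "\<alpha> I = 0" for I
    unfolding ext_filtration_def mem_Collect_eq by (metis leD le_trans)
  then show "\<alpha> = 0" by (simp add: fun_eq_iff)
qed

lemma ext_filtration_mono: "q \<le> p \<Longrightarrow> ext_filtration n p \<subseteq> ext_filtration n q"
  by (auto simp: ext_filtration_def)

lemma subspace_ext_filtration: "ext.subspace (ext_filtration n p)"
proof (rule ext.subspaceI)
  fix \<alpha> \<beta> :: "'a ext" assume "\<alpha> \<in> ext_filtration n p" "\<beta> \<in> ext_filtration n p"
  then show "\<alpha> + \<beta> \<in> ext_filtration n p"
    unfolding ext_filtration_def mem_Collect_eq plus_fun_apply by (metis add_0)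
qed (auto simp: ext_filtration_def ext_scale_def)

text \<open>
Contraction with the \<open>i\<close>-th coordinate vector field.
\<close>

definition interior_coord :: "nat \<Rightarrow> 'k::field ext \<Rightarrow> 'k ext" where
  "interior_coord i \<alpha> I = (if i \<in> I then 0 else shuffle_sign {i} I * \<alpha> (insert i I))"

lemma interior_mult_eq: "interior_mult n v \<alpha> = (\<Sum>i<n. ext_scale (of_real (v i)) (interior_coord i \<alpha>))"
proof
  fix I
  have c: "shuffle_sign {i} I = ((-1) ^ card {j \<in> I. j < i} :: 'a)" for i
  proof -
    have "{(i', j). i' \<in> {i} \<and> j \<in> I \<and> j < i'} = Pair i ` {j \<in> I. j < i}" by auto
    then show ?thesis by (simp add: shuffle_sign_def card_image inj_on_def)
  qed
  have "(\<Sum>i<n. ext_scale (of_real (v i)) (interior_coord i \<alpha>)) I =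
      (\<Sum>i<n. of_real (v i) * interior_coord i \<alpha> I)"
    by (simp add: sum_fun_apply ext_scale_def)
  also have "\<dots> = (\<Sum>i\<in>{..<n} - I. of_real (v i) * interior_coord i \<alpha> I)"
    by (rule sum.mono_neutral_right) (auto simp: interior_coord_def)
  also have "\<dots> = interior_mult n v \<alpha> I"
    unfolding interior_mult_def by (rule sum.cong) (auto simp: interior_coord_def c)
  finally show "interior_mult n v \<alpha> I = (\<Sum>i<n. ext_scale (of_real (v i)) (interior_coord i \<alpha>)) I" ..
qed

lemma sum_Pow_insert:
  assumes "finite L" "i \<notin> L"
  shows "(\<Sum>I\<in>Pow (insert i L). f I) = (\<Sum>I\<in>Pow L. f I) + (\<Sum>I\<in>Pow L. f (insert i I))"
proof -
  have "(\<Sum>I\<in>Pow (insert i L). f I) = (\<Sum>I\<in>Pow L. f I) + (\<Sum>I\<in>insert i ` Pow L. f I)"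
    unfolding Pow_insert using assms by (intro sum.union_disjoint) auto
  also have "(\<Sum>I\<in>insert i ` Pow L. f I) = (\<Sum>I\<in>Pow L. f (insert i I))"
  proof (subst sum.reindex)
    show "inj_on (insert i) (Pow L)"
      using assms by (meson PowD inj_onI insert_ident subsetD)
  qed simp
  finally show ?thesis .
qed

text \<open>
  The coefficients at \<open>K\<close> are compared according to whether \<open>i\<close> belongs to \<open>K\<close>.  If not, the subsets
  of \<open>insert i K\<close> which contain \<open>i\<close> give the first summand and the others the second one.  If so, the
  left side vanishes and the two summands on the right cancel term by term.
\<close>

lemma interior_coord_wedge:
  assumes \<beta>: "even_ext \<beta>"
  shows "interior_coord i (wedge \<beta> \<alpha>) = wedge (interior_coord i \<beta>) \<alpha> + wedge \<beta> (interior_coord i \<alpha>)"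
proof
  fix K
  consider (inf) "infinite K" | (out) "finite K" "i \<notin> K" | (inn) L where "finite L" "i \<notin> L" "K = insert i L"
    by (metis Set.set_insert finite_insert)
  then show "interior_coord i (wedge \<beta> \<alpha>) K = (wedge (interior_coord i \<beta>) \<alpha> + wedge \<beta> (interior_coord i \<alpha>)) K"
  proof cases
    case inf
    then show ?thesis by (simp add: wedge_infinite interior_coord_def)
  next
    case out
    have ins: "insert i K - I = insert i (K - I)" "insert i K - insert i I = K - I" if "I \<subseteq> K" for I using that out by auto
    have fin: "finite I" if "I \<subseteq> K" for I using that out finite_subset by auto
    have "interior_coord i (wedge \<beta> \<alpha>) K =
       (\<Sum>I\<in>Pow K. shuffle_sign {i} K * shuffle_sign I (insert i K - I) * \<beta> I * \<alpha> (insert i K - I)) +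
       (\<Sum>I\<in>Pow K. shuffle_sign {i} K * shuffle_sign (insert i I) (insert i K - insert i I) * \<beta> (insert i I) * \<alpha> (insert i K - insert i I))"
      using out by (simp add: interior_coord_def wedge_eq sum_Pow_insert sum_distrib_left algebra_simps)
    also have "(\<Sum>I\<in>Pow K. shuffle_sign {i} K * shuffle_sign I (insert i K - I) * \<beta> I * \<alpha> (insert i K - I)) = wedge \<beta> (interior_coord i \<alpha>) K"
      unfolding wedge_eq
    proof (rule sum.cong [OF refl])
      fix I assume "I \<in> Pow K"
      then have I: "I \<subseteq> K" by auto
      define J where "J = K - I"
      have J: "K = I \<union> J" "I \<inter> J = {}" "finite I" "finite J" "insert i K - I = {i} \<union> J" "i \<notin> I" "i \<notin> J"
        using I fin out ins by (auto simp: J_def)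
      have "\<beta> I * shuffle_sign I {i} = \<beta> I * (shuffle_sign {i} I :: 'a)"
        using \<beta> J shuffle_sign_swap[of "{i}" I, where 'k = 'a] by (cases "\<beta> I = 0") (auto simp: even_ext_def)
      then have s: "\<beta> I * (shuffle_sign I {i} * shuffle_sign {i} I) = \<beta> I"
        by (metis mult.assoc mult.commute mult.right_neutral shuffle_sign_squared)
      have "shuffle_sign {i} K = shuffle_sign {i} I * (shuffle_sign {i} J :: 'a)"
        unfolding J(1) using J by (subst shuffle_sign_Un_right) auto
      moreover have "shuffle_sign I ({i} \<union> J) = shuffle_sign I {i} * (shuffle_sign I J :: 'a)"
        using J by (subst shuffle_sign_Un_right) auto
      ultimately have "shuffle_sign {i} K * shuffle_sign I (insert i K - I) * \<beta> I =
          (\<beta> I * (shuffle_sign I {i} * shuffle_sign {i} I)) * (shuffle_sign I J * shuffle_sign {i} J)"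
        unfolding J(5) by (simp only: mult_ac)
      also have "\<dots> = shuffle_sign I J * \<beta> I * shuffle_sign {i} J" unfolding s by (simp only: mult_ac)
      finally have "shuffle_sign {i} K * shuffle_sign I (insert i K - I) * \<beta> I = shuffle_sign I J * \<beta> I * shuffle_sign {i} J" .
      then show "shuffle_sign {i} K * shuffle_sign I (insert i K - I) * \<beta> I * \<alpha> (insert i K - I) =
         shuffle_sign I (K - I) * \<beta> I * interior_coord i \<alpha> (K - I)"
        using J(7) by (auto simp: interior_coord_def J_def [symmetric] J(5))
    qed
    also have "(\<Sum>I\<in>Pow K. shuffle_sign {i} K * shuffle_sign (insert i I) (insert i K - insert i I) * \<beta> (insert i I) * \<alpha> (insert i K - insert i I)) = wedge (interior_coord i \<beta>) \<alpha> K"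
      unfolding wedge_eq
    proof (rule sum.cong [OF refl])
      fix I assume "I \<in> Pow K"
      then have I: "I \<subseteq> K" by auto
      define J where "J = K - I"
      have J: "K = I \<union> J" "I \<inter> J = {}" "finite I" "finite J" "insert i K - insert i I = J" "i \<notin> I" "i \<notin> J"
        using I fin out ins by (auto simp: J_def)
      have "shuffle_sign {i} K = shuffle_sign {i} I * (shuffle_sign {i} J :: 'a)"
        unfolding J(1) using J by (subst shuffle_sign_Un_right) auto
      moreover have "shuffle_sign ({i} \<union> I) J = shuffle_sign {i} J * (shuffle_sign I J :: 'a)"
        using J by (subst shuffle_sign_Un_left) auto
      ultimately show "shuffle_sign {i} K * shuffle_sign (insert i I) (insert i K - insert i I) * \<beta> (insert i I) * \<alpha> (insert i K - insert i I) =
         shuffle_sign I (K - I) * interior_coord i \<beta> I * \<alpha> (K - I)"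
        using J(6) unfolding J(5) by (simp add: interior_coord_def J_def [symmetric] mult_ac)
    qed
    finally show ?thesis by simp
  next
    case inn
    have ins: "insert i L - I = insert i (L - I)" "insert i L - insert i I = L - I" if "I \<subseteq> L" for I using that inn by auto
    have fin: "finite I" if "I \<subseteq> L" for I using that inn finite_subset by auto
    have "wedge (interior_coord i \<beta>) \<alpha> K = (\<Sum>I\<in>Pow L. shuffle_sign I (insert i L - I) * interior_coord i \<beta> I * \<alpha> (insert i L - I))"
      using inn by (simp add: wedge_eq sum_Pow_insert interior_coord_def)
    moreover have "wedge \<beta> (interior_coord i \<alpha>) K = (\<Sum>I\<in>Pow L. shuffle_sign (insert i I) (L - I) * \<beta> (insert i I) * interior_coord i \<alpha> (L - I))"
    proof -
      have "(\<Sum>I\<in>Pow L. shuffle_sign I (insert i L - I) * \<beta> I * interior_coord i \<alpha> (insert i L - I)) = 0"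
        by (rule sum.neutral) (use inn in \<open>auto simp: interior_coord_def\<close>)
      then show ?thesis using inn by (simp add: wedge_eq sum_Pow_insert)
    qed
    moreover have "shuffle_sign I (insert i L - I) * interior_coord i \<beta> I * \<alpha> (insert i L - I)
       = - (shuffle_sign (insert i I) (L - I) * \<beta> (insert i I) * interior_coord i \<alpha> (L - I))" if I: "I \<subseteq> L" for I
    proof -
      define J where "J = L - I"
      have J: "I \<inter> J = {}" "finite I" "finite J" "insert i L - I = {i} \<union> J" "i \<notin> I" "i \<notin> J"
        using I fin inn ins by (auto simp: J_def)
      have "\<beta> (insert i I) * shuffle_sign I {i} = - (\<beta> (insert i I) * (shuffle_sign {i} I :: 'a))"
        using \<beta> J shuffle_sign_swap[of "{i}" I, where 'k = 'a] by (cases "\<beta> (insert i I) = 0") (auto simp: even_ext_def)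
      then have s: "\<beta> (insert i I) * (shuffle_sign I {i} * shuffle_sign {i} I) = - \<beta> (insert i I)"
        by (simp add: mult.assoc [symmetric])
      have "shuffle_sign I ({i} \<union> J) = shuffle_sign I {i} * (shuffle_sign I J :: 'a)"
        using J by (subst shuffle_sign_Un_right) auto
      moreover have "shuffle_sign ({i} \<union> I) J = shuffle_sign {i} J * (shuffle_sign I J :: 'a)"
        using J by (subst shuffle_sign_Un_left) auto
      ultimately show ?thesis unfolding J_def [symmetric] J(4) using J(5,6) s
        by (simp add: interior_coord_def mult_ac)
    qed
    ultimately show ?thesis using inn by (simp add: interior_coord_def flip: sum.distrib)
  qed
qed

lemma interior_mult_wedge:
  "even_ext \<beta> \<Longrightarrow> interior_mult n v (wedge \<beta> \<alpha>) = wedge (interior_mult n v \<beta>) \<alpha> + wedge \<beta> (interior_mult n v \<alpha>)"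
  by (simp add: interior_mult_eq interior_coord_wedge ext.scale_right_distrib sum.distrib
      wedge_sum_left wedge_sum_right wedge_scale_left wedge_scale_right del: plus_fun_apply)

lemma interior_mult_add: "interior_mult n v (\<alpha> + \<beta>) = interior_mult n v \<alpha> + interior_mult n v \<beta>"
  by (simp add: interior_mult_def fun_eq_iff sum.distrib algebra_simps)

lemma interior_mult_scale: "interior_mult n v (ext_scale a \<alpha>) = ext_scale a (interior_mult n v \<alpha>)"
  by (simp add: interior_mult_def ext_scale_def fun_eq_iff sum_distrib_left mult_ac)

lemma interior_mult_filtration:
  assumes "\<alpha> \<in> ext_filtration n p" shows "interior_mult n v \<alpha> \<in> ext_filtration n (p - 1)"
  unfolding ext_filtration_def mem_Collect_eq
proof (intro allI impI)
  fix I assume "interior_mult n v \<alpha> I \<noteq> 0"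
  then obtain i where "i \<in> {..<n} - I" "\<alpha> (insert i I) \<noteq> 0"
    unfolding interior_mult_def by (metis (no_types, lifting) mult_zero_right sum.neutral)
  then have i: "insert i I \<subseteq> {..<n}" "p \<le> card (insert i I)" "i \<notin> I"
    using assms by (auto simp: ext_filtration_def)
  then have "finite I" by (meson finite_insert finite_lessThan finite_subset)
  with i show "I \<subseteq> {..<n} \<and> p - 1 \<le> card I" by auto
qed

text \<open>
  Reversal multiplies the component of degree \<open>p\<close> by \<open>(-1)\<^sup>p\<^sup>(\<^sup>p\<^sup>-\<^sup>1\<^sup>)\<^sup>/\<^sup>2\<close>, and this sign changes when
  \<open>p\<close> increases by 2.
\<close>

lemma reversal_wedge:
  assumes "\<forall>I. b I \<noteq> 0 \<longrightarrow> card I = 2"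
  shows "reversal (wedge b \<alpha>) = - wedge b (reversal \<alpha>)"
proof
  fix K
  show "reversal (wedge b \<alpha>) K = (- wedge b (reversal \<alpha>)) K"
  proof (cases "finite K")
    case True
    have "(-1) ^ (card K * (card K - 1) div 2) * (b I * x) =
        - (b I * ((-1) ^ (card (K - I) * (card (K - I) - 1) div 2) * x))" if "I \<subseteq> K" for I x
    proof (cases "b I = 0")
      case False
      then have c: "card I = 2" using assms by auto
      define m where "m = card (K - I)"
      have "card (K - I) = card K - card I" "card I \<le> card K"
        using that True by (auto simp: card_Diff_subset finite_subset card_mono)
      then have m: "card K = m + 2" using c by (simp add: m_def)
      have "(m + 2) * (m + 2 - 1) div 2 = m * (m - 1) div 2 + (2 * m + 1)"
      proof (cases m)
        case (Suc k)
        have "(m + 2) * (m + 2 - 1) = m * (m - 1) + 2 * (2 * m + 1)" unfolding Suc by (simp add: algebra_simps)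
        then show ?thesis by simp
      qed simp
      then show ?thesis unfolding m m_def [symmetric] by (simp add: power_add mult_ac)
    qed simp
    note sgn = this
    have "reversal (wedge b \<alpha>) K = (\<Sum>I\<in>Pow K. (-1) ^ (card K * (card K - 1) div 2) *
        (b I * (shuffle_sign I (K - I) * \<alpha> (K - I))))"
      by (simp add: reversal_def wedge_eq sum_distrib_left mult_ac)
    also have "\<dots> = (\<Sum>I\<in>Pow K. - (b I * ((-1) ^ (card (K - I) * (card (K - I) - 1) div 2) *
        (shuffle_sign I (K - I) * \<alpha> (K - I)))))"
      by (intro sum.cong refl sgn) auto
    also have "\<dots> = (- wedge b (reversal \<alpha>)) K"
      by (simp add: reversal_def wedge_eq sum_negf mult_ac)
    finally show ?thesis .
  qed (simp add: wedge_infinite reversal_def)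
qed

section \<open>Exponentials of nilpotent operators\<close>

text \<open>
  The exponential series of \<open>b\<close> at \<open>x\<close>, up to order \<open>N\<close>.  Multiplication by a 2-form is nilpotent,
  so that the truncation at the dimension is the full series.
\<close>

definition op_exp :: "('k::field_char_0 \<Rightarrow> 'v \<Rightarrow> 'v) \<Rightarrow> nat \<Rightarrow> ('v \<Rightarrow> 'v) \<Rightarrow> 'v \<Rightarrow> 'v::ab_group_add" where
  "op_exp sc N b x = (\<Sum>k\<le>N. sc (1 / fact k) ((b ^^ k) x))"

text \<open>
  Moving \<open>D\<close> through \<open>b\<^sup>k\<close> produces \<open>k\<close> equal terms \<open>C b\<^sup>k\<^sup>-\<^sup>1\<close>, and \<open>k / k! = 1 / (k - 1)!\<close>.  The shift
  of the index loses the last term of the series, which \<open>C\<close> is assumed to kill.  The set \<open>U\<close> is the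
  domain on which \<open>D\<close> satisfies the commutation rule: for the exterior derivative, the smooth forms.
\<close>

lemma op_exp_twist:
  fixes sc :: "'k::field_char_0 \<Rightarrow> 'v \<Rightarrow> 'v::ab_group_add"
  assumes V: "vector_space sc"
    and b_add: "\<And>x y. b (x + y) = b x + b y" and b_scale: "\<And>a x. b (sc a x) = sc a (b x)"
    and C_add: "\<And>x y. C (x + y) = C x + C y" and C_scale: "\<And>a x. C (sc a x) = sc a (C x)"
    and U: "\<And>x. x \<in> U \<Longrightarrow> b x \<in> U"
    and comm: "\<And>x. x \<in> U \<Longrightarrow> D (b x) = C x + b (D x)"
    and Cb: "\<And>x. x \<in> U \<Longrightarrow> C (b x) = b (C x)"
    and D_sum: "D (op_exp sc N b x) = (\<Sum>k\<le>N. sc (1 / fact k) (D ((b ^^ k) x)))"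
    and nilp: "C ((b ^^ N) x) = 0"
    and x: "x \<in> U"
  shows "D (op_exp sc N b x) = C (op_exp sc N b x) + op_exp sc N b (D x)"
proof -
  interpret vector_space sc by (rule V)
  have bk: "(b ^^ k) x \<in> U" for k using x U by (induction k) auto
  have Cbk: "b (C ((b ^^ k) x)) = C ((b ^^ Suc k) x)" for k using Cb[OF bk] by simp
  have C_sum: "C (\<Sum>k\<in>A. f k) = (\<Sum>k\<in>A. C (f k))" for A :: "nat set" and f
  proof -
    have C0: "C 0 = 0" using C_add[of 0 0] by simp
    show ?thesis by (induction A rule: infinite_finite_induct) (simp_all add: C0 C_add)
  qed
  have pow: "D ((b ^^ Suc k) x) = sc (of_nat (Suc k)) (C ((b ^^ k) x)) + (b ^^ Suc k) (D x)" for k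
  proof (induction k)
    case 0
    then show ?case using comm[OF x] by simp
  next
    case (Suc k)
    have "D ((b ^^ Suc (Suc k)) x) = C ((b ^^ Suc k) x) + b (D ((b ^^ Suc k) x))"
      using comm[OF bk[of "Suc k"]] by simp
    also have "b (D ((b ^^ Suc k) x)) = sc (of_nat (Suc k)) (C ((b ^^ Suc k) x)) + (b ^^ Suc (Suc k)) (D x)"
      unfolding Suc b_add b_scale Cbk by simp
    finally show ?case
      by (simp only: of_nat_Suc [of "Suc k"] scale_left_distrib scale_one add.assoc)
  qed
  have "D (op_exp sc N b x) = D x + (\<Sum>k<N. sc (1 / fact (Suc k)) (D ((b ^^ Suc k) x)))"
    unfolding D_sum by (subst sum.atMost_shift) simp
  also have "\<dots> = (\<Sum>k<N. sc (1 / fact k) (C ((b ^^ k) x))) +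
      (D x + (\<Sum>k<N. sc (1 / fact (Suc k)) ((b ^^ Suc k) (D x))))"
  proof -
    have "sc (1 / fact (Suc k)) (D ((b ^^ Suc k) x)) =
      sc (1 / fact k) (C ((b ^^ k) x)) + sc (1 / fact (Suc k)) ((b ^^ Suc k) (D x))" for k
    proof -
      have "(1 / fact (Suc k)) * of_nat (Suc k) = (1 / fact k :: 'k)"
        by (simp add: field_simps del: of_nat_Suc)
      then show ?thesis unfolding pow scale_right_distrib scale_scale by (simp del: of_nat_Suc fact_Suc)
    qed
    then show ?thesis by (simp add: sum.distrib algebra_simps del: fact_Suc funpow.simps)
  qed
  also have "(D x + (\<Sum>k<N. sc (1 / fact (Suc k)) ((b ^^ Suc k) (D x)))) = op_exp sc N b (D x)"
    unfolding op_exp_def by (subst sum.atMost_shift) simp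
  also have "(\<Sum>k<N. sc (1 / fact k) (C ((b ^^ k) x))) = C (op_exp sc N b x)"
    unfolding op_exp_def C_sum C_scale lessThan_Suc_atMost [symmetric] by (simp add: nilp)
  finally show ?thesis .
qed

text \<open>
  The coefficient of \<open>b\<^sup>m\<close> in the product of the two series is \<open>(1 - 1)\<^sup>m / m!\<close>.  Nilpotency allows
  to pass from the square of pairs of exponents to the triangle.
\<close>

lemma op_exp_neg_inverse:
  fixes sc :: "'k::field_char_0 \<Rightarrow> 'v \<Rightarrow> 'v::ab_group_add"
  assumes V: "vector_space sc"
    and b_add: "\<And>x y. b (x + y) = b x + b y" and b_scale: "\<And>a x. b (sc a x) = sc a (b x)"
    and nilp: "\<And>k. N < k \<Longrightarrow> (b ^^ k) x = 0"
  shows "op_exp sc N (\<lambda>y. - b y) (op_exp sc N b x) = x"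
proof -
  interpret vector_space sc by (rule V)
  have b0: "b 0 = 0" using b_add[of 0 0] by simp
  have b_minus: "b (- y) = - b y" for y using b_add[of y "- y"] b0 by (simp add: eq_neg_iff_add_eq_0 add.commute)
  have bk_add: "(b ^^ k) (y + z) = (b ^^ k) y + (b ^^ k) z" for k y z
    by (induction k) (auto simp: b_add)
  have bk_scale: "(b ^^ k) (sc a y) = sc a ((b ^^ k) y)" for k a y
    by (induction k) (auto simp: b_scale)
  have bk0: "(b ^^ k) 0 = 0" for k by (induction k) (auto simp: b0)
  have bk_sum: "(b ^^ k) (\<Sum>j\<in>A. f j) = (\<Sum>j\<in>A. (b ^^ k) (f j))" for k and A :: "nat set" and f
    by (induction A rule: infinite_finite_induct) (simp_all add: bk0 bk_add)
  have nb: "((\<lambda>y. - b y) ^^ k) y = sc ((-1) ^ k) ((b ^^ k) y)" for k y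
    by (induction k) (auto simp: b_scale)
  have "op_exp sc N (\<lambda>y. - b y) (op_exp sc N b x) =
      (\<Sum>i\<le>N. \<Sum>j\<le>N. sc ((-1) ^ i / (fact i * fact j)) ((b ^^ (i + j)) x))"
    by (simp add: op_exp_def nb bk_sum bk_scale scale_sum_right funpow_add)
  also have "\<dots> = (\<Sum>(i, j)\<in>{..N} \<times> {..N}. sc ((-1) ^ i / (fact i * fact j)) ((b ^^ (i + j)) x))"
    by (simp add: sum.cartesian_product)
  also have "\<dots> = (\<Sum>(i, j)\<in>{(i, j). i + j \<le> N}. sc ((-1) ^ i / (fact i * fact j)) ((b ^^ (i + j)) x))"
    by (rule sum.mono_neutral_right) (auto simp: nilp intro: ccontr)
  also have "\<dots> = (\<Sum>m\<le>N. \<Sum>i\<le>m. sc ((-1) ^ i / (fact i * fact (m - i))) ((b ^^ (i + (m - i))) x))"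
    by (rule sum.triangle_reindex_eq)
  also have "\<dots> = (\<Sum>m\<le>N. if m = 0 then x else 0)"
  proof (rule sum.cong [OF refl])
    fix m
    have "(\<Sum>i\<le>m. sc ((-1) ^ i / (fact i * fact (m - i))) ((b ^^ (i + (m - i))) x)) =
        (\<Sum>i\<le>m. sc ((-1) ^ i * of_nat (m choose i) / fact m) ((b ^^ m) x))"
      by (rule sum.cong [OF refl]) (auto simp: binomial_fact)
    also have "\<dots> = sc ((\<Sum>i\<le>m. (-1) ^ i * of_nat (m choose i)) / fact m) ((b ^^ m) x)"
      by (simp add: scale_sum_left sum_divide_distrib)
    also have "\<dots> = (if m = 0 then x else 0)"
      using choose_alternating_sum[of m, where 'a = 'k] by simp
    finally show "(\<Sum>i\<le>m. sc ((-1) ^ i / (fact i * fact (m - i))) ((b ^^ (i + (m - i))) x)) =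
      (if m = 0 then x else 0)" .
  qed
  also have "\<dots> = x" by simp
  finally show ?thesis .
qed

section \<open>Conjugation by the exponential of a 2-form\<close>

lemmas ext_filtration_closed =
  ext.subspace_add[OF subspace_ext_filtration] ext.subspace_scale[OF subspace_ext_filtration]
  ext.subspace_0[OF subspace_ext_filtration] ext.subspace_neg[OF subspace_ext_filtration]

lemma ext_filtration_0_wedge:
  "\<alpha> \<in> ext_filtration n p \<Longrightarrow> \<beta> \<in> ext_filtration n 0 \<Longrightarrow> wedge \<alpha> \<beta> \<in> ext_filtration n 0"
  using ext_filtration_wedge[of \<alpha> n p \<beta> 0] ext_filtration_mono[of 0 "p + 0" n] by auto

lemma wedge_power_filtration:
  assumes "b \<in> ext_filtration n 2" "\<alpha> \<in> ext_filtration n p"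
  shows "(wedge b ^^ k) \<alpha> \<in> ext_filtration n (2 * k + p)"
proof (induction k)
  case (Suc k)
  then show ?case using ext_filtration_wedge[OF assms(1) Suc] by simp
qed (use assms in simp)

lemma ext_one_filtration: "ext_one \<in> ext_filtration n 0"
  by (auto simp: ext_filtration_def ext_one_def split: if_splits)

lemma ext_exp_eq: "ext_exp n b = op_exp ext_scale n (wedge b) ext_one"
  by (simp add: ext_exp_def op_exp_def fun_eq_iff sum_fun_apply ext_scale_def)

text \<open>
  The series of the operator \<open>wedge b\<close> is the product with the series \<open>e\<^sup>b\<close>, by associativity.  The
  hypothesis excludes coefficients at infinite sets, which the unit of the algebra annihilates.
\<close>

lemma wedge_ext_exp:
  assumes "\<alpha> \<in> ext_filtration n 0"
  shows "wedge (ext_exp n b) \<alpha> = op_exp ext_scale n (wedge b) \<alpha>"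
proof -
  have one: "wedge ext_one \<alpha> = \<alpha>"
  proof
    fix K show "wedge ext_one \<alpha> K = \<alpha> K"
      using assms by (cases "finite K")
        (auto simp: wedge_one wedge_infinite ext_filtration_def intro: finite_subset)
  qed
  have "wedge ((wedge b ^^ k) ext_one) \<alpha> = (wedge b ^^ k) \<alpha>" for k
    by (induction k) (simp_all add: one wedge_assoc)
  then show ?thesis by (simp add: ext_exp_eq op_exp_def wedge_sum_left wedge_scale_left)
qed

lemma ext_exp_filtration:
  assumes "b \<in> ext_filtration n 2"
  shows "ext_exp n b \<in> ext_filtration n 0"
  unfolding ext_exp_eq op_exp_def
proof (intro ext.subspace_sum[OF subspace_ext_filtration] ext_filtration_closed)
  fix k show "(wedge b ^^ k) ext_one \<in> ext_filtration n 0"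
    using wedge_power_filtration[OF assms ext_one_filtration] ext_filtration_mono[of 0] by blast
qed

lemma even_ext_exp:
  assumes "even_ext b" shows "even_ext (ext_exp n b)"
proof -
  have "even_ext ((wedge b ^^ k) ext_one)" for k
    by (induction k) (auto simp: even_ext_wedge assms, auto simp: even_ext_def ext_one_def)
  then show ?thesis unfolding even_ext_def ext_exp_def
    by (metis (no_types, lifting) divide_eq_0_iff sum.neutral)
qed

lemma ext_exp_neg_inverse:
  assumes b: "b \<in> ext_filtration n 2" and \<alpha>: "\<alpha> \<in> ext_filtration n 0"
  shows "wedge (ext_exp n (- b)) (wedge (ext_exp n b) \<alpha>) = \<alpha>"
proof -
  have "wedge (ext_exp n b) \<alpha> \<in> ext_filtration n 0"
    using ext_filtration_0_wedge[OF ext_exp_filtration] assms by blast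
  moreover have "wedge (- b) = (\<lambda>y. - wedge b y)" by (simp add: wedge_minus_left fun_eq_iff)
  moreover have "op_exp ext_scale n (\<lambda>y. - wedge b y) (op_exp ext_scale n (wedge b) \<alpha>) = \<alpha>"
  proof (rule op_exp_neg_inverse[OF ext.vector_space_axioms])
    fix k assume "n < k"
    then show "(wedge b ^^ k) \<alpha> = 0"
      using ext_filtration_above[OF _ wedge_power_filtration[OF assms]] by simp
  qed (simp_all add: wedge_add_right wedge_scale_right)
  ultimately show ?thesis using \<alpha> by (simp add: wedge_ext_exp)
qed

lemma interior_mult_sum: "interior_mult n v (\<Sum>k\<in>A. f k) = (\<Sum>k\<in>A. interior_mult n v (f k))"
proof -
  have "interior_mult n v 0 = 0" by (simp add: interior_mult_def fun_eq_iff)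
  then show ?thesis
    by (induction A rule: infinite_finite_induct)
      (simp_all add: interior_mult_add del: plus_fun_apply zero_fun_apply)
qed

lemma interior_mult_ext_exp:
  assumes b: "b \<in> ext_filtration n 2" "even_ext b" and \<alpha>: "\<alpha> \<in> ext_filtration n 0"
  shows "interior_mult n v (wedge (ext_exp n b) \<alpha>) =
     wedge (interior_mult n v b) (wedge (ext_exp n b) \<alpha>) + wedge (ext_exp n b) (interior_mult n v \<alpha>)"
proof -
  have i: "interior_mult n v b \<in> ext_filtration n 1"
    using interior_mult_filtration[OF b(1)] by simp
  have \<iota>: "interior_mult n v \<alpha> \<in> ext_filtration n 0"
    using interior_mult_filtration[OF \<alpha>] by simp
  have "interior_mult n v (op_exp ext_scale n (wedge b) \<alpha>) =
     wedge (interior_mult n v b) (op_exp ext_scale n (wedge b) \<alpha>) +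
     op_exp ext_scale n (wedge b) (interior_mult n v \<alpha>)"
  proof (rule op_exp_twist[OF ext.vector_space_axioms, where U = UNIV])
    show "interior_mult n v (op_exp ext_scale n (wedge b) \<alpha>) =
        (\<Sum>k\<le>n. ext_scale (1 / fact k) (interior_mult n v ((wedge b ^^ k) \<alpha>)))"
      by (simp add: op_exp_def interior_mult_sum interior_mult_scale)
    \<comment> \<open>a form of degree at least \<open>2 n + 1\<close>\<close>
    show "wedge (interior_mult n v b) ((wedge b ^^ n) \<alpha>) = 0"
      using ext_filtration_above[OF _ ext_filtration_wedge[OF i wedge_power_filtration[OF b(1) \<alpha>]]] by simp
    show "wedge (interior_mult n v b) (wedge b x) = wedge b (wedge (interior_mult n v b) x)" for x
      by (rule wedge_even_left_commute[OF b(2), symmetric])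
  qed (simp_all add: wedge_add_right wedge_scale_right interior_mult_wedge b(2) del: plus_fun_apply)
  then show ?thesis using \<alpha> \<iota> by (simp add: wedge_ext_exp)
qed

lemma covector_support: "covector n a I \<noteq> 0 \<Longrightarrow> \<exists>i<n. I = {i}"
  by (rule ccontr) (auto simp: covector_def intro!: sum.neutral)

lemma covector_filtration: "covector n a \<in> ext_filtration n 1"
  unfolding ext_filtration_def by (auto dest!: covector_support)

lemma hat_op_filtration:
  assumes b: "b \<in> ext_filtration n 2" and \<alpha>: "\<alpha> \<in> ext_filtration n 0"
  shows "hat_op n G b v \<alpha> \<in> ext_filtration n 0"
proof -
  have i: "interior_mult n v b \<in> ext_filtration n 1"
    using interior_mult_filtration[OF b] by simp
  have "interior_mult n v \<alpha> \<in> ext_filtration n 0"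
    using interior_mult_filtration[OF \<alpha>] by simp
  then show ?thesis unfolding hat_op_def
    using ext_filtration_0_wedge[OF ext_filtration_closed(1)[OF covector_filtration i] \<alpha>]
    by (intro ext_filtration_closed)
qed

text \<open>
  The contraction produces \<open>\<iota>\<^sub>vb\<close> when it passes \<open>e\<^sup>b\<close>, which is the part of \<open>hat_op n G b v\<close> that is
  absent from \<open>hat_op n G 0 v\<close>.
\<close>

lemma hat_op_ext_exp:
  assumes b: "b \<in> ext_filtration n 2" "even_ext b" and \<alpha>: "\<alpha> \<in> ext_filtration n 0"
  shows "wedge (ext_exp n b) (hat_op n G b v \<alpha>) = hat_op n G 0 v (wedge (ext_exp n b) \<alpha>)"
proof -
  note even = even_ext_exp[OF b(2), of n]
  have "interior_mult n v 0 = (0 :: 'a ext)" by (simp add: interior_mult_def fun_eq_iff)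
  then show ?thesis
    by (simp add: hat_op_def interior_mult_ext_exp[OF assms] wedge_add_right wedge_add_left
      wedge_even_left_commute[OF even] add_ac del: plus_fun_apply)
qed

lemma reversal_ext_exp:
  assumes b: "\<forall>I. b I \<noteq> 0 \<longrightarrow> card I = 2" and \<alpha>: "\<alpha> \<in> ext_filtration n 0"
  shows "reversal (wedge (ext_exp n b) \<alpha>) = wedge (ext_exp n (- b)) (reversal \<alpha>)"
proof -
  have r: "reversal \<alpha> \<in> ext_filtration n 0" using \<alpha> by (auto simp: ext_filtration_def reversal_def)
  have lin: "reversal (\<Sum>k\<in>A. ext_scale (c k) (f k)) = (\<Sum>k\<in>A. ext_scale (c k) (reversal (f k)))"
    for A :: "nat set" and c and f :: "nat \<Rightarrow> 'a ext"
    by (simp add: fun_eq_iff reversal_def sum_fun_apply ext_scale_def sum_distrib_left sum_distrib_right mult_ac)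
  have "reversal ((wedge b ^^ k) \<alpha>) = (wedge (- b) ^^ k) (reversal \<alpha>)" for k
    by (induction k) (simp_all add: reversal_wedge b wedge_minus_left del: uminus_apply)
  then show ?thesis using \<alpha> r by (simp add: wedge_ext_exp op_exp_def lin)
qed

text \<open>
  If \<open>y\<close> is the image of \<open>\<alpha>\<close> under the product of the operators of \<open>b\<close>, the product of the operators
  of \<open>0\<close> maps \<open>e\<^sup>b \<and> \<alpha>\<close> to \<open>e\<^sup>b \<and> y\<close>, and reversal makes \<open>e\<^sup>-\<^sup>b \<and> reversal y\<close> of it.  The frame is chosen
  from \<open>n\<close> and \<open>G\<close> alone, hence it is the same on both sides.
\<close>

lemma born_infeld_star_ext_exp:
  fixes b \<alpha> :: "'k::real_field ext"
  assumes b: "b \<in> ext_filtration n 2" "\<forall>I. b I \<noteq> 0 \<longrightarrow> card I = 2" and \<alpha>: "\<alpha> \<in> ext_filtration n 0"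
  shows "born_infeld_star n G b \<alpha> = wedge (ext_exp n b) (born_infeld_star n G 0 (wedge (ext_exp n b) \<alpha>))"
proof -
  define e where "e = (SOME e. oriented_orthonormal_frame n G e)"
  have ev: "even_ext b" using b(2) by (auto simp: even_ext_def)
  have fold: "fold (\<lambda>i. hat_op n G b (e i)) is \<alpha> \<in> ext_filtration n 0 \<and>
      wedge (ext_exp n b) (fold (\<lambda>i. hat_op n G b (e i)) is \<alpha>) =
      fold (\<lambda>i. hat_op n G 0 (e i)) is (wedge (ext_exp n b) \<alpha>)" for "is"
    using \<alpha>
    by (induction "is" arbitrary: \<alpha>) (simp_all add: hat_op_filtration[OF b(1)] hat_op_ext_exp[OF b(1) ev])
  define y where "y = fold (\<lambda>i. hat_op n G b (e i)) [0..<n] \<alpha>"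
  have y: "y \<in> ext_filtration n 0" using fold by (simp add: y_def)
  have r: "reversal y \<in> ext_filtration n 0" using y by (auto simp: ext_filtration_def reversal_def)
  have "born_infeld_star n G 0 (wedge (ext_exp n b) \<alpha>) = reversal (wedge (ext_exp n b) y)"
    using fold by (simp add: born_infeld_star_def Let_def y_def e_def)
  also have "\<dots> = wedge (ext_exp n (- b)) (reversal y)" by (rule reversal_ext_exp[OF b(2) y])
  finally have "wedge (ext_exp n b) (born_infeld_star n G 0 (wedge (ext_exp n b) \<alpha>)) = reversal y"
    using ext_exp_neg_inverse[OF ext_filtration_closed(4)[OF b(1)] r] by simp
  then show ?thesis by (simp add: born_infeld_star_def Let_def y_def e_def)
qed

section \<open>Pullback and products\<close>

definition covector_product :: "nat \<Rightarrow> (nat \<Rightarrow> nat \<Rightarrow> real) \<Rightarrow> nat set \<Rightarrow> 'k::real_field ext" where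
  "covector_product n J K =
     foldr (\<lambda>k. wedge (covector n (\<lambda>i. of_real (J k i)))) (sorted_list_of_set K) ext_one"

lemma ext_pullback_eq:
  "ext_pullback n J \<alpha> = (\<Sum>K\<in>Pow {..<n}. ext_scale (\<alpha> K) (covector_product n J K))"
  by (simp add: ext_pullback_def covector_product_def fun_eq_iff sum_fun_apply ext_scale_def)

lemma covector_product_insert_min:
  assumes "finite K" "\<forall>j\<in>K. k < j"
  shows "covector_product n J (insert k K) = wedge (covector n (\<lambda>i. of_real (J k i))) (covector_product n J K)"
proof -
  have "k \<notin> K" using assms by auto
  then have "sorted_list_of_set (insert k K) = k # sorted_list_of_set K"
    using assms by (simp add: sorted_list_of_set_insert insort_is_Cons less_imp_le)
  then show ?thesis by (simp add: covector_product_def)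
qed

lemma wedge_covector_anticommute:
  "wedge (covector n a) (wedge (covector n a') \<alpha>) = - wedge (covector n a') (wedge (covector n a) \<alpha>)"
proof -
  have "wedge (covector n a) (covector n a') = (\<lambda>K. -1 * wedge (covector n a') (covector n a) K)"
    by (rule wedge_graded_commute) (auto dest!: covector_support)
  also have "\<dots> = - wedge (covector n a') (covector n a)" by (simp add: fun_eq_iff)
  finally show ?thesis by (simp add: wedge_minus_left flip: wedge_assoc)
qed

lemma shuffle_sign_min: "\<forall>j\<in>K. k < j \<Longrightarrow> shuffle_sign {k} K = 1"
proof -
  assume "\<forall>j\<in>K. k < j"
  then have e: "{(i, j). i \<in> {k} \<and> j \<in> K \<and> j < i} = {}" by force
  show ?thesis unfolding shuffle_sign_def e by simp
qed

text \<open>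
  Induction on \<open>K\<close> by adding a new minimum: the covector is moved past the first factor of the
  product, unless it comes first already or repeats it.
\<close>

lemma wedge_covector_product:
  fixes J :: "nat \<Rightarrow> nat \<Rightarrow> real"
  assumes "finite K"
  shows "wedge (covector n (\<lambda>i. of_real (J k i))) (covector_product n J K) =
    ext_scale (if k \<in> K then 0 else shuffle_sign {k} K) (covector_product n J (insert k K) :: 'k::real_field ext)"
  using assms
proof (induction K rule: finite_linorder_min_induct)
  case empty
  then show ?case by (simp add: covector_product_insert_min)
next
  case (insert m L)
  let ?\<theta> = "\<lambda>k. covector n (\<lambda>i. of_real (J k i)) :: 'k ext"
  let ?P = "covector_product n J :: nat set \<Rightarrow> 'k ext"
  consider "k < m" | "k = m" | "m < k" by linarith
  then show ?case
  proof cases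
    case 1
    then have *: "\<forall>j\<in>insert m L. k < j" using insert by auto
    then have "k \<notin> insert m L" by auto
    then show ?thesis using insert * by (simp add: covector_product_insert_min shuffle_sign_min)
  next
    case 2
    have "wedge (?\<theta> m) (wedge (?\<theta> m) (?P L)) I = 0" for I
      using fun_cong[OF wedge_covector_anticommute[of n "\<lambda>i. of_real (J m i)" "\<lambda>i. of_real (J m i)" "?P L"], of I]
      by simp
    then have "wedge (?\<theta> m) (wedge (?\<theta> m) (?P L)) = 0" by (simp add: fun_eq_iff)
    then show ?thesis using 2 insert.hyps by (simp add: covector_product_insert_min)
  next
    case 3
    have "wedge (?\<theta> k) (?P (insert m L)) = - wedge (?\<theta> m) (wedge (?\<theta> k) (?P L))"
      using insert by (simp add: covector_product_insert_min wedge_covector_anticommute[of n "\<lambda>i. of_real (J k i)"])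
    also have "\<dots> = ext_scale (- (if k \<in> L then 0 else shuffle_sign {k} L)) (wedge (?\<theta> m) (?P (insert k L)))"
      by (simp add: insert.IH wedge_scale_right)
    also have "wedge (?\<theta> m) (?P (insert k L)) = ?P (insert m (insert k L))"
      using insert 3 by (simp add: covector_product_insert_min)
    also have "- (if k \<in> L then 0 else shuffle_sign {k} L) = (if k \<in> insert m L then 0 else shuffle_sign {k} (insert m L) :: 'k)"
    proof -
      have "m \<notin> L" using insert by auto
      then have "shuffle_sign {k} ({m} \<union> L) = shuffle_sign {k} {m} * (shuffle_sign {k} L :: 'k)"
        by (intro shuffle_sign_Un_right) auto
      moreover have "{(i, j). i \<in> {k} \<and> j \<in> {m} \<and> j < i} = {(k, m)}" using 3 by auto
      then have "shuffle_sign {k} {m} = (-1 :: 'k)" unfolding shuffle_sign_def by simp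
      ultimately show ?thesis using 3 by simp
    qed
    finally show ?thesis by (simp add: insert_commute)
  qed
qed

text \<open>
  The pullbacks of the \<open>dx\<^sup>k\<close> multiply like the \<open>dx\<^sup>k\<close> themselves, and therefore pullback is
  multiplicative.
\<close>

lemma wedge_covector_products:
  fixes J :: "nat \<Rightarrow> nat \<Rightarrow> real"
  assumes "finite K" "finite L"
  shows "wedge (covector_product n J K) (covector_product n J L) =
    ext_scale (if K \<inter> L = {} then shuffle_sign K L else 0) (covector_product n J (K \<union> L) :: 'k::real_field ext)"
  using assms(1)
proof (induction K rule: finite_linorder_min_induct)
  case empty
  have fo: "finite I" if "foldr (\<lambda>k. wedge (covector n (\<lambda>i. of_real (J k i)))) ks ext_one I \<noteq> (0::'k)" for I ks
    using that by (cases ks) (auto simp: ext_one_def split: if_splits, meson wedge_infinite)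
  have "wedge ext_one (covector_product n J L) = (covector_product n J L :: 'k ext)"
  proof
    fix I show "wedge ext_one (covector_product n J L) I = (covector_product n J L I :: 'k)"
      by (cases "finite I") (auto simp: wedge_one wedge_infinite covector_product_def, metis fo)
  qed
  then show ?case by (simp add: covector_product_def)
next
  case (insert m K)
  let ?\<theta> = "covector n (\<lambda>i. of_real (J m i)) :: 'k ext"
  let ?P = "covector_product n J :: nat set \<Rightarrow> 'k ext"
  have m: "m \<notin> K" using insert by auto
  have "wedge (?P (insert m K)) (?P L) = wedge ?\<theta> (wedge (?P K) (?P L))"
    using insert by (simp add: covector_product_insert_min wedge_assoc)
  also have "\<dots> = ext_scale ((if K \<inter> L = {} then shuffle_sign K L else 0) *
      (if m \<in> K \<union> L then 0 else shuffle_sign {m} (K \<union> L))) (?P (insert m (K \<union> L)))"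
    using insert assms(2) by (simp add: wedge_scale_right wedge_covector_product)
  also have "(if K \<inter> L = {} then shuffle_sign K L else 0) * (if m \<in> K \<union> L then 0 else shuffle_sign {m} (K \<union> L)) =
      (if insert m K \<inter> L = {} then shuffle_sign (insert m K) L else 0 :: 'k)"
  proof (cases "insert m K \<inter> L = {}")
    case True
    have "shuffle_sign {m} (K \<union> L) = shuffle_sign {m} K * (shuffle_sign {m} L :: 'k)"
      using True by (intro shuffle_sign_Un_right) auto
    also have "\<dots> = shuffle_sign {m} L" using insert by (simp add: shuffle_sign_min)
    finally have "shuffle_sign {m} (K \<union> L) = (shuffle_sign {m} L :: 'k)" .
    moreover have "shuffle_sign ({m} \<union> K) L = shuffle_sign {m} L * (shuffle_sign K L :: 'k)"
      using m insert by (intro shuffle_sign_Un_left) auto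
    ultimately show ?thesis using True m by simp
  qed auto
  finally show ?case by simp
qed

lemma ext_pullback_wedge:
  "ext_pullback n J (wedge \<beta> \<alpha>) = wedge (ext_pullback n J \<beta>) (ext_pullback n J (\<alpha> :: 'k::real_field ext))"
proof -
  let ?P = "covector_product n J :: nat set \<Rightarrow> 'k ext"
  define f where "f = (\<lambda>(I, L). ext_scale (\<beta> I * \<alpha> L * shuffle_sign I L) (?P (I \<union> L)))"
  have fin: "finite I" if "I \<subseteq> {..<n}" for I using that finite_subset by auto
  have "ext_pullback n J (wedge \<beta> \<alpha>) =
      (\<Sum>K\<in>Pow {..<n}. \<Sum>I\<in>Pow K. ext_scale (\<beta> I * \<alpha> (K - I) * shuffle_sign I (K - I)) (?P K))"
    unfolding ext_pullback_eq wedge_eq ext.scale_sum_left by (simp add: mult_ac)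
  also have "\<dots> = (\<Sum>(K, I)\<in>Sigma (Pow {..<n}) Pow. ext_scale (\<beta> I * \<alpha> (K - I) * shuffle_sign I (K - I)) (?P K))"
    using fin by (intro sum.Sigma) auto
  also have "\<dots> = (\<Sum>p\<in>{(I, L)\<in>Pow {..<n} \<times> Pow {..<n}. I \<inter> L = {}}. f p)"
    by (rule sum.reindex_bij_witness[of _ "\<lambda>(I, L). (I \<union> L, I)" "\<lambda>(K, I). (I, K - I)"])
       (auto simp: f_def Un_absorb1)
  also have "\<dots> = (\<Sum>p\<in>Pow {..<n} \<times> Pow {..<n}. if fst p \<inter> snd p = {} then f p else 0)"
    by (subst sum.inter_filter [symmetric]) (auto intro!: sum.cong)
  also have "\<dots> = (\<Sum>I\<in>Pow {..<n}. \<Sum>L\<in>Pow {..<n}. wedge (ext_scale (\<beta> I) (?P I)) (ext_scale (\<alpha> L) (?P L)))"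
    unfolding sum.cartesian_product
    using fin by (intro sum.cong refl)
      (auto simp: f_def wedge_scale_left wedge_scale_right wedge_covector_products mult_ac split: if_splits)
  also have "\<dots> = wedge (ext_pullback n J \<beta>) (ext_pullback n J \<alpha>)"
    unfolding ext_pullback_eq wedge_sum_left wedge_sum_right by (rule sum.swap)
  finally show ?thesis .
qed

section \<open>Smooth functions\<close>

lemma eventually_update_in_open:
  assumes S: "openin (top_of_set (coord_space n)) S" and x: "x \<in> S" and i: "i < n"
  shows "\<forall>\<^sub>F t in nhds (x i). x(i := t) \<in> S"
proof -
  obtain T where T: "open T" "S = coord_space n \<inter> T" using S by (auto simp: openin_open)
  have c: "continuous_on UNIV (\<lambda>t. x(i := t))"
    by (rule continuous_on_coordinatewise_then_product) (rename_tac j, case_tac "j = i", simp_all)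
  have "open ((\<lambda>t. x(i := t)) -` T)" by (rule open_vimage[OF T(1) c])
  moreover have "x i \<in> (\<lambda>t. x(i := t)) -` T" using x T by simp
  ultimately have "\<forall>\<^sub>F t in nhds (x i). x(i := t) \<in> T"
    by (metis (mono_tags, lifting) eventually_nhds vimage_eq)
  moreover have "x(i := t) \<in> coord_space n" for t
    using x i unfolding T(2) coord_space_def by (auto simp: PiE_iff extensional_def)
  ultimately show ?thesis unfolding T(2) by simp
qed

lemma has_partial_cong:
  assumes S: "openin (top_of_set (coord_space n)) S" and x: "x \<in> S" and i: "i < n"
    and fg: "\<And>y. y \<in> S \<Longrightarrow> f y = g y"
  shows "((\<lambda>t. f (x(i := t))) has_vector_derivative d) (at (x i)) \<longleftrightarrow>
         ((\<lambda>t. g (x(i := t))) has_vector_derivative d) (at (x i))"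
proof (rule has_vector_derivative_cong_ev)
  show "\<forall>\<^sub>F t in nhds (x i). t \<in> UNIV \<longrightarrow> f (x(i := t)) = g (x(i := t))"
    using eventually_update_in_open[OF S x i] by eventually_elim (simp add: fg)
qed (simp add: fg x)

lemma partial_deriv_eqI:
  "((\<lambda>t. f (x(i := t))) has_vector_derivative d) (at (x i)) \<Longrightarrow> partial_deriv i f x = d"
  unfolding partial_deriv_def by (rule vector_derivative_at)

lemma Ck_on_partial:
  assumes "Ck_on n S (Suc k) f" "i < n" "x \<in> S"
  shows "((\<lambda>t. f (x(i := t))) has_vector_derivative partial_deriv i f x) (at (x i))"
  using assms unfolding partial_deriv_def Ck_on.simps vector_derivative_works by blast

lemma Ck_on_partial_deriv: "Ck_on n S (Suc k) f \<Longrightarrow> i < n \<Longrightarrow> Ck_on n S k (partial_deriv i f)"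
  by simp

text \<open>
  Partial derivatives are taken of functions on the whole type; openness of \<open>S\<close> makes them depend only
  on the values on \<open>S\<close>.
\<close>

lemma Ck_on_cong:
  assumes S: "openin (top_of_set (coord_space n)) S"
  shows "Ck_on n S k f \<Longrightarrow> (\<And>x. x \<in> S \<Longrightarrow> f x = g x) \<Longrightarrow> Ck_on n S k g"
proof (induction k arbitrary: f g)
  case 0
  then show ?case using continuous_on_cong by fastforce
next
  case (Suc k)
  have d: "((\<lambda>t. g (x(i := t))) has_vector_derivative partial_deriv i f x) (at (x i))"
    if "i < n" "x \<in> S" for i x
    using Ck_on_partial[OF Suc.prems(1) that]
    by (rule iffD1[OF has_partial_cong[OF S that(2,1), of f g], rotated]) (rule Suc.prems(2))
  show ?case
    unfolding Ck_on.simps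
  proof (intro conjI allI impI ballI)
    show "continuous_on S g" using Suc.prems continuous_on_cong by fastforce
    fix i assume i: "i < n"
    show "(\<lambda>t. g (x(i := t))) differentiable at (x i)" if "x \<in> S" for x
      using d[OF i that] by (rule differentiableI_vector)
    show "Ck_on n S k (partial_deriv i g)"
    proof (rule Suc.IH)
      show "Ck_on n S k (partial_deriv i f)" using Suc.prems(1) i by simp
      show "partial_deriv i f x = partial_deriv i g x" if "x \<in> S" for x
        using partial_deriv_eqI[of g x i "partial_deriv i f x", OF d[OF i that]] by simp
    qed
  qed
qed

text \<open>
  It suffices to know the partial derivatives on \<open>S\<close>.  This form is convenient because formulas such as
  the product rule hold only there.
\<close>

lemma Ck_on_SucI:
  assumes S: "openin (top_of_set (coord_space n)) S" and "continuous_on S f"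
    and "\<And>i. i < n \<Longrightarrow> \<exists>g. (\<forall>x\<in>S. ((\<lambda>t. f (x(i := t))) has_vector_derivative g x) (at (x i))) \<and> Ck_on n S k g"
  shows "Ck_on n S (Suc k) f"
  unfolding Ck_on.simps
proof (intro conjI allI impI ballI assms(2))
  fix i assume "i < n"
  then obtain g where g: "\<And>x. x \<in> S \<Longrightarrow> ((\<lambda>t. f (x(i := t))) has_vector_derivative g x) (at (x i))"
    "Ck_on n S k g" using assms(3) by blast
  show "(\<lambda>t. f (x(i := t))) differentiable at (x i)" if "x \<in> S" for x
    using g(1)[OF that] by (rule differentiableI_vector)
  show "Ck_on n S k (partial_deriv i f)"
  proof (rule Ck_on_cong[OF S g(2)])
    fix x assume "x \<in> S"
    then show "g x = partial_deriv i f x" using partial_deriv_eqI[of f x i "g x", OF g(1)] by simp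
  qed
qed

lemma Ck_on_lower: "Ck_on n S (Suc k) f \<Longrightarrow> Ck_on n S k f"
  by (induction k arbitrary: f) auto

lemma Ck_on_const:
  assumes S: "openin (top_of_set (coord_space n)) S"
  shows "Ck_on n S k (\<lambda>x. c)"
proof (induction k arbitrary: c)
  case (Suc k)
  show ?case
  proof (rule Ck_on_SucI[OF S])
    show "\<exists>g. (\<forall>x\<in>S. ((\<lambda>t. c) has_vector_derivative g x) (at (x i))) \<and> Ck_on n S k g" for i
      by (rule exI[of _ "\<lambda>x. 0"]) (simp add: Suc)
  qed simp
qed simp

lemma Ck_on_add:
  assumes S: "openin (top_of_set (coord_space n)) S"
  shows "Ck_on n S k f \<Longrightarrow> Ck_on n S k g \<Longrightarrow> Ck_on n S k (\<lambda>x. f x + g x)"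
proof (induction k arbitrary: f g)
  case (Suc k)
  show ?case
  proof (rule Ck_on_SucI[OF S])
    show "continuous_on S (\<lambda>x. f x + g x)" using Suc.prems by (simp add: continuous_on_add)
    show "\<exists>h. (\<forall>x\<in>S. ((\<lambda>t. f (x(i := t)) + g (x(i := t))) has_vector_derivative h x) (at (x i))) \<and> Ck_on n S k h"
      if "i < n" for i
    proof (intro exI[of _ "\<lambda>x. partial_deriv i f x + partial_deriv i g x"] conjI ballI)
      show "Ck_on n S k (\<lambda>x. partial_deriv i f x + partial_deriv i g x)"
        by (rule Suc.IH[OF Suc.prems[THEN Ck_on_partial_deriv, OF that]])
      show "((\<lambda>t. f (x(i := t)) + g (x(i := t))) has_vector_derivative
          partial_deriv i f x + partial_deriv i g x) (at (x i))" if "x \<in> S" for x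
        by (rule has_vector_derivative_add[OF Ck_on_partial[OF Suc.prems(1) \<open>i < n\<close> that]
            Ck_on_partial[OF Suc.prems(2) \<open>i < n\<close> that]])
    qed
  qed
qed (simp add: continuous_on_add)

lemma Ck_on_mult:
  fixes f g :: "_ \<Rightarrow> 'k::real_normed_field"
  assumes S: "openin (top_of_set (coord_space n)) S"
  shows "Ck_on n S k f \<Longrightarrow> Ck_on n S k g \<Longrightarrow> Ck_on n S k (\<lambda>x. f x * g x)"
proof (induction k arbitrary: f g)
  case (Suc k)
  show ?case
  proof (rule Ck_on_SucI[OF S])
    show "continuous_on S (\<lambda>x. f x * g x)" using Suc.prems by (simp add: continuous_on_mult)
    show "\<exists>h. (\<forall>x\<in>S. ((\<lambda>t. f (x(i := t)) * g (x(i := t))) has_vector_derivative h x) (at (x i))) \<and> Ck_on n S k h"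
      if "i < n" for i
    proof (intro exI[of _ "\<lambda>x. f x * partial_deriv i g x + partial_deriv i f x * g x"] conjI ballI)
      show "Ck_on n S k (\<lambda>x. f x * partial_deriv i g x + partial_deriv i f x * g x)"
        by (intro Ck_on_add[OF S] Suc.IH Ck_on_lower[OF Suc.prems(1)] Ck_on_lower[OF Suc.prems(2)]
            Ck_on_partial_deriv[OF Suc.prems(1) that] Ck_on_partial_deriv[OF Suc.prems(2) that])
      show "((\<lambda>t. f (x(i := t)) * g (x(i := t))) has_vector_derivative
          f x * partial_deriv i g x + partial_deriv i f x * g x) (at (x i))" if "x \<in> S" for x
        by (rule has_vector_derivative_mult[OF Ck_on_partial[OF Suc.prems(1) \<open>i < n\<close> that]
            Ck_on_partial[OF Suc.prems(2) \<open>i < n\<close> that], unfolded fun_upd_triv])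
    qed
  qed
qed (simp add: continuous_on_mult)

lemma Ck_on_of_real:
  assumes S: "openin (top_of_set (coord_space n)) S"
  shows "Ck_on n S k f \<Longrightarrow> Ck_on n S k (\<lambda>x. of_real (f x) :: 'k::real_normed_field)"
proof (induction k arbitrary: f)
  case (Suc k)
  show ?case
  proof (rule Ck_on_SucI[OF S])
    show "continuous_on S (\<lambda>x. of_real (f x) :: 'k)" using Suc.prems by (simp add: continuous_on_of_real)
    show "\<exists>h. (\<forall>x\<in>S. ((\<lambda>t. of_real (f (x(i := t))) :: 'k) has_vector_derivative h x) (at (x i))) \<and> Ck_on n S k h"
      if "i < n" for i
    proof (intro exI[of _ "\<lambda>x. of_real (partial_deriv i f x)"] conjI ballI)
      show "Ck_on n S k (\<lambda>x. of_real (partial_deriv i f x) :: 'k)"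
        by (rule Suc.IH[OF Ck_on_partial_deriv[OF Suc.prems that]])
      show "((\<lambda>t. of_real (f (x(i := t))) :: 'k) has_vector_derivative of_real (partial_deriv i f x)) (at (x i))"
        if "x \<in> S" for x
        by (rule bounded_linear.has_vector_derivative[OF bounded_linear_of_real
            Ck_on_partial[OF Suc.prems \<open>i < n\<close> that]])
    qed
  qed
qed (simp add: continuous_on_of_real)

lemma smooth_on_partial:
  assumes "smooth_on n S f" "i < n" "x \<in> S"
  shows "((\<lambda>t. f (x(i := t))) has_vector_derivative partial_deriv i f x) (at (x i))"
  using assms Ck_on_partial unfolding smooth_on_def by blast

context
  fixes n S assumes S: "openin (top_of_set (coord_space n)) S"
begin

lemma smooth_on_const: "smooth_on n S (\<lambda>x. c)"
  using Ck_on_const[OF S] unfolding smooth_on_def by blast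

lemma smooth_on_add: "smooth_on n S f \<Longrightarrow> smooth_on n S g \<Longrightarrow> smooth_on n S (\<lambda>x. f x + g x)"
  using Ck_on_add[OF S] unfolding smooth_on_def by blast

lemma smooth_on_mult:
  "smooth_on n S f \<Longrightarrow> smooth_on n S g \<Longrightarrow> smooth_on n S (\<lambda>x. f x * g x :: 'k::real_normed_field)"
  using Ck_on_mult[OF S] unfolding smooth_on_def by blast

lemma smooth_on_of_real:
  "smooth_on n S f \<Longrightarrow> smooth_on n S (\<lambda>x. of_real (f x) :: 'k::real_normed_field)"
  using Ck_on_of_real[OF S] unfolding smooth_on_def by blast

lemma smooth_on_sum:
  "(\<And>k. k \<in> A \<Longrightarrow> smooth_on n S (f k)) \<Longrightarrow> smooth_on n S (\<lambda>x. \<Sum>k\<in>A. f k x)"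
  by (induction A rule: infinite_finite_induct) (auto intro: smooth_on_const smooth_on_add)

lemma smooth_on_wedge:
  fixes \<alpha> \<beta> :: "_ \<Rightarrow> 'k::real_normed_field ext"
  assumes "\<And>I. smooth_on n S (\<lambda>x. \<alpha> x I)" "\<And>I. smooth_on n S (\<lambda>x. \<beta> x I)"
  shows "smooth_on n S (\<lambda>x. wedge (\<alpha> x) (\<beta> x) K)"
  unfolding wedge_def by (intro smooth_on_sum smooth_on_mult smooth_on_const assms)

end

lemma partial_deriv_wedge:
  fixes \<alpha> \<beta> :: "_ \<Rightarrow> 'k::real_normed_field ext"
  assumes \<alpha>: "\<And>I. smooth_on n S (\<lambda>x. \<alpha> x I)" and \<beta>: "\<And>I. smooth_on n S (\<lambda>x. \<beta> x I)"
    and i: "i < n" and x: "x \<in> S"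
  shows "partial_deriv i (\<lambda>y. wedge (\<alpha> y) (\<beta> y) K) x =
    wedge (\<lambda>I. partial_deriv i (\<lambda>y. \<alpha> y I) x) (\<beta> x) K + wedge (\<alpha> x) (\<lambda>I. partial_deriv i (\<lambda>y. \<beta> y I) x) K"
proof (rule partial_deriv_eqI)
  have *: "((\<lambda>t. \<alpha> (x(i := t)) I * \<beta> (x(i := t)) J) has_vector_derivative
      \<alpha> x I * partial_deriv i (\<lambda>y. \<beta> y J) x + partial_deriv i (\<lambda>y. \<alpha> y I) x * \<beta> x J) (at (x i))" for I J
    by (rule has_vector_derivative_mult[OF smooth_on_partial[OF \<alpha>[of I] i x] smooth_on_partial[OF \<beta>[of J] i x],
        unfolded fun_upd_triv])
  have "((\<lambda>t. \<Sum>I\<in>Pow K. shuffle_sign I (K - I) * (\<alpha> (x(i := t)) I * \<beta> (x(i := t)) (K - I))) has_vector_derivative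
    (\<Sum>I\<in>Pow K. shuffle_sign I (K - I) *
      (\<alpha> x I * partial_deriv i (\<lambda>y. \<beta> y (K - I)) x + partial_deriv i (\<lambda>y. \<alpha> y I) x * \<beta> x (K - I)))) (at (x i))"
    by (intro has_vector_derivative_sum has_vector_derivative_mult_right *)
  then show "((\<lambda>t. wedge (\<alpha> (x(i := t))) (\<beta> (x(i := t))) K) has_vector_derivative
    wedge (\<lambda>I. partial_deriv i (\<lambda>y. \<alpha> y I) x) (\<beta> x) K + wedge (\<alpha> x) (\<lambda>I. partial_deriv i (\<lambda>y. \<beta> y I) x) K)
    (at (x i))"
    by (simp add: wedge_eq algebra_simps flip: sum.distrib)
qed

section \<open>Differential forms\<close>

text \<open>
  The families of local expressions which vanish where forms are required to vanish, with no
  condition of smoothness or compatibility.  On them \<open>\<epsilon>\<^sub>B\<close> is injective and the pointwise algebra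
  applies.  They contain the forms and, by a local computation in each chart, the twisted derivatives
  of forms; equations between derivatives are therefore solved for arguments of \<open>\<epsilon>\<^sub>B\<close> in this space.
\<close>

definition supported_families :: "'x mfd \<Rightarrow> ('x, 'k::field) form set" where
  "supported_families X = {\<omega>. \<forall>c x I. \<omega> c x I \<noteq> 0 \<longrightarrow> c \<in> atlas X \<and> x \<in> chart_image c \<and> I \<subseteq> {..<mdim X}}"

lemma supported_filtration: "\<omega> \<in> supported_families X \<Longrightarrow> \<omega> c x \<in> ext_filtration (mdim X) 0"
  unfolding supported_families_def ext_filtration_def by blast

lemma forms_supported: "forms X \<subseteq> supported_families X"
  unfolding forms_def supported_families_def by blast

lemma form_add_nonzero: "(\<omega> + \<eta>) c x I \<noteq> 0 \<Longrightarrow> \<omega> c x I \<noteq> 0 \<or> \<eta> c x I \<noteq> (0 :: 'k::group_add)"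
  by auto

lemma form_scale_nonzero: "form_scale a \<omega> c x I \<noteq> 0 \<Longrightarrow> \<omega> c x I \<noteq> 0"
  by (auto simp: form_scale_def)

lemma subspace_supported:
  "form.subspace (supported_families X :: ('x, 'k::field) form set)"
proof (rule form.subspaceI)
  fix \<omega> \<eta> :: "('x, 'k) form"
  assume "\<omega> \<in> supported_families X" "\<eta> \<in> supported_families X"
  then show "\<omega> + \<eta> \<in> supported_families X"
    unfolding supported_families_def by (blast dest: form_add_nonzero)
next
  fix a and \<omega> :: "('x, 'k) form"
  assume "\<omega> \<in> supported_families X"
  then show "form_scale a \<omega> \<in> supported_families X"
    unfolding supported_families_def by (blast dest: form_scale_nonzero)
qed (simp add: supported_families_def)

lemma forms_iff:
  "\<omega> \<in> forms X \<longleftrightarrow> \<omega> \<in> supported_families X \<and>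
     (\<forall>c\<in>atlas X. \<forall>I. smooth_on (mdim X) (chart_image c) (\<lambda>x. \<omega> c x I)) \<and>
     (\<forall>c\<in>atlas X. \<forall>c'\<in>atlas X. \<forall>x\<in>overlap c c'.
        \<omega> c x = ext_pullback (mdim X) (jacobian c c' x) (\<omega> c' (transition c c' x)))"
  unfolding forms_def supported_families_def mem_Collect_eq
  by (intro conj_cong refl) blast

lemma ext_pullback_add: "ext_pullback n J (\<alpha> + \<beta>) = ext_pullback n J \<alpha> + ext_pullback n J \<beta>"
  by (simp add: ext_pullback_eq ext.scale_left_distrib sum.distrib)

lemma ext_pullback_scale: "ext_pullback n J (ext_scale a \<alpha>) = ext_scale a (ext_pullback n J \<alpha>)"
  by (simp add: ext_pullback_eq ext.scale_sum_right) (simp add: ext_scale_def)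

lemma form_scale_apply: "form_scale a \<omega> c x = ext_scale a (\<omega> c x)"
  by (simp add: form_scale_def ext_scale_def)

definition ext_of_real :: "real ext \<Rightarrow> 'k::real_field ext" where
  "ext_of_real \<alpha> = (\<lambda>I. of_real (\<alpha> I))"

lemma embed_form_apply: "embed_form \<omega> c x = ext_of_real (\<omega> c x)"
  by (simp add: embed_form_def ext_of_real_def)

lemma ext_of_real_wedge: "ext_of_real (wedge \<alpha> \<beta>) = wedge (ext_of_real \<alpha>) (ext_of_real \<beta>)"
  by (simp add: ext_of_real_def wedge_def fun_eq_iff)

lemma ext_of_real_pullback: "ext_of_real (ext_pullback n J \<alpha>) = ext_pullback n J (ext_of_real \<alpha>)"
proof -
  have cov: "ext_of_real (covector n a) = covector n (\<lambda>i. of_real (a i))" for a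
    by (auto simp: ext_of_real_def covector_def fun_eq_iff intro!: sum.cong)
  have "ext_of_real (foldr (\<lambda>k. wedge (covector n (\<lambda>i. J k i))) ks ext_one) =
      foldr (\<lambda>k. wedge (covector n (\<lambda>i. of_real (J k i)))) ks (ext_one :: 'a ext)" for ks
    by (induction ks) (simp_all add: ext_of_real_wedge cov, simp add: ext_of_real_def ext_one_def fun_eq_iff)
  then have "ext_of_real (covector_product n J K) = (covector_product n J K :: 'a ext)" for K
    by (simp add: covector_product_def)
  then show ?thesis
    by (simp add: ext_pullback_eq fun_eq_iff ext_of_real_def sum_fun_apply ext_scale_def)
qed

lemma wedge_form_add_right: "wedge_form \<beta> (\<omega> + \<eta>) = wedge_form \<beta> \<omega> + wedge_form \<beta> \<eta>"
  by (simp add: wedge_form_def wedge_add_right fun_eq_iff)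

lemma wedge_form_scale_right: "wedge_form \<beta> (form_scale a \<omega>) = form_scale a (wedge_form \<beta> \<omega>)"
  by (simp add: fun_eq_iff wedge_form_def form_scale_apply wedge_scale_right)

locale manifold =
  fixes X :: "'x mfd"
  assumes compact_oriented: "compact_oriented_manifold X"
begin

lemma chart_open: "c \<in> atlas X \<Longrightarrow> openin (top_of_set (coord_space (mdim X))) (chart_image c)"
  using compact_oriented by (simp add: compact_oriented_manifold_def)

lemma forms_smooth: "\<omega> \<in> forms X \<Longrightarrow> c \<in> atlas X \<Longrightarrow> smooth_on (mdim X) (chart_image c) (\<lambda>x. \<omega> c x I)"
  by (simp add: forms_def)

lemma forms_transition:
  "\<omega> \<in> forms X \<Longrightarrow> c \<in> atlas X \<Longrightarrow> c' \<in> atlas X \<Longrightarrow> x \<in> overlap c c' \<Longrightarrow>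
    \<omega> c x = ext_pullback (mdim X) (jacobian c c' x) (\<omega> c' (transition c c' x))"
  by (simp add: forms_def)

lemma subspace_forms: "form.subspace (forms X :: ('x, 'k::real_normed_field) form set)"
proof (rule form.subspaceI)
  show "0 \<in> (forms X :: ('x, 'k) form set)"
    unfolding forms_iff
    by (auto simp: form.subspace_0[OF subspace_supported] smooth_on_const[OF chart_open] ext_pullback_eq simp del: zero_fun_apply)
       (simp_all add: smooth_on_const[OF chart_open] fun_eq_iff sum_fun_apply)
next
  fix \<omega> \<eta> :: "('x, 'k) form"
  assume *: "\<omega> \<in> forms X" "\<eta> \<in> forms X"
  show "\<omega> + \<eta> \<in> forms X"
    unfolding forms_iff
  proof (intro conjI allI impI ballI)
    fix c I assume "c \<in> atlas X"
    then show "smooth_on (mdim X) (chart_image c) (\<lambda>x. (\<omega> + \<eta>) c x I)"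
      unfolding plus_fun_apply by (intro smooth_on_add[OF chart_open] forms_smooth *)
  next
    fix c c' x assume t: "c \<in> atlas X" "c' \<in> atlas X" "x \<in> overlap c c'"
    show "(\<omega> + \<eta>) c x = ext_pullback (mdim X) (jacobian c c' x) ((\<omega> + \<eta>) c' (transition c c' x))"
      unfolding plus_fun_apply ext_pullback_add
      using forms_transition[OF *(1) t] forms_transition[OF *(2) t] by simp
  qed (use * forms_supported form.subspace_add[OF subspace_supported] in blast)
next
  fix a and \<omega> :: "('x, 'k) form"
  assume *: "\<omega> \<in> forms X"
  show "form_scale a \<omega> \<in> forms X"
    unfolding forms_iff
  proof (intro conjI allI impI ballI)
    fix c I assume "c \<in> atlas X"
    then show "smooth_on (mdim X) (chart_image c) (\<lambda>x. form_scale a \<omega> c x I)"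
      unfolding form_scale_def
      by (intro smooth_on_mult[OF chart_open] smooth_on_const[OF chart_open] forms_smooth *)
  next
    fix c c' x assume t: "c \<in> atlas X" "c' \<in> atlas X" "x \<in> overlap c c'"
    show "form_scale a \<omega> c x = ext_pullback (mdim X) (jacobian c c' x) (form_scale a \<omega> c' (transition c c' x))"
      unfolding form_scale_apply ext_pullback_scale
      using forms_transition[OF * t] by simp
  qed (use * forms_supported form.subspace_scale[OF subspace_supported] in blast)
qed

lemma subspace_forms_of_parity:
  "form.subspace (forms_of_parity X k :: ('x, 'k::real_normed_field) form set)"
proof (rule form.subspaceI)
  fix \<omega> \<eta> :: "('x, 'k) form"
  assume "\<omega> \<in> forms_of_parity X k" "\<eta> \<in> forms_of_parity X k"
  then show "\<omega> + \<eta> \<in> forms_of_parity X k"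
    using form.subspace_add[OF subspace_forms] unfolding forms_of_parity_def
    by (blast dest: form_add_nonzero)
next
  fix a and \<omega> :: "('x, 'k) form"
  assume "\<omega> \<in> forms_of_parity X k"
  then show "form_scale a \<omega> \<in> forms_of_parity X k"
    using form.subspace_scale[OF subspace_forms]
    unfolding forms_of_parity_def by (blast dest: form_scale_nonzero)
qed (use form.subspace_0[OF subspace_forms] in \<open>auto simp: forms_of_parity_def\<close>)

lemma wedge_form_supported:
  fixes \<beta> \<omega> :: "('x, 'k::real_normed_field) form"
  assumes "\<beta> \<in> supported_families X" "\<omega> \<in> supported_families X"
  shows "wedge_form \<beta> \<omega> \<in> supported_families X"
  unfolding supported_families_def mem_Collect_eq
proof (intro allI impI)
  fix c x I assume nz: "wedge_form \<beta> \<omega> c x I \<noteq> 0"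
  then have "\<omega> c x \<noteq> 0" by (auto simp: wedge_form_def)
  then obtain I' where "\<omega> c x I' \<noteq> 0" by (auto simp: fun_eq_iff)
  moreover have "wedge_form \<beta> \<omega> c x \<in> ext_filtration (mdim X) 0"
    unfolding wedge_form_def
    by (rule ext_filtration_0_wedge[OF supported_filtration[OF assms(1)] supported_filtration[OF assms(2)]])
  ultimately show "c \<in> atlas X \<and> x \<in> chart_image c \<and> I \<subseteq> {..<mdim X}"
    using nz assms(2) unfolding supported_families_def ext_filtration_def by blast
qed

lemma forms_wedge_form:
  fixes \<beta> \<omega> :: "('x, 'k::real_normed_field) form"
  assumes "\<beta> \<in> forms X" "\<omega> \<in> forms X"
  shows "wedge_form \<beta> \<omega> \<in> forms X"
  unfolding forms_iff
proof (intro conjI allI impI ballI)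
  show "wedge_form \<beta> \<omega> \<in> supported_families X"
    using wedge_form_supported assms forms_supported by blast
next
  fix c I assume "c \<in> atlas X"
  then show "smooth_on (mdim X) (chart_image c) (\<lambda>x. wedge_form \<beta> \<omega> c x I)"
    unfolding wedge_form_def by (intro smooth_on_wedge[OF chart_open] forms_smooth assms)
next
  fix c c' x assume *: "c \<in> atlas X" "c' \<in> atlas X" "x \<in> overlap c c'"
  show "wedge_form \<beta> \<omega> c x = ext_pullback (mdim X) (jacobian c c' x) (wedge_form \<beta> \<omega> c' (transition c c' x))"
    unfolding wedge_form_def ext_pullback_wedge
    using forms_transition[OF assms(1) *] forms_transition[OF assms(2) *] by simp
qed

lemma embed_form_forms:
  assumes "\<omega> \<in> forms X"
  shows "(embed_form \<omega> :: ('x, 'k::real_normed_field) form) \<in> forms X"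
  unfolding forms_iff
proof (intro conjI allI impI ballI)
  show "(embed_form \<omega> :: ('x, 'k::real_normed_field) form) \<in> supported_families X"
  proof -
    have "embed_form \<omega> c x I \<noteq> (0 :: 'k) \<Longrightarrow> \<omega> c x I \<noteq> 0" for c x I by (simp add: embed_form_def)
    then show ?thesis using subsetD[OF forms_supported assms] unfolding supported_families_def by blast
  qed
next
  fix c I assume "c \<in> atlas X"
  then show "smooth_on (mdim X) (chart_image c) (\<lambda>x. embed_form \<omega> c x I :: 'k)"
    unfolding embed_form_def by (intro smooth_on_of_real[OF chart_open] forms_smooth assms)
next
  fix c c' x assume "c \<in> atlas X" "c' \<in> atlas X" "x \<in> overlap c c'"
  then show "embed_form \<omega> c x = ext_pullback (mdim X) (jacobian c c' x) (embed_form \<omega> c' (transition c c' x) :: 'k ext)"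
    unfolding embed_form_apply using forms_transition[OF assms] by (simp flip: ext_of_real_pullback)
qed

lemma ext_deriv_eq:
  "c \<in> atlas X \<Longrightarrow> x \<in> chart_image c \<Longrightarrow> ext_deriv X \<omega> c x =
    (\<Sum>i<mdim X. wedge (covector (mdim X) (\<lambda>j. if j = i then 1 else 0)) (\<lambda>I. partial_deriv i (\<lambda>y. \<omega> c y I) x))"
  by (simp add: ext_deriv_def fun_eq_iff sum_fun_apply)

lemma ext_deriv_outside: "\<not> (c \<in> atlas X \<and> x \<in> chart_image c) \<Longrightarrow> ext_deriv X \<omega> c x = 0"
  by (auto simp: ext_deriv_def fun_eq_iff)

lemma ext_deriv_filtration:
  assumes "\<omega> \<in> supported_families X"
  shows "ext_deriv X \<omega> c x \<in> ext_filtration (mdim X) 1"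
proof (cases "c \<in> atlas X \<and> x \<in> chart_image c")
  case True
  have "(\<lambda>I. partial_deriv i (\<lambda>y. \<omega> c y I) x) \<in> ext_filtration (mdim X) 0" for i
    unfolding ext_filtration_def mem_Collect_eq
  proof (intro allI impI, rule ccontr)
    fix I assume nz: "partial_deriv i (\<lambda>y. \<omega> c y I) x \<noteq> 0" and "\<not> (I \<subseteq> {..<mdim X} \<and> 0 \<le> card I)"
    then have "\<omega> c y I = 0" for y using assms unfolding supported_families_def by blast
    then have "(\<lambda>y. \<omega> c y I) = (\<lambda>y. 0)" by simp
    then show False using nz by (simp add: partial_deriv_def)
  qed
  from ext_filtration_wedge[OF covector_filtration this] show ?thesis
    using True by (simp add: ext_deriv_eq ext.subspace_sum[OF subspace_ext_filtration])
next
  case False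
  then show ?thesis using ext.subspace_0[OF subspace_ext_filtration] by (simp add: ext_deriv_outside)
qed

lemma ext_deriv_supported:
  assumes "\<omega> \<in> supported_families X" shows "ext_deriv X \<omega> \<in> supported_families X"
  unfolding supported_families_def mem_Collect_eq
proof (intro allI impI)
  fix c x I assume *: "ext_deriv X \<omega> c x I \<noteq> 0"
  then have "c \<in> atlas X \<and> x \<in> chart_image c" by (metis ext_deriv_outside zero_fun_apply)
  then show "c \<in> atlas X \<and> x \<in> chart_image c \<and> I \<subseteq> {..<mdim X}"
    using * ext_deriv_filtration[OF assms, of c x] unfolding ext_filtration_def by blast
qed

lemma ext_deriv_add:
  fixes \<omega> \<eta> :: "('x, 'k::real_normed_field) form"
  assumes "\<omega> \<in> forms X" "\<eta> \<in> forms X"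
  shows "ext_deriv X (\<omega> + \<eta>) = ext_deriv X \<omega> + ext_deriv X \<eta>"
proof (intro ext)
  fix c x I
  show "ext_deriv X (\<omega> + \<eta>) c x I = (ext_deriv X \<omega> + ext_deriv X \<eta>) c x I"
  proof (cases "c \<in> atlas X \<and> x \<in> chart_image c")
    case True
    have "(\<lambda>I. partial_deriv i (\<lambda>y. (\<omega> + \<eta>) c y I) x) =
        (\<lambda>I. partial_deriv i (\<lambda>y. \<omega> c y I) x) + (\<lambda>I. partial_deriv i (\<lambda>y. \<eta> c y I) x)" if "i < mdim X" for i
    proof
      fix I
      show "partial_deriv i (\<lambda>y. (\<omega> + \<eta>) c y I) x =
        ((\<lambda>I. partial_deriv i (\<lambda>y. \<omega> c y I) x) + (\<lambda>I. partial_deriv i (\<lambda>y. \<eta> c y I) x)) I"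
        unfolding plus_fun_apply
        by (rule partial_deriv_eqI, rule has_vector_derivative_add)
          (use True that assms smooth_on_partial[OF forms_smooth] in blast)+
    qed
    then show ?thesis using True by (simp add: ext_deriv_eq wedge_add_right sum.distrib del: plus_fun_apply)
        (simp add: ext_deriv_eq)
  qed (simp add: ext_deriv_outside)
qed

lemma ext_deriv_scale:
  fixes \<omega> :: "('x, 'k::real_normed_field) form"
  assumes "\<omega> \<in> forms X"
  shows "ext_deriv X (form_scale a \<omega>) = form_scale a (ext_deriv X \<omega>)"
proof (intro ext)
  fix c x I
  show "ext_deriv X (form_scale a \<omega>) c x I = form_scale a (ext_deriv X \<omega>) c x I"
  proof (cases "c \<in> atlas X \<and> x \<in> chart_image c")
    case True
    have "(\<lambda>I. partial_deriv i (\<lambda>y. form_scale a \<omega> c y I) x) =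
        ext_scale a (\<lambda>I. partial_deriv i (\<lambda>y. \<omega> c y I) x)" if "i < mdim X" for i
    proof
      fix I
      show "partial_deriv i (\<lambda>y. form_scale a \<omega> c y I) x = ext_scale a (\<lambda>I. partial_deriv i (\<lambda>y. \<omega> c y I) x) I"
        unfolding form_scale_def ext_scale_def
        by (rule partial_deriv_eqI, rule has_vector_derivative_mult_right)
          (use True that assms smooth_on_partial[OF forms_smooth] in blast)
    qed
    then show ?thesis using True
      by (simp add: ext_deriv_eq wedge_scale_right sum_fun_apply form_scale_apply flip: ext.scale_sum_right)
  qed (simp add: ext_deriv_outside form_scale_apply)
qed

lemma ext_deriv_sum:
  fixes f :: "nat \<Rightarrow> ('x, 'k::real_normed_field) form"
  assumes "\<And>k. f k \<in> forms X"
  shows "ext_deriv X (\<Sum>k\<in>A. f k) = (\<Sum>k\<in>A. ext_deriv X (f k))"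
proof -
  have "ext_deriv X 0 = (0 :: ('x, 'k) form)"
    using ext_deriv_add[of "0 :: ('x, 'k) form" 0] form.subspace_0[OF subspace_forms] by simp
  then show ?thesis
  proof (induction A rule: infinite_finite_induct)
    case (insert k F)
    then show ?case
      using ext_deriv_add[OF assms form.subspace_sum[OF subspace_forms], of F f k] assms
      by (simp del: plus_fun_apply zero_fun_apply)
  qed (simp_all del: zero_fun_apply)
qed

text \<open>
  The product rule for partial derivatives; the even form \<open>\<beta>\<close> is moved past the \<open>dx\<^sup>i\<close> without a
  sign.
\<close>

lemma ext_deriv_wedge_even:
  fixes \<beta> \<omega> :: "('x, 'k::real_normed_field) form"
  assumes \<beta>: "\<beta> \<in> forms X" "\<And>c x. even_ext (\<beta> c x)" and \<omega>: "\<omega> \<in> forms X"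
  shows "ext_deriv X (wedge_form \<beta> \<omega>) = wedge_form (ext_deriv X \<beta>) \<omega> + wedge_form \<beta> (ext_deriv X \<omega>)"
proof (intro ext)
  fix c x I
  show "ext_deriv X (wedge_form \<beta> \<omega>) c x I = (wedge_form (ext_deriv X \<beta>) \<omega> + wedge_form \<beta> (ext_deriv X \<omega>)) c x I"
  proof (cases "c \<in> atlas X \<and> x \<in> chart_image c")
    case True
    let ?dx = "\<lambda>i. covector (mdim X) (\<lambda>j. if j = i then 1 else 0) :: 'k ext"
    let ?p = "\<lambda>i (\<omega> :: ('x, 'k) form) I. partial_deriv i (\<lambda>y. \<omega> c y I) x"
    have "?p i (wedge_form \<beta> \<omega>) = wedge (?p i \<beta>) (\<omega> c x) + wedge (\<beta> c x) (?p i \<omega>)" if "i < mdim X" for i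
    proof
      fix K show "?p i (wedge_form \<beta> \<omega>) K = (wedge (?p i \<beta>) (\<omega> c x) + wedge (\<beta> c x) (?p i \<omega>)) K"
        unfolding plus_fun_apply wedge_form_def
        by (rule partial_deriv_wedge[OF forms_smooth[OF \<beta>(1)] forms_smooth[OF \<omega>] that]) (use True in auto)
    qed
    then have "ext_deriv X (wedge_form \<beta> \<omega>) c x =
        (\<Sum>i<mdim X. wedge (?dx i) (wedge (?p i \<beta>) (\<omega> c x)) + wedge (\<beta> c x) (wedge (?dx i) (?p i \<omega>)))"
      using True by (simp add: ext_deriv_eq wedge_add_right wedge_even_left_commute[OF \<beta>(2)] del: plus_fun_apply)
    also have "\<dots> = wedge (ext_deriv X \<beta> c x) (\<omega> c x) + wedge (\<beta> c x) (ext_deriv X \<omega> c x)"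
      using True by (simp only: ext_deriv_eq sum.distrib wedge_sum_left wedge_sum_right wedge_assoc)
    finally show ?thesis by (simp add: wedge_form_def)
  qed (simp add: ext_deriv_outside wedge_form_def)
qed

end

section \<open>The action of a 2-form\<close>

text \<open>A chart is a pair, and quantified charts are kept as single variables.\<close>

declare split_paired_All [simp del] split_paired_Ex [simp del]

text \<open>
The axiom \<open>x * conjugate x = |x|\<^sup>2\<close> determines the conjugate of \<open>x \<noteq> 0\<close>.
\<close>

lemma conjugate_of_real: "conjugate (of_real r :: 'k::real_or_complex) = of_real r"
proof (cases "r = 0")
  case False
  have "of_real r * conjugate (of_real r :: 'k) = of_real r * of_real r"
    by (simp add: mult_conjugate scaleR_conv_of_real power2_eq_square)
  then show ?thesis using False by simp
qed simp

definition ext_conj :: "'k::real_or_complex ext \<Rightarrow> 'k ext" where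
  "ext_conj \<alpha> = (\<lambda>I. conjugate (\<alpha> I))"

lemma conj_form_apply: "conj_form \<omega> c x = ext_conj (\<omega> c x)"
  by (simp add: conj_form_def ext_conj_def)

lemma ext_conj_of_real: "ext_conj (ext_of_real \<alpha>) = ext_of_real \<alpha>"
  by (simp add: ext_conj_def ext_of_real_def conjugate_of_real)

lemma ext_conj_wedge: "ext_conj (wedge \<alpha> \<beta>) = wedge (ext_conj \<alpha>) (ext_conj \<beta>)"
proof
  fix K
  have "shuffle_sign I J = (of_real (shuffle_sign I J) :: 'a)" for I J
    by (simp add: shuffle_sign_def)
  then have c: "conjugate (shuffle_sign I J :: 'a) = shuffle_sign I J" for I J
    by (metis conjugate_of_real)
  show "ext_conj (wedge \<alpha> \<beta>) K = wedge (ext_conj \<alpha>) (ext_conj \<beta>) K"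
    by (cases "finite (Pow K)") (simp_all add: wedge_eq ext_conj_def sum_conjugate conjugate_dist_mul c)
qed

lemma ext_of_real_exp: "ext_of_real (ext_exp n \<beta>) = ext_exp n (ext_of_real \<beta> :: 'k::real_field ext)"
proof -
  have "ext_of_real ((wedge \<beta> ^^ k) ext_one) = (wedge (ext_of_real \<beta>) ^^ k) (ext_one :: 'k ext)" for k
    by (induction k) (simp_all add: ext_of_real_wedge, simp add: ext_of_real_def ext_one_def fun_eq_iff)
  then have "(wedge (ext_of_real \<beta>) ^^ k) ext_one I = (of_real ((wedge \<beta> ^^ k) ext_one I) :: 'k)" for k I
    by (metis ext_of_real_def)
  then have "ext_exp n (ext_of_real \<beta>) = (\<lambda>I. \<Sum>k\<le>n. (of_real ((wedge \<beta> ^^ k) ext_one I) :: 'k) / fact k)"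
    unfolding ext_exp_def by simp
  then show ?thesis by (simp add: ext_exp_def ext_of_real_def)
qed

lemma ext_filtration_conj: "\<alpha> \<in> ext_filtration n p \<Longrightarrow> ext_conj \<alpha> \<in> ext_filtration n p"
  by (simp add: ext_filtration_def ext_conj_def)

lemma eps_apply: "eps X B \<omega> c x = wedge (ext_exp (mdim X) (embed_form B c x)) (\<omega> c x)"
  by (simp add: eps_def wedge_form_def)

lemma eps_add: "eps X B (\<omega> + \<eta>) = eps X B \<omega> + eps X B \<eta>"
  by (simp add: eps_def wedge_form_add_right)

lemma eps_scale: "eps X B (form_scale a \<omega>) = form_scale a (eps X B \<omega>)"
  by (simp add: eps_def wedge_form_scale_right)

lemma eps_zero [simp]: "eps X B 0 = 0"
  using eps_add[of X B 0 0] by simp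

lemma linear_eps: "Vector_Spaces.linear form_scale form_scale (eps X B)"
  unfolding Vector_Spaces.linear_iff
  by (intro conjI allI form.vector_space_axioms eps_add eps_scale)

locale two_form = manifold X for X :: "'x mfd" +
  fixes B :: "('x, real) form"
  assumes B: "B \<in> forms_of_degree X 2"
begin

lemma embed_B_forms: "(embed_form B :: ('x, 'k::real_normed_field) form) \<in> forms X"
  using B by (intro embed_form_forms) (simp add: forms_of_degree_def)

lemma embed_B_degree: "\<forall>I. (embed_form B c x I :: 'k::real_normed_field) \<noteq> 0 \<longrightarrow> card I = 2"
  using B by (simp add: forms_of_degree_def embed_form_def)

lemma embed_B_even: "even_ext (embed_form B c x :: 'k::real_normed_field ext)"
  using embed_B_degree[of c x] unfolding even_ext_def by auto

lemma embed_B_filtration: "(embed_form B c x :: 'k::real_normed_field ext) \<in> ext_filtration (mdim X) 2"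
proof -
  have "(embed_form B :: ('x, 'k) form) \<in> supported_families X"
    using embed_B_forms forms_supported by blast
  then show ?thesis using embed_B_degree[of c x, where 'k = 'k]
    unfolding ext_filtration_def supported_families_def by fastforce
qed

lemma wedge_B_power_apply:
  "((wedge_form (embed_form B) ^^ k) \<omega>) c x = (wedge (embed_form B c x) ^^ k) (\<omega> c x)"
  by (induction k) (simp_all add: wedge_form_def)

lemma op_exp_wedge_B_apply:
  "op_exp form_scale N (wedge_form (embed_form B)) \<omega> c x = op_exp ext_scale N (wedge (embed_form B c x)) (\<omega> c x)"
  by (simp add: op_exp_def sum_fun_apply form_scale_apply wedge_B_power_apply)

lemma eps_op_exp:
  fixes \<omega> :: "('x, 'k::real_normed_field) form"
  assumes "\<omega> \<in> supported_families X"
  shows "eps X B \<omega> = op_exp form_scale (mdim X) (wedge_form (embed_form B)) \<omega>"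
  by (intro ext) (simp only: eps_apply op_exp_wedge_B_apply wedge_ext_exp[OF supported_filtration[OF assms]])

lemma wedge_B_parity:
  fixes \<omega> :: "('x, 'k::real_normed_field) form"
  assumes "\<omega> \<in> forms_of_parity X k"
  shows "wedge_form (embed_form B) \<omega> \<in> forms_of_parity X k"
  unfolding forms_of_parity_def mem_Collect_eq
proof (intro conjI allI impI)
  show "wedge_form (embed_form B) \<omega> \<in> forms X"
    using assms by (intro forms_wedge_form embed_B_forms) (simp add: forms_of_parity_def)
  fix c x K assume nz: "wedge_form (embed_form B) \<omega> c x K \<noteq> 0"
  then have fin: "finite K" using wedge_infinite unfolding wedge_form_def by blast
  have "\<exists>I\<in>Pow K. shuffle_sign I (K - I) * embed_form B c x I * \<omega> c x (K - I) \<noteq> 0"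
    using nz unfolding wedge_form_def wedge_eq by (rule contrapos_np) (simp add: sum.neutral)
  then obtain I where I: "I \<subseteq> K" "(embed_form B c x I :: 'k) \<noteq> 0" "\<omega> c x (K - I) \<noteq> 0" by auto
  have "card (K - I) mod 2 = k mod 2" using assms I(3) unfolding forms_of_parity_def by blast
  moreover have "card (K - I) = card K - card I" "card I \<le> card K"
    using I(1) fin by (auto simp: card_Diff_subset finite_subset card_mono)
  moreover have "card I = 2" using embed_B_degree I(2) by blast
  ultimately show "card K mod 2 = k mod 2" by (metis add.commute le_add_diff_inverse mod_add_self2)
qed

lemma eps_parity:
  fixes \<omega> :: "('x, 'k::real_normed_field) form"
  assumes "\<omega> \<in> forms_of_parity X k"
  shows "eps X B \<omega> \<in> forms_of_parity X k"
proof -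
  have "\<omega> \<in> supported_families X"
    using assms forms_supported unfolding forms_of_parity_def by blast
  moreover have "(wedge_form (embed_form B) ^^ j) \<omega> \<in> forms_of_parity X k" for j
    by (induction j) (simp_all add: assms wedge_B_parity)
  ultimately show ?thesis
    by (simp add: eps_op_exp op_exp_def form.subspace_sum[OF subspace_forms_of_parity]
        form.subspace_scale[OF subspace_forms_of_parity])
qed

lemma eps_neg_inverse:
  fixes \<omega> :: "('x, 'k::real_normed_field) form"
  assumes "\<omega> \<in> supported_families X"
  shows "eps X (- B) (eps X B \<omega>) = \<omega>"
proof (intro ext)
  fix c x I
  have "embed_form (- B) c x = - (embed_form B c x :: 'k ext)" by (simp add: embed_form_def fun_eq_iff)
  then show "eps X (- B) (eps X B \<omega>) c x I = \<omega> c x I"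
    by (simp only: eps_apply ext_exp_neg_inverse[OF embed_B_filtration supported_filtration[OF assms]])
qed

lemma neg_B: "- B \<in> forms_of_degree X 2"
  using B form.subspace_neg[OF subspace_forms, of B] unfolding forms_of_degree_def by simp

lemma eps_inj: "inj_on (eps X B) (supported_families X :: ('x, 'k::real_normed_field) form set)"
  by (rule inj_on_inverseI[of _ "eps X (- B)"]) (rule eps_neg_inverse)

lemma parity_supported: "forms_of_parity X k \<subseteq> (supported_families X :: ('x, 'k::real_normed_field) form set)"
  using forms_supported unfolding forms_of_parity_def by blast

lemma eps_bij: "bij_betw (eps X B) (forms_of_parity X k) (forms_of_parity X k :: ('x, 'k::real_normed_field) form set)"
proof (rule bij_betw_byWitness[of _ "eps X (- B)"])
  interpret neg: two_form X "- B" by unfold_locales (rule neg_B)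
  show "\<forall>\<omega>\<in>forms_of_parity X k. eps X (- B) (eps X B \<omega>) = (\<omega> :: ('x, 'k) form)"
    using eps_neg_inverse parity_supported by blast
  show "\<forall>\<omega>\<in>forms_of_parity X k. eps X B (eps X (- B) \<omega>) = (\<omega> :: ('x, 'k) form)"
    using neg.eps_neg_inverse parity_supported by force
  show "eps X B ` forms_of_parity X k \<subseteq> (forms_of_parity X k :: ('x, 'k) form set)"
    using eps_parity by blast
  show "eps X (- B) ` forms_of_parity X k \<subseteq> (forms_of_parity X k :: ('x, 'k) form set)"
    using neg.eps_parity by blast
qed

lemma born_infeld_product_eps:
  fixes \<omega> \<omega>' :: "('x, 'k::real_or_complex) form"
  assumes "\<omega>' \<in> supported_families X"
  shows "born_infeld_product X g 0 (eps X B \<omega>) (eps X B \<omega>') = born_infeld_product X g B \<omega> \<omega>'"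
proof -
  have "wedge (\<omega> c x) (born_infeld_star (mdim X) (g c x) (embed_form B c x) (conj_form \<omega>' c x)) =
     wedge (eps X B \<omega> c x) (born_infeld_star (mdim X) (g c x) (embed_form 0 c x) (conj_form (eps X B \<omega>') c x))" for c x
  proof -
    let ?E = "ext_exp (mdim X) (embed_form B c x) :: 'k ext"
    have E: "ext_conj ?E = ?E"
      unfolding embed_form_apply ext_of_real_exp [symmetric] by (rule ext_conj_of_real)
    have c: "conj_form (eps X B \<omega>') c x = wedge ?E (conj_form \<omega>' c x)"
      by (simp add: conj_form_apply eps_apply ext_conj_wedge E)
    have z: "embed_form 0 c x = (0 :: 'k ext)" by (simp add: embed_form_def fun_eq_iff)
    have f: "conj_form \<omega>' c x \<in> ext_filtration (mdim X) 0"
      unfolding conj_form_apply by (intro ext_filtration_conj supported_filtration assms)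
    show ?thesis
      unfolding born_infeld_star_ext_exp[OF embed_B_filtration embed_B_degree f] c z eps_apply
      by (simp only: wedge_assoc wedge_even_left_commute[OF even_ext_exp[OF embed_B_even]])
  qed
  then show ?thesis by (simp add: born_infeld_product_def wedge_form_def)
qed

end

lemma (in manifold) embed_ext_deriv:
  assumes "\<beta> \<in> forms X"
  shows "embed_form (ext_deriv X \<beta>) = (ext_deriv X (embed_form \<beta>) :: ('x, 'k::real_normed_field) form)"
proof (intro ext)
  fix c x I
  show "embed_form (ext_deriv X \<beta>) c x I = (ext_deriv X (embed_form \<beta>) c x I :: 'k)"
  proof (cases "c \<in> atlas X \<and> x \<in> chart_image c")
    case True
    have p: "partial_deriv i (\<lambda>y. embed_form \<beta> c y K :: 'k) x = of_real (partial_deriv i (\<lambda>y. \<beta> c y K) x)"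
      if "i < mdim X" for i K
      unfolding embed_form_def
      by (rule partial_deriv_eqI, rule bounded_linear.has_vector_derivative[OF bounded_linear_of_real])
        (use True that smooth_on_partial[OF forms_smooth[OF assms]] in blast)
    have cov: "covector n (\<lambda>j. if j = i then 1 else 0) = (ext_of_real (covector n (\<lambda>j. if j = i then 1 else 0)) :: 'k ext)" for n i
      by (auto simp: ext_of_real_def covector_def fun_eq_iff intro!: sum.cong)
    have "wedge (covector (mdim X) (\<lambda>j. if j = i then 1 else 0)) (\<lambda>K. partial_deriv i (\<lambda>y. embed_form \<beta> c y K :: 'k) x) I =
      of_real (wedge (covector (mdim X) (\<lambda>j. if j = i then 1 else 0)) (\<lambda>K. partial_deriv i (\<lambda>y. \<beta> c y K) x) I)"
      if "i < mdim X" for i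
    proof -
      have "(\<lambda>K. partial_deriv i (\<lambda>y. embed_form \<beta> c y K :: 'k) x) = ext_of_real (\<lambda>K. partial_deriv i (\<lambda>y. \<beta> c y K) x)"
        using p[OF that] by (simp add: ext_of_real_def)
      then show ?thesis unfolding cov by (simp only: ext_of_real_wedge [symmetric]) (simp add: ext_of_real_def)
    qed
    then show ?thesis using True by (simp add: embed_form_def ext_deriv_def)
  qed (auto simp: embed_form_def ext_deriv_def)
qed

lemma (in manifold) twisted_d_supported:
  fixes \<omega> :: "('x, 'k::real_normed_field) form"
  assumes "H \<in> supported_families X" "\<omega> \<in> supported_families X"
  shows "twisted_d X H \<omega> \<in> supported_families X"
proof -
  have "(embed_form H :: ('x, 'k) form) \<in> supported_families X"
    using assms(1) unfolding supported_families_def embed_form_def by simp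
  then show ?thesis unfolding twisted_d_def
    by (intro form.subspace_add[OF subspace_supported] ext_deriv_supported wedge_form_supported assms)
qed

text \<open>
  The hypotheses under which \<open>\<epsilon>\<^sub>B\<close> intertwines \<open>d\<^sup>H\<close> and \<open>d\<^sup>H\<^sup>'\<close>.
\<close>

locale twist = two_form X B for X :: "'x mfd" and B :: "('x, real) form" +
  fixes H H' :: "('x, real) form"
  assumes H: "H \<in> forms X" and H': "H' = H - ext_deriv X B"
begin

lemma H_supported: "H \<in> supported_families X"
  using H forms_supported by blast

lemma eps_twisted_d:
  fixes \<omega> :: "('x, 'k::real_normed_field) form"
  assumes \<omega>: "\<omega> \<in> forms X"
  shows "twisted_d X H' (eps X B \<omega>) = eps X B (twisted_d X H \<omega>)"
proof -
  let ?b = "embed_form B :: ('x, 'k) form"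
  let ?N = "mdim X"
  have supp: "\<omega> \<in> supported_families X" using \<omega> forms_supported by blast
  have b_supp: "?b \<in> supported_families X" using embed_B_forms forms_supported by blast
  have db: "embed_form (ext_deriv X B) = ext_deriv X ?b"
    using B by (intro embed_ext_deriv) (simp add: forms_of_degree_def)
  have "ext_deriv X (op_exp form_scale ?N (wedge_form ?b) \<omega>) =
    wedge_form (ext_deriv X ?b) (op_exp form_scale ?N (wedge_form ?b) \<omega>) +
    op_exp form_scale ?N (wedge_form ?b) (ext_deriv X \<omega>)"
  proof (rule op_exp_twist[OF form.vector_space_axioms, where U = "forms X"])
    fix \<eta> :: "('x, 'k) form" assume \<eta>: "\<eta> \<in> forms X"
    show "wedge_form ?b \<eta> \<in> forms X" by (rule forms_wedge_form[OF embed_B_forms \<eta>])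
    show "ext_deriv X (wedge_form ?b \<eta>) = wedge_form (ext_deriv X ?b) \<eta> + wedge_form ?b (ext_deriv X \<eta>)"
      by (rule ext_deriv_wedge_even[OF embed_B_forms embed_B_even \<eta>])
    show "wedge_form (ext_deriv X ?b) (wedge_form ?b \<eta>) = wedge_form ?b (wedge_form (ext_deriv X ?b) \<eta>)"
      unfolding wedge_form_def by (simp only: wedge_even_left_commute[OF embed_B_even])
  next
    have f: "(wedge_form ?b ^^ k) \<omega> \<in> forms X" for k
      by (induction k) (simp_all add: \<omega> forms_wedge_form embed_B_forms)
    show "ext_deriv X (op_exp form_scale ?N (wedge_form ?b) \<omega>) =
        (\<Sum>k\<le>?N. form_scale (1 / fact k) (ext_deriv X ((wedge_form ?b ^^ k) \<omega>)))"
      unfolding op_exp_def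
      by (subst ext_deriv_sum) (simp_all add: f form.subspace_scale[OF subspace_forms] ext_deriv_scale)
    \<comment> \<open>a form of degree greater than \<open>2 ?N\<close>\<close>
    show "wedge_form (ext_deriv X ?b) ((wedge_form ?b ^^ ?N) \<omega>) = 0"
    proof (intro ext)
      fix c x I
      have "wedge (ext_deriv X ?b c x) ((wedge (?b c x) ^^ ?N) (\<omega> c x)) = 0"
        by (rule ext_filtration_above[OF _ ext_filtration_wedge[OF ext_deriv_filtration[OF b_supp]
          wedge_power_filtration[OF embed_B_filtration supported_filtration[OF supp]]]]) simp
      then show "wedge_form (ext_deriv X ?b) ((wedge_form ?b ^^ ?N) \<omega>) c x I = 0 c x I"
        by (simp add: wedge_form_def[of "ext_deriv X ?b"] wedge_B_power_apply)
    qed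
  qed (use \<omega> in \<open>simp_all add: wedge_form_add_right wedge_form_scale_right del: plus_fun_apply\<close>)
  then have d: "ext_deriv X (eps X B \<omega>) = wedge_form (ext_deriv X ?b) (eps X B \<omega>) + eps X B (ext_deriv X \<omega>)"
    using supp ext_deriv_supported[OF supp] by (simp only: eps_op_exp)
  have H'_embed: "(embed_form H' :: ('x, 'k) form) = embed_form H - ext_deriv X ?b"
    unfolding db[symmetric] H' by (simp add: embed_form_def fun_eq_iff)
  have "wedge_form (embed_form H) (eps X B \<omega>) = eps X B (wedge_form (embed_form H) \<omega>)"
    by (intro ext) (simp add: wedge_form_def eps_apply wedge_even_left_commute[OF even_ext_exp[OF embed_B_even]])
  moreover have "wedge_form (embed_form H') (eps X B \<omega>) =
      wedge_form (embed_form H) (eps X B \<omega>) - wedge_form (ext_deriv X ?b) (eps X B \<omega>)"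
  proof -
    have "wedge (\<alpha> - \<beta>) \<gamma> = wedge \<alpha> \<gamma> - wedge \<beta> \<gamma>" for \<alpha> \<beta> \<gamma> :: "'k ext"
      using wedge_add_left[of \<alpha> "- \<beta>" \<gamma>] by (simp only: wedge_minus_left diff_conv_add_uminus)
    then show ?thesis unfolding H'_embed by (simp add: wedge_form_def fun_eq_iff)
  qed
  ultimately show ?thesis unfolding twisted_d_def d by (simp add: eps_add algebra_simps del: plus_fun_apply minus_apply)
qed

end

section \<open>Adjoints, harmonic forms and zeta-determinants\<close>

text \<open>
  The equations that characterize the value of the adjoint at \<open>\<beta>\<close> and at \<open>e \<beta>\<close> correspond under the
  bijection \<open>e\<close>.  Hence one has a unique solution iff the other has, and the conventional value \<open>0\<close>
  corresponds to itself.
\<close>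

lemma adjoint_on_transport:
  assumes bij: "bij_betw e U U" and T: "\<And>\<gamma>. \<gamma> \<in> U \<Longrightarrow> T' (e \<gamma>) = e (T \<gamma>)"
    and ip: "\<And>x y. y \<in> insert \<beta> U \<Longrightarrow> ip' (e x) (e y) = ip x y"
    and zero: "e 0 = 0"
  shows "adjoint_on ip' U T' (e \<beta>) = e (adjoint_on ip U T \<beta>)"
proof -
  define P where "P = (\<lambda>\<alpha>. \<alpha> \<in> U \<and> (\<forall>\<gamma>\<in>U. ip (T \<gamma>) \<beta> = ip \<gamma> \<alpha>))"
  define P' where "P' = (\<lambda>\<alpha>. \<alpha> \<in> U \<and> (\<forall>\<gamma>\<in>U. ip' (T' \<gamma>) (e \<beta>) = ip' \<gamma> \<alpha>))"
  have im: "e ` U = U" and inj: "inj_on e U" using bij by (auto simp: bij_betw_def)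
  have PU: "\<alpha> \<in> U" if "P \<alpha>" for \<alpha> using that by (simp add: P_def)
  have iff: "P' (e \<alpha>) \<longleftrightarrow> P \<alpha>" if "\<alpha> \<in> U" for \<alpha>
  proof -
    have "P' (e \<alpha>) \<longleftrightarrow> (\<forall>\<gamma>\<in>e ` U. ip' (T' \<gamma>) (e \<beta>) = ip' \<gamma> (e \<alpha>))"
      using that im by (auto simp: P'_def)
    also have "\<dots> \<longleftrightarrow> P \<alpha>" using that by (simp add: P_def T ip)
    finally show ?thesis .
  qed
  have P'E: "\<exists>\<alpha>. P \<alpha> \<and> \<alpha>' = e \<alpha>" if "P' \<alpha>'" for \<alpha>'
  proof -
    have "\<alpha>' \<in> e ` U" using that im by (simp add: P'_def)
    then show ?thesis using iff that by auto
  qed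
  have ex: "(\<exists>!\<alpha>. P' \<alpha>) \<longleftrightarrow> (\<exists>!\<alpha>. P \<alpha>)"
  proof
    assume "\<exists>!\<alpha>. P' \<alpha>"
    then show "\<exists>!\<alpha>. P \<alpha>" using P'E iff PU inj by (metis inj_onD)
  next
    assume "\<exists>!\<alpha>. P \<alpha>"
    then show "\<exists>!\<alpha>. P' \<alpha>" using P'E iff PU by metis
  qed
  show ?thesis
  proof (cases "\<exists>!\<alpha>. P \<alpha>")
    case True
    then have "P (THE \<alpha>. P \<alpha>)" by (rule theI')
    then have "P' (e (THE \<alpha>. P \<alpha>))" using iff PU by blast
    then have "(THE \<alpha>. P' \<alpha>) = e (THE \<alpha>. P \<alpha>)" using True ex by (intro the1_equality) auto
    then show ?thesis using True ex
      by (simp add: adjoint_on_def P_def [symmetric] P'_def [symmetric] Let_def)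
  next
    case False
    then show ?thesis using ex zero
      by (simp add: adjoint_on_def P_def [symmetric] P'_def [symmetric] Let_def)
  qed
qed

lemma adjoint_on_in: "0 \<in> U \<Longrightarrow> adjoint_on ip U T \<beta> \<in> U"
proof -
  let ?P = "\<lambda>\<alpha>. \<alpha> \<in> U \<and> (\<forall>\<gamma>\<in>U. ip (T \<gamma>) \<beta> = ip \<gamma> \<alpha>)"
  assume "0 \<in> U"
  moreover have "(THE \<alpha>. ?P \<alpha>) \<in> U" if "\<exists>!\<alpha>. ?P \<alpha>" using theI'[OF that] by blast
  ultimately show "adjoint_on ip U T \<beta> \<in> U" by (simp add: adjoint_on_def Let_def)
qed

interpretation form_pair: vector_space_pair form_scale form_scale
  by unfold_locales

text \<open>
  The set \<open>V\<close> may be infinite-dimensional, and \<open>f\<close> is injective on \<open>T\<close> only, as is the case for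
  \<open>\<epsilon>\<^sub>B\<close> and the supported families.
\<close>

lemma dim_linear_image:
  assumes lin: "Vector_Spaces.linear form_scale form_scale f"
    and inj: "inj_on f T" and T: "form.subspace T" and V: "V \<subseteq> T"
  shows "form.dim (f ` V) = form.dim V"
proof -
  obtain b where b: "b \<subseteq> V" "form.independent b" "V \<subseteq> form.span b" "card b = form.dim V"
    by (rule form.basis_exists)
  have "form.span b \<subseteq> T" using b(1) V T by (intro form.span_minimal) auto
  then have inj': "inj_on f (form.span b)" using inj by (rule inj_on_subset[rotated])
  show ?thesis
  proof (rule form.dim_unique[of "f ` b"])
    show "form.independent (f ` b)"
      by (rule form_pair.linear_independent_injective_image[OF lin b(2) inj'])
    show "f ` V \<subseteq> form.span (f ` b)"
      using b(3) form_pair.linear_span_image[OF lin, of b] by auto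
    show "card (f ` b) = form.dim V"
      using b(4) card_image[OF inj_on_subset[OF inj' form.span_superset]] by simp
  qed (use b(1) in auto)
qed

context twist
begin

lemma adj_eps:
  fixes \<beta> :: "('x, 'k::real_or_complex) form"
  assumes "\<beta> \<in> supported_families X"
  shows "twisted_d_adj X g 0 H' k (eps X B \<beta>) = eps X B (twisted_d_adj X g B H k \<beta>)"
  unfolding twisted_d_adj_def
proof (rule adjoint_on_transport[OF eps_bij])
  fix \<gamma> :: "('x, 'k) form" assume "\<gamma> \<in> forms_of_parity X k"
  then show "twisted_d X H' (eps X B \<gamma>) = eps X B (twisted_d X H \<gamma>)"
    by (intro eps_twisted_d) (simp add: forms_of_parity_def)
next
  fix x y :: "('x, 'k) form" assume "y \<in> insert \<beta> (forms_of_parity X k)"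
  then show "born_infeld_product X g 0 (eps X B x) (eps X B y) = born_infeld_product X g B x y"
    using assms parity_supported by (intro born_infeld_product_eps) blast
qed simp

lemma adj_parity: "twisted_d_adj X g b h k (\<beta> :: ('x, 'k::real_or_complex) form) \<in> forms_of_parity X k"
  unfolding twisted_d_adj_def by (intro adjoint_on_in form.subspace_0[OF subspace_forms_of_parity])

lemma parity_forms: "\<omega> \<in> forms_of_parity X k \<Longrightarrow> \<omega> \<in> forms X"
  by (simp add: forms_of_parity_def)

lemma adj_d_eps:
  fixes \<omega> :: "('x, 'k::real_or_complex) form"
  assumes "\<omega> \<in> forms_of_parity X k"
  shows "twisted_d_adj X g 0 H' j (twisted_d X H' (eps X B \<omega>)) = eps X B (twisted_d_adj X g B H j (twisted_d X H \<omega>))"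
proof -
  have "\<omega> \<in> supported_families X" using assms parity_supported by blast
  then show ?thesis
    by (simp only: eps_twisted_d[OF parity_forms[OF assms]] adj_eps twisted_d_supported[OF H_supported])
qed

lemma laplacian_eps:
  fixes \<omega> :: "('x, 'k::real_or_complex) form"
  assumes "\<omega> \<in> forms_of_parity X k"
  shows "twisted_laplacian X g 0 H' k (eps X B \<omega>) = eps X B (twisted_laplacian X g B H k \<omega>)"
proof -
  have "\<omega> \<in> supported_families X" using assms parity_supported by blast
  then show ?thesis unfolding twisted_laplacian_def
    by (simp only: adj_d_eps[OF assms] adj_eps eps_twisted_d[OF parity_forms[OF adj_parity]] eps_add)
qed

lemma laplacian_supported:
  fixes \<omega> :: "('x, 'k::real_or_complex) form"
  shows "twisted_laplacian X g B H k \<omega> \<in> supported_families X"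
  unfolding twisted_laplacian_def
  by (intro form.subspace_add[OF subspace_supported] twisted_d_supported[OF H_supported]
      subsetD[OF parity_supported adj_parity])

lemma eps_eq_iff:
  fixes \<omega> \<eta> :: "('x, 'k::real_normed_field) form"
  shows "\<omega> \<in> supported_families X \<Longrightarrow> \<eta> \<in> supported_families X \<Longrightarrow> eps X B \<omega> = eps X B \<eta> \<longleftrightarrow> \<omega> = \<eta>"
  using eps_inj by (auto dest: inj_onD)

lemma eps_Collect_parity:
  assumes "\<And>\<omega>. \<omega> \<in> forms_of_parity X k \<Longrightarrow> Q (eps X B \<omega>) \<longleftrightarrow> P (\<omega> :: ('x, 'k::real_normed_field) form)"
  shows "{\<omega> \<in> forms_of_parity X k. Q \<omega>} = eps X B ` {\<omega> \<in> forms_of_parity X k. P \<omega>}"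
proof -
  have "{\<omega> \<in> forms_of_parity X k. Q \<omega>} = {\<omega> \<in> eps X B ` forms_of_parity X k. Q \<omega>}"
    using eps_bij[of k, where 'k = 'k] by (simp add: bij_betw_def)
  also have "\<dots> = eps X B ` {\<omega> \<in> forms_of_parity X k. P \<omega>}" using assms by auto
  finally show ?thesis .
qed

lemma harmonic_eps:
  "harmonic_forms X g 0 H' k = eps X B ` (harmonic_forms X g B H k :: ('x, 'k::real_or_complex) form set)"
  unfolding harmonic_forms_def
proof (rule eps_Collect_parity)
  fix \<omega> :: "('x, 'k) form" assume "\<omega> \<in> forms_of_parity X k"
  then show "twisted_laplacian X g 0 H' k (eps X B \<omega>) = 0 \<longleftrightarrow> twisted_laplacian X g B H k \<omega> = 0"
    using eps_eq_iff[OF laplacian_supported form.subspace_0[OF subspace_supported], of g k \<omega>]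
    by (simp add: laplacian_eps del: zero_fun_apply)
qed

text \<open>
  Corresponding eigenspaces have the same dimension, so the two operators have the same
  zeta-functions.
\<close>

lemma twisted_det_eps: "twisted_det TYPE('k::real_or_complex) X g 0 H' k = twisted_det TYPE('k) X g B H k"
proof -
  define A where "A = (\<lambda>\<omega> :: ('x, 'k) form. twisted_d_adj X g B H k (twisted_d X H \<omega>))"
  define A' where "A' = (\<lambda>\<omega> :: ('x, 'k) form. twisted_d_adj X g 0 H' k (twisted_d X H' \<omega>))"
  have "eigen_mult (forms_of_parity X k) A' r = eigen_mult (forms_of_parity X k) A r" for r
  proof -
    have "{\<omega> \<in> forms_of_parity X k. A' \<omega> = form_scale (of_real r) \<omega>} =
        eps X B ` {\<omega> \<in> forms_of_parity X k. A \<omega> = form_scale (of_real r) \<omega>}"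
    proof (rule eps_Collect_parity)
      fix \<omega> :: "('x, 'k) form" assume \<omega>: "\<omega> \<in> forms_of_parity X k"
      have "A \<omega> \<in> supported_families X" unfolding A_def using adj_parity parity_supported by blast
      moreover have "form_scale (of_real r) \<omega> \<in> supported_families X"
        using \<omega> parity_supported by (intro form.subspace_scale[OF subspace_supported]) blast
      moreover have "A' (eps X B \<omega>) = eps X B (A \<omega>)" unfolding A_def A'_def by (rule adj_d_eps[OF \<omega>])
      ultimately show "A' (eps X B \<omega>) = form_scale (of_real r) (eps X B \<omega>) \<longleftrightarrow> A \<omega> = form_scale (of_real r) \<omega>"
        using eps_eq_iff[of "A \<omega>" "form_scale (of_real r) \<omega>"] by (simp add: eps_scale)
    qed
    moreover have "{\<omega> \<in> forms_of_parity X k. A \<omega> = form_scale (of_real r) \<omega>} \<subseteq> supported_families X"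
      using parity_supported by blast
    ultimately show ?thesis unfolding eigen_mult_def
      by (simp add: dim_linear_image[OF linear_eps eps_inj subspace_supported])
  qed
  then have "is_zeta (forms_of_parity X k) A' = is_zeta (forms_of_parity X k) A"
    by (simp add: is_zeta_def fun_eq_iff)
  then show ?thesis unfolding twisted_det_def zeta_det_def zeta_function_def A_def A'_def by simp
qed

lemma orthonormal_basis_eps:
  fixes bs :: "('x, 'k::real_or_complex) form list"
  assumes "set bs \<subseteq> supported_families X"
    and V: "V \<subseteq> supported_families X"
  shows "orthonormal_basis (born_infeld_product X g 0) (eps X B ` V) (map (eps X B) bs) \<longleftrightarrow>
     orthonormal_basis (born_infeld_product X g B) V bs"
proof -
  have "form.span (eps X B ` set bs) = eps X B ` form.span (set bs)"
    by (rule form_pair.linear_span_image[OF linear_eps])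
  moreover have "form.span (set bs) \<subseteq> supported_families X"
    using assms by (intro form.span_minimal subspace_supported)
  ultimately have "form.span (eps X B ` set bs) = eps X B ` V \<longleftrightarrow> form.span (set bs) = V"
    using inj_on_image_eq_iff[OF eps_inj] V by simp
  moreover have "born_infeld_product X g 0 (map (eps X B) bs ! i) (map (eps X B) bs ! j) =
      born_infeld_product X g B (bs ! i) (bs ! j)" if "i < length bs" "j < length bs" for i j
    using that assms(1) by (simp add: born_infeld_product_eps subset_eq)
  ultimately show ?thesis unfolding orthonormal_basis_def by simp
qed

end

section \<open>Determinant lines\<close>

text \<open>
  Linear isomorphisms between records.  Closure of the domain under the operations is part of the
  definition because pullbacks of multilinear functions are extended by \<open>0\<close> outside it.
\<close>

definition space_iso :: "('k::field, 'v) module \<Rightarrow> ('k, 'w) module \<Rightarrow> ('v \<Rightarrow> 'w) \<Rightarrow> bool" where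
  "space_iso V W f \<longleftrightarrow> bij_betw f (carrier V) (carrier W) \<and>
     (\<forall>x\<in>carrier V. \<forall>y\<in>carrier V. x \<oplus>\<^bsub>V\<^esub> y \<in> carrier V \<and> f (x \<oplus>\<^bsub>V\<^esub> y) = f x \<oplus>\<^bsub>W\<^esub> f y) \<and>
     (\<forall>a. \<forall>x\<in>carrier V. a \<odot>\<^bsub>V\<^esub> x \<in> carrier V \<and> f (a \<odot>\<^bsub>V\<^esub> x) = a \<odot>\<^bsub>W\<^esub> f x)"

lemma space_isoD:
  assumes "space_iso V W f"
  shows "bij_betw f (carrier V) (carrier W)"
    and "x \<in> carrier V \<Longrightarrow> f x \<in> carrier W"
    and "x \<in> carrier V \<Longrightarrow> y \<in> carrier V \<Longrightarrow> x \<oplus>\<^bsub>V\<^esub> y \<in> carrier V"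
    and "x \<in> carrier V \<Longrightarrow> y \<in> carrier V \<Longrightarrow> f (x \<oplus>\<^bsub>V\<^esub> y) = f x \<oplus>\<^bsub>W\<^esub> f y"
    and "x \<in> carrier V \<Longrightarrow> a \<odot>\<^bsub>V\<^esub> x \<in> carrier V"
    and "x \<in> carrier V \<Longrightarrow> f (a \<odot>\<^bsub>V\<^esub> x) = a \<odot>\<^bsub>W\<^esub> f x"
  using assms by (auto simp: space_iso_def bij_betw_def)

lemma space_iso_inv:
  assumes "space_iso V W f" shows "space_iso W V (inv_into (carrier V) f)"
proof -
  note f = space_isoD[OF assms]
  let ?g = "inv_into (carrier V) f"
  have im: "f ` carrier V = carrier W" and inj: "inj_on f (carrier V)" using f(1) by (auto simp: bij_betw_def)
  have surj: "\<exists>v\<in>carrier V. x = f v" if "x \<in> carrier W" for x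
    using that unfolding im [symmetric] by auto
  have g: "?g (f x) = x" if "x \<in> carrier V" for x using inj that by simp
  have "x \<oplus>\<^bsub>W\<^esub> y \<in> carrier W \<and> ?g (x \<oplus>\<^bsub>W\<^esub> y) = ?g x \<oplus>\<^bsub>V\<^esub> ?g y" if "x \<in> carrier W" "y \<in> carrier W" for x y
  proof -
    obtain v w where vw: "v \<in> carrier V" "w \<in> carrier V" "x = f v" "y = f w"
      using surj[OF \<open>x \<in> _\<close>] surj[OF \<open>y \<in> _\<close>] by auto
    have "x \<oplus>\<^bsub>W\<^esub> y = f (v \<oplus>\<^bsub>V\<^esub> w)" unfolding vw(3,4) by (rule f(4)[OF vw(1,2), symmetric])
    then show ?thesis using f(2)[OF f(3)[OF vw(1,2)]] g[OF f(3)[OF vw(1,2)]] g[OF vw(1)] g[OF vw(2)] vw(3,4)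
      by metis
  qed
  moreover have "a \<odot>\<^bsub>W\<^esub> x \<in> carrier W \<and> ?g (a \<odot>\<^bsub>W\<^esub> x) = a \<odot>\<^bsub>V\<^esub> ?g x" if "x \<in> carrier W" for a x
  proof -
    obtain v where v: "v \<in> carrier V" "x = f v" using surj[OF \<open>x \<in> _\<close>] by auto
    have "a \<odot>\<^bsub>W\<^esub> x = f (a \<odot>\<^bsub>V\<^esub> v)" unfolding v(2) by (rule f(6)[OF v(1), symmetric])
    then show ?thesis using f(2)[OF f(5)[OF v(1)], of a] g[OF f(5)[OF v(1)], of a] g[OF v(1)] v(2)
      by metis
  qed
  ultimately show ?thesis unfolding space_iso_def using bij_betw_inv_into[OF f(1)] by blast
qed

lemma space_on_simps [simp]:
  "carrier (space_on sc S) = S" "x \<oplus>\<^bsub>space_on sc S\<^esub> y = x + y" "a \<odot>\<^bsub>space_on sc S\<^esub> x = sc a x"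
  by (simp_all add: space_on_def)

lemma fun_space_simps [simp]:
  "carrier (fun_space S) = S" "f \<oplus>\<^bsub>fun_space S\<^esub> h = f + h" "a \<odot>\<^bsub>fun_space S\<^esub> f = (\<lambda>x. a * f x)"
  by (simp_all add: fun_space_def)

lemma dual_space_add [simp]: "\<phi> \<oplus>\<^bsub>dual_space V\<^esub> \<psi> = \<phi> + \<psi>"
  and dual_space_smult [simp]: "a \<odot>\<^bsub>dual_space V\<^esub> \<phi> = (\<lambda>x. a * \<phi> x)"
  by (simp_all add: dual_space_def)

lemma dual_space_iff:
  "\<phi> \<in> carrier (dual_space V) \<longleftrightarrow>
     (\<forall>x\<in>carrier V. \<forall>y\<in>carrier V. \<phi> (x \<oplus>\<^bsub>V\<^esub> y) = \<phi> x + \<phi> y) \<and>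
     (\<forall>a. \<forall>x\<in>carrier V. \<phi> (a \<odot>\<^bsub>V\<^esub> x) = a * \<phi> x) \<and>
     (\<forall>x. x \<notin> carrier V \<longrightarrow> \<phi> x = 0)"
  by (simp add: dual_space_def)

text \<open>
  The transpose of \<open>p : W \<rightarrow> V\<close>, extended by \<open>0\<close>.  Exterior powers, determinant lines and tensor
  products are dual spaces of spaces of multilinear functions, and the maps between them are
  transposes of pullbacks.
\<close>

definition dual_map :: "('k::field, 'w) module \<Rightarrow> ('w \<Rightarrow> 'v) \<Rightarrow> ('v \<Rightarrow> 'k) \<Rightarrow> 'w \<Rightarrow> 'k" where
  "dual_map W p \<phi> = (\<lambda>w. if w \<in> carrier W then \<phi> (p w) else 0)"

lemma dual_map_in:
  assumes "space_iso W V p" "\<phi> \<in> carrier (dual_space V)"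
  shows "dual_map W p \<phi> \<in> carrier (dual_space W)"
  using assms(2) space_isoD[OF assms(1)] by (simp add: dual_space_iff dual_map_def)

lemma dual_space_iso:
  assumes "space_iso W V p"
  shows "space_iso (dual_space V) (dual_space W) (dual_map W p)"
proof -
  note p = space_isoD[OF assms] and i = space_isoD[OF space_iso_inv[OF assms]]
  have pi: "p (inv_into (carrier W) p v) = v" if "v \<in> carrier V" for v
    using p(1) that by (metis bij_betw_inv_into_right)
  have ip: "inv_into (carrier W) p (p w) = w" if "w \<in> carrier W" for w
    using p(1) that by (metis bij_betw_inv_into_left)
  have "bij_betw (dual_map W p) (carrier (dual_space V)) (carrier (dual_space W))"
  proof (rule bij_betw_byWitness[of _ "dual_map V (inv_into (carrier W) p)"])
    show "dual_map W p ` carrier (dual_space V) \<subseteq> carrier (dual_space W)"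
      using dual_map_in[OF assms] by blast
    show "dual_map V (inv_into (carrier W) p) ` carrier (dual_space W) \<subseteq> carrier (dual_space V)"
      using dual_map_in[OF space_iso_inv[OF assms]] by blast
    show "\<forall>\<phi>\<in>carrier (dual_space V). dual_map V (inv_into (carrier W) p) (dual_map W p \<phi>) = \<phi>"
      using i(2) pi by (auto simp: dual_map_def fun_eq_iff dual_space_iff)
    show "\<forall>\<phi>\<in>carrier (dual_space W). dual_map W p (dual_map V (inv_into (carrier W) p) \<phi>) = \<phi>"
      using p(2) ip by (auto simp: dual_map_def fun_eq_iff dual_space_iff)
  qed
  moreover have "\<phi> + \<psi> \<in> carrier (dual_space V)" if "\<phi> \<in> carrier (dual_space V)" "\<psi> \<in> carrier (dual_space V)" for \<phi> \<psi>
    using that by (simp add: dual_space_iff algebra_simps)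
  moreover have "(\<lambda>x. a * \<phi> x) \<in> carrier (dual_space V)" if "\<phi> \<in> carrier (dual_space V)" for a \<phi>
    using that by (simp add: dual_space_iff algebra_simps)
  ultimately show ?thesis
    unfolding space_iso_def by (auto simp: dual_map_def fun_eq_iff)
qed

lemma inverse_dual_map_eq: "inverse_dual_map V W f = dual_map W (inv_into (carrier V) f)"
  by (simp add: inverse_dual_map_def dual_map_def fun_eq_iff)

definition alternating_pullback ::
  "nat \<Rightarrow> ('k::field, 'v) module \<Rightarrow> ('v \<Rightarrow> 'w) \<Rightarrow> ('w list \<Rightarrow> 'k) \<Rightarrow> 'v list \<Rightarrow> 'k" where
  "alternating_pullback d V f h = (\<lambda>vs. if vs \<in> tuples d V then h (map f vs) else 0)"

lemma tuples_update: "vs \<in> tuples d V \<Longrightarrow> x \<in> carrier V \<Longrightarrow> vs[i := x] \<in> tuples d V"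
  using set_update_subset_insert[of vs i x] by (auto simp: tuples_def)

lemma alternating_pullback_in:
  assumes f: "space_iso V W f" and h: "h \<in> alternating d W"
  shows "alternating_pullback d V f h \<in> alternating d V"
proof -
  note fD = space_isoD[OF f]
  have m: "map f vs \<in> tuples d W" if "vs \<in> tuples d V" for vs
    using that fD(2) by (auto simp: tuples_def)
  have inj: "inj_on f (set vs)" if "vs \<in> tuples d V" for vs
    using fD(1) that by (auto simp: tuples_def bij_betw_def intro: inj_on_subset)
  show ?thesis
    using h unfolding alternating_def alternating_pullback_def
    by (simp add: tuples_update m map_update fD distinct_map inj)
qed

lemma alternating_outside: "h \<in> alternating d V \<Longrightarrow> vs \<notin> tuples d V \<Longrightarrow> h vs = 0"
  by (simp add: alternating_def)

lemma alternating_add: "h \<in> alternating d V \<Longrightarrow> h' \<in> alternating d V \<Longrightarrow> h + h' \<in> alternating d V"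
  by (simp add: alternating_def algebra_simps)

lemma alternating_scale: "h \<in> alternating d V \<Longrightarrow> (\<lambda>vs. a * h vs) \<in> alternating d V"
  by (simp add: alternating_def algebra_simps)

lemma alternating_space_iso:
  assumes f: "space_iso V W f"
  shows "space_iso (fun_space (alternating d W)) (fun_space (alternating d V)) (alternating_pullback d V f)"
proof -
  note fD = space_isoD[OF f] and gD = space_isoD[OF space_iso_inv[OF f]]
  let ?g = "inv_into (carrier V) f"
  have fg: "map f (map ?g ws) = ws" if "ws \<in> tuples d W" for ws
    using fD(1) that by (auto simp: tuples_def bij_betw_inv_into_right intro!: map_idI)
  have gf: "map ?g (map f vs) = vs" if "vs \<in> tuples d V" for vs
    using fD(1) that by (auto simp: tuples_def bij_betw_inv_into_left intro!: map_idI)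
  have mf: "map f vs \<in> tuples d W" if "vs \<in> tuples d V" for vs using that fD(2) by (auto simp: tuples_def)
  have mg: "map ?g ws \<in> tuples d V" if "ws \<in> tuples d W" for ws using that gD(2) by (auto simp: tuples_def)
  have "bij_betw (alternating_pullback d V f) (alternating d W) (alternating d V)"
  proof (rule bij_betw_byWitness[of _ "alternating_pullback d W ?g"])
    show "\<forall>h\<in>alternating d W. alternating_pullback d W ?g (alternating_pullback d V f h) = h"
      using mg fg alternating_outside by (auto simp: alternating_pullback_def fun_eq_iff simp del: map_map)
    show "\<forall>h\<in>alternating d V. alternating_pullback d V f (alternating_pullback d W ?g h) = h"
      using mf gf alternating_outside by (auto simp: alternating_pullback_def fun_eq_iff simp del: map_map)
  qed (use alternating_pullback_in[OF f] alternating_pullback_in[OF space_iso_inv[OF f]] in auto)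
  then show ?thesis unfolding space_iso_def
    by (auto simp: alternating_add alternating_scale) (auto simp: alternating_pullback_def fun_eq_iff)
qed

definition exterior_map ::
  "nat \<Rightarrow> ('k::field, 'v) module \<Rightarrow> ('k, 'w) module \<Rightarrow> ('v \<Rightarrow> 'w) \<Rightarrow> (('v list \<Rightarrow> 'k) \<Rightarrow> 'k) \<Rightarrow> ('w list \<Rightarrow> 'k) \<Rightarrow> 'k" where
  "exterior_map d V W f = dual_map (fun_space (alternating d W)) (alternating_pullback d V f)"

lemma exterior_space_iso:
  "space_iso V W f \<Longrightarrow> space_iso (exterior_power d V) (exterior_power d W) (exterior_map d V W f)"
  unfolding exterior_power_def exterior_map_def by (intro dual_space_iso alternating_space_iso)

lemma det_map_eq: "det_map V W f = exterior_map (top_degree V) V W f"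
  by (simp add: det_map_def exterior_map_def dual_map_def alternating_pullback_def fun_eq_iff)

lemma exterior_power_trivial:
  assumes f: "space_iso V W f" and V: "carrier (exterior_power d V) = {0}"
  shows "carrier (exterior_power d W) = {0}"
proof -
  have "carrier (exterior_power d W) = exterior_map d V W f ` carrier (exterior_power d V)"
    using space_isoD(1)[OF exterior_space_iso[OF f]] by (simp add: bij_betw_def)
  also have "\<dots> = {0}" unfolding V by (simp add: exterior_map_def dual_map_def fun_eq_iff)
  finally show ?thesis .
qed

text \<open>
  An isomorphism preserves the vanishing of each exterior power, hence also the degree which
  \<open>top_degree\<close> singles out, whether or not a greatest one exists.
\<close>

lemma top_degree_cong: "space_iso V W f \<Longrightarrow> top_degree V = top_degree W"
  unfolding top_degree_def using exterior_power_trivial space_iso_inv by (metis (no_types, lifting))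

lemma det_space_iso: "space_iso V W f \<Longrightarrow> space_iso (det_space V) (det_space W) (det_map V W f)"
  unfolding det_space_def det_map_eq using exterior_space_iso top_degree_cong by metis

lemma exterior_map_wedge_list:
  assumes f: "space_iso V W f" and mem: "\<And>v. v \<in> set vs \<Longrightarrow> f v \<in> carrier W \<longleftrightarrow> v \<in> carrier V"
  shows "exterior_map (length vs) V W f (wedge_list V vs) = wedge_list W (map f vs)"
proof
  fix h
  have "map f vs \<in> tuples (length vs) W \<longleftrightarrow> vs \<in> tuples (length vs) V"
    using mem by (auto simp: tuples_def)
  then show "exterior_map (length vs) V W f (wedge_list V vs) h = wedge_list W (map f vs) h"
    using alternating_pullback_in[OF f, of h "length vs"]
    by (auto simp: exterior_map_def dual_map_def wedge_list_def)
      (auto simp: alternating_pullback_def alternating_def)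
qed

lemma wedge_list_in: "wedge_list V vs \<in> carrier (exterior_power (length vs) V)"
  by (auto simp: exterior_power_def dual_space_iff wedge_list_def alternating_add alternating_scale)

text \<open>
  An alternating function of \<open>d\<close> arguments vanishes on lists of any other length, so that the only
  function alternating in both degrees is \<open>0\<close>.
\<close>

lemma wedge_list_wrong_degree:
  assumes "wedge_list V vs \<in> carrier (exterior_power d V)" "d \<noteq> length vs"
  shows "wedge_list V vs = 0"
proof
  fix h
  show "wedge_list V vs h = 0 h"
  proof (cases "h \<in> alternating d V \<and> h \<in> alternating (length vs) V")
    case True
    have "vs \<notin> tuples d V" using assms(2) by (auto simp: tuples_def)
    then show ?thesis using True by (simp add: wedge_list_def alternating_def)
  next
    case False
    then show ?thesis using assms(1)
      by (auto simp: exterior_power_def dual_space_iff wedge_list_def split: if_splits)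
  qed
qed

lemma exterior_power_zero: "0 \<in> carrier (exterior_power d V)"
  by (simp add: exterior_power_def dual_space_iff)

text \<open>
  The entries of \<open>vs\<close> may lie outside \<open>V\<close>, provided that \<open>f\<close> detects this; then both products vanish.
  If the length of \<open>vs\<close> is not the top degree, a product belongs to the determinant line only
  if it is \<open>0\<close>, and this happens on both sides simultaneously.
\<close>

lemma det_map_wedge_list:
  assumes f: "space_iso V W f" and mem: "\<And>v. v \<in> set vs \<Longrightarrow> f v \<in> carrier W \<longleftrightarrow> v \<in> carrier V"
  shows "wedge_list V vs \<in> carrier (det_space V) \<longleftrightarrow> wedge_list W (map f vs) \<in> carrier (det_space W)" (is ?mem)
    and "wedge_list V vs \<in> carrier (det_space V) \<Longrightarrow> det_map V W f (wedge_list V vs) = wedge_list W (map f vs)"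
proof -
  note top = top_degree_cong[OF f]
  have em: "exterior_map (length vs) V W f (wedge_list V vs) = wedge_list W (map f vs)"
    by (rule exterior_map_wedge_list[OF f mem])
  have em0: "exterior_map d V W f 0 = 0" for d by (simp add: exterior_map_def dual_map_def fun_eq_iff)
  have "?mem \<and> (wedge_list V vs \<in> carrier (det_space V) \<longrightarrow> det_map V W f (wedge_list V vs) = wedge_list W (map f vs))"
  proof (cases "length vs = top_degree V")
    case True
    then show ?thesis using wedge_list_in[of V vs] wedge_list_in[of W "map f vs"] em top
      by (simp add: det_space_def det_map_eq)
  next
    case False
    have V: "wedge_list V vs \<in> carrier (det_space V) \<longleftrightarrow> wedge_list V vs = 0"
      using wedge_list_wrong_degree[of V vs] exterior_power_zero False unfolding det_space_def by metis
    have W: "wedge_list W (map f vs) \<in> carrier (det_space W) \<longleftrightarrow> wedge_list W (map f vs) = 0"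
      using wedge_list_wrong_degree[of W "map f vs"] exterior_power_zero False top
      unfolding det_space_def length_map by metis
    have "inj_on (exterior_map (length vs) V W f) (carrier (exterior_power (length vs) V))"
      using space_isoD(1)[OF exterior_space_iso[OF f]] by (simp add: bij_betw_def)
    then have "wedge_list W (map f vs) = 0 \<longleftrightarrow> wedge_list V vs = 0"
      using em em0 wedge_list_in[of V vs] exterior_power_zero by (metis inj_on_eq_iff)
    then show ?thesis using V W em0 by (simp add: det_map_eq)
  qed
  then show ?mem and "wedge_list V vs \<in> carrier (det_space V) \<Longrightarrow> det_map V W f (wedge_list V vs) = wedge_list W (map f vs)"
    by blast+
qed

lemma bilinear_forms_add:
  "\<beta> \<in> bilinear_forms V W \<Longrightarrow> \<beta>' \<in> bilinear_forms V W \<Longrightarrow> \<beta> + \<beta>' \<in> bilinear_forms V W"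
  by (simp add: bilinear_forms_def dual_space_iff algebra_simps)

lemma bilinear_forms_scale: "\<beta> \<in> bilinear_forms V W \<Longrightarrow> (\<lambda>p. a * \<beta> p) \<in> bilinear_forms V W"
  by (simp add: bilinear_forms_def dual_space_iff algebra_simps)

lemma tensor_elt_in: "tensor_elt V W v w \<in> carrier (tensor_space V W)"
  by (auto simp: tensor_space_def dual_space_iff tensor_elt_def bilinear_forms_add bilinear_forms_scale)

lemma tensor_smult_in:
  "t \<in> carrier (tensor_space V W) \<Longrightarrow> a \<odot>\<^bsub>tensor_space V W\<^esub> t \<in> carrier (tensor_space V W)"
  by (simp add: tensor_space_def dual_space_iff algebra_simps)

lemma bilinear_pullback_in:
  assumes f: "space_iso V V' f" and f': "space_iso W W' f'" and \<beta>: "\<beta> \<in> bilinear_forms V' W'"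
  shows "(\<lambda>(v, w). if v \<in> carrier V \<and> w \<in> carrier W then \<beta> (f v, f' w) else 0) \<in> bilinear_forms V W"
  using \<beta> space_isoD[OF f] space_isoD[OF f']
  by (simp add: bilinear_forms_def dual_space_iff split: prod.split)

lemma tensor_map_elt:
  assumes f: "space_iso V V' f" and f': "space_iso W W' f'" and v: "v \<in> carrier V" and w: "w \<in> carrier W"
  shows "tensor_map V W V' W' f f' (a \<odot>\<^bsub>tensor_space V W\<^esub> tensor_elt V W v w) =
    a \<odot>\<^bsub>tensor_space V' W'\<^esub> tensor_elt V' W' (f v) (f' w)"
  using bilinear_pullback_in[OF f f'] v w
  by (auto simp: tensor_map_def tensor_elt_def tensor_space_def fun_eq_iff)

section \<open>Cohomology and torsion\<close>

lemma (in manifold) twisted_d_add: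
  fixes \<omega> \<eta> :: "('x, 'k::real_normed_field) form"
  assumes "\<omega> \<in> forms X" "\<eta> \<in> forms X"
  shows "twisted_d X h (\<omega> + \<eta>) = twisted_d X h \<omega> + twisted_d X h \<eta>"
  unfolding twisted_d_def ext_deriv_add[OF assms] wedge_form_add_right by (simp only: add_ac)

lemma (in manifold) twisted_d_scale:
  fixes \<omega> :: "('x, 'k::real_normed_field) form"
  assumes "\<omega> \<in> forms X"
  shows "twisted_d X h (form_scale a \<omega>) = form_scale a (twisted_d X h \<omega>)"
  by (simp add: twisted_d_def ext_deriv_scale[OF assms] wedge_form_scale_right form.scale_right_distrib del: plus_fun_apply)

lemma (in manifold) subspace_coboundaries:
  "form.subspace (coboundaries X h k :: ('x, 'k::real_normed_field) form set)"
  unfolding coboundaries_def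
proof (rule form.subspaceI)
  let ?U = "forms_of_parity X (Suc k) :: ('x, 'k) form set"
  note U = subspace_forms_of_parity[of "Suc k", where 'k = 'k]
  have uf: "\<omega> \<in> forms X" if "\<omega> \<in> ?U" for \<omega> using that by (simp add: forms_of_parity_def)
  have "twisted_d X h 0 = (0 :: ('x, 'k) form)"
    using twisted_d_scale[of "0 :: ('x, 'k) form" h 0] form.subspace_0[OF subspace_forms]
    by (simp del: zero_fun_apply)
  then show "0 \<in> twisted_d X h ` ?U" using form.subspace_0[OF U] by (metis imageI)
next
  fix x y :: "('x, 'k) form"
  assume "x \<in> twisted_d X h ` forms_of_parity X (Suc k)" "y \<in> twisted_d X h ` forms_of_parity X (Suc k)"
  then obtain \<omega> \<eta> where o: "\<omega> \<in> forms_of_parity X (Suc k)" "\<eta> \<in> forms_of_parity X (Suc k)"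
    "x = twisted_d X h \<omega>" "y = twisted_d X h \<eta>" by (elim imageE)
  have "x + y = twisted_d X h (\<omega> + \<eta>)"
    unfolding o by (rule twisted_d_add[symmetric]) (use o in \<open>simp_all add: forms_of_parity_def\<close>)
  then show "x + y \<in> twisted_d X h ` forms_of_parity X (Suc k)"
    using form.subspace_add[OF subspace_forms_of_parity o(1,2)] by (rule image_eqI)
next
  fix a and x :: "('x, 'k) form"
  assume "x \<in> twisted_d X h ` forms_of_parity X (Suc k)"
  then obtain \<omega> where o: "\<omega> \<in> forms_of_parity X (Suc k)" "x = twisted_d X h \<omega>" by (elim imageE)
  have "form_scale a x = twisted_d X h (form_scale a \<omega>)"
    unfolding o by (rule twisted_d_scale[symmetric]) (use o in \<open>simp add: forms_of_parity_def\<close>)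
  then show "form_scale a x \<in> twisted_d X h ` forms_of_parity X (Suc k)"
    using form.subspace_scale[OF subspace_forms_of_parity o(1)] by (rule image_eqI)
qed

lemma coh_class_eq: "coh_class X h k \<omega> = (\<lambda>\<eta>. \<eta> + \<omega>) ` coboundaries X h k"
  unfolding coh_class_def a_r_coset_def' cocycles_def space_on_simps by blast

lemma carrier_cohomology:
  "carrier (cohomology X h k) = coh_class X h k ` {\<omega> \<in> forms_of_parity X k. twisted_d X h \<omega> = 0}"
proof -
  have "carrier (cohomology X h k) = a_rcosets\<^bsub>cocycles X h k\<^esub> (coboundaries X h k)"
    by (simp add: cohomology_def quotient_space_def)
  also have "\<dots> = (\<Union>\<omega>\<in>carrier (cocycles X h k). {coh_class X h k \<omega>})"
    by (simp add: A_RCOSETS_def' coh_class_def)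
  finally show ?thesis by (simp add: cocycles_def UNION_singleton_eq_range)
qed

lemma (in manifold) cohomology_add:
  fixes \<omega> \<eta> :: "('x, 'k::real_normed_field) form"
  shows "coh_class X h k \<omega> \<oplus>\<^bsub>cohomology X h k\<^esub> coh_class X h k \<eta> = coh_class X h k (\<omega> + \<eta>)"
proof -
  let ?W = "coboundaries X h k :: ('x, 'k) form set"
  have "coh_class X h k \<omega> \<oplus>\<^bsub>cohomology X h k\<^esub> coh_class X h k \<eta> =
      (\<Union>a\<in>coh_class X h k \<omega>. \<Union>b\<in>coh_class X h k \<eta>. {a + b})"
    by (simp add: cohomology_def quotient_space_def set_add_def' cocycles_def)
  also have "\<dots> = {(a + \<omega>) + (b + \<eta>) | a b. a \<in> ?W \<and> b \<in> ?W}"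
    unfolding coh_class_eq by blast
  also have "\<dots> = coh_class X h k (\<omega> + \<eta>)"
  proof (intro equalityI subsetI)
    fix \<theta> assume "\<theta> \<in> {(a + \<omega>) + (b + \<eta>) | a b. a \<in> ?W \<and> b \<in> ?W}"
    then obtain a b where ab: "\<theta> = (a + \<omega>) + (b + \<eta>)" "a \<in> ?W" "b \<in> ?W" by blast
    have "\<theta> = (a + b) + (\<omega> + \<eta>)" unfolding ab(1) by (simp only: add_ac)
    moreover have "a + b \<in> ?W" by (rule form.subspace_add[OF subspace_coboundaries ab(2,3)])
    ultimately show "\<theta> \<in> coh_class X h k (\<omega> + \<eta>)" unfolding coh_class_eq by blast
  next
    fix \<theta> assume "\<theta> \<in> coh_class X h k (\<omega> + \<eta>)"
    then obtain a where a: "a \<in> ?W" "\<theta> = a + (\<omega> + \<eta>)" unfolding coh_class_eq by blast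
    have "\<theta> = (a + \<omega>) + (0 + \<eta>)" unfolding a(2) by (simp only: add_ac add_0_left)
    then show "\<theta> \<in> {(a + \<omega>) + (b + \<eta>) | a b. a \<in> ?W \<and> b \<in> ?W}"
      using a(1) form.subspace_0[OF subspace_coboundaries] by blast
  qed
  finally show ?thesis .
qed

lemma (in manifold) cohomology_smult:
  fixes \<omega> :: "('x, 'k::real_normed_field) form"
  shows "a \<odot>\<^bsub>cohomology X h k\<^esub> coh_class X h k \<omega> = coh_class X h k (form_scale a \<omega>)"
proof -
  let ?W = "coboundaries X h k :: ('x, 'k) form set"
  have "a \<odot>\<^bsub>cohomology X h k\<^esub> coh_class X h k \<omega> =
      (\<Union>b\<in>?W. \<Union>c\<in>form_scale a ` coh_class X h k \<omega>. {b + c})"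
    by (simp add: cohomology_def quotient_space_def set_add_def' cocycles_def)
  also have "\<dots> = {b + form_scale a (c + \<omega>) | b c. b \<in> ?W \<and> c \<in> ?W}"
    unfolding coh_class_eq by blast
  also have "\<dots> = coh_class X h k (form_scale a \<omega>)"
  proof (intro equalityI subsetI)
    fix \<theta> assume "\<theta> \<in> {b + form_scale a (c + \<omega>) | b c. b \<in> ?W \<and> c \<in> ?W}"
    then obtain b c where bc: "\<theta> = b + form_scale a (c + \<omega>)" "b \<in> ?W" "c \<in> ?W" by blast
    have "\<theta> = (b + form_scale a c) + form_scale a \<omega>"
      unfolding bc(1) by (simp only: form.scale_right_distrib add.assoc)
    moreover have "b + form_scale a c \<in> ?W"
      by (intro form.subspace_add[OF subspace_coboundaries] form.subspace_scale[OF subspace_coboundaries] bc(2,3))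
    ultimately show "\<theta> \<in> coh_class X h k (form_scale a \<omega>)" unfolding coh_class_eq by blast
  next
    fix \<theta> assume "\<theta> \<in> coh_class X h k (form_scale a \<omega>)"
    then obtain b where b: "b \<in> ?W" "\<theta> = b + form_scale a \<omega>" unfolding coh_class_eq by blast
    have "\<theta> = b + form_scale a (0 + \<omega>)" unfolding b(2) by (simp only: add_0_left)
    then show "\<theta> \<in> {b + form_scale a (c + \<omega>) | b c. b \<in> ?W \<and> c \<in> ?W}"
      using b(1) form.subspace_0[OF subspace_coboundaries] by blast
  qed
  finally show ?thesis .
qed

context twist
begin

lemma eps_coboundaries:
  "eps X B ` coboundaries X H k = (coboundaries X H' k :: ('x, 'k::real_normed_field) form set)"
proof -
  have "eps X B ` coboundaries X H k = twisted_d X H' ` eps X B ` (forms_of_parity X (Suc k) :: ('x, 'k) form set)"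
    unfolding coboundaries_def image_image
    by (intro image_cong refl) (simp add: eps_twisted_d parity_forms)
  then show ?thesis using eps_bij[of "Suc k", where 'k = 'k] by (simp add: bij_betw_def coboundaries_def)
qed

lemma eps_coh_class:
  "eps X B ` coh_class X H k \<omega> = coh_class X H' k (eps X B \<omega> :: ('x, 'k::real_normed_field) form)"
  unfolding coh_class_eq eps_coboundaries [symmetric] image_image by (simp only: eps_add)

lemma coh_class_supported:
  fixes \<omega> :: "('x, 'k::real_normed_field) form"
  assumes "\<omega> \<in> supported_families X" shows "coh_class X H k \<omega> \<subseteq> supported_families X"
proof -
  have "coboundaries X H k \<subseteq> (supported_families X :: ('x, 'k) form set)"
    unfolding coboundaries_def using twisted_d_supported[OF H_supported] parity_supported by blast
  then show ?thesis unfolding coh_class_eq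
    using form.subspace_add[OF subspace_supported _ assms] by blast
qed

lemma eps_image_inj: "inj_on ((`) (eps X B)) (Pow (supported_families X :: ('x, 'k::real_normed_field) form set))"
  by (rule inj_onI) (use inj_on_image_eq_iff[OF eps_inj] in blast)

lemma eps_cocycles:
  "{\<omega> \<in> forms_of_parity X k. twisted_d X H' \<omega> = 0} =
   eps X B ` {\<omega> \<in> forms_of_parity X k. twisted_d X H \<omega> = (0 :: ('x, 'k::real_normed_field) form)}"
proof (rule eps_Collect_parity)
  fix \<omega> :: "('x, 'k) form" assume \<omega>: "\<omega> \<in> forms_of_parity X k"
  then have "twisted_d X H \<omega> \<in> supported_families X"
    using twisted_d_supported[OF H_supported] parity_supported by blast
  then show "twisted_d X H' (eps X B \<omega>) = 0 \<longleftrightarrow> twisted_d X H \<omega> = 0"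
    using eps_eq_iff[OF _ form.subspace_0[OF subspace_supported], of "twisted_d X H \<omega>"]
    by (simp add: eps_twisted_d[OF parity_forms[OF \<omega>]] del: zero_fun_apply)
qed

text \<open>
  As \<open>\<epsilon>\<^sub>B\<close> maps cocycles onto cocycles and coboundaries onto coboundaries, it maps cosets onto
  cosets.
\<close>

lemma cohomology_carrier_eps:
  "carrier (cohomology X H' k) = (`) (eps X B) ` carrier (cohomology X H k :: ('k::real_normed_field, _) module)"
  unfolding carrier_cohomology eps_cocycles image_image eps_coh_class ..

lemma cohomology_carrier_supported:
  "carrier (cohomology X H k) \<subseteq> Pow (supported_families X :: ('x, 'k::real_normed_field) form set)"
  unfolding carrier_cohomology using coh_class_supported parity_supported by blast

lemma cohomology_space_iso:
  "space_iso (cohomology X H k :: ('k::real_normed_field, _) module) (cohomology X H' k) ((`) (eps X B))"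
proof -
  let ?C = "cohomology X H k :: ('k, ('x, 'k) form set) module"
  let ?Z = "{\<omega> \<in> forms_of_parity X k. twisted_d X H \<omega> = (0 :: ('x, 'k) form)}"
  have "bij_betw ((`) (eps X B)) (carrier ?C) (carrier (cohomology X H' k))"
    unfolding bij_betw_def cohomology_carrier_eps
    using inj_on_subset[OF eps_image_inj cohomology_carrier_supported] by blast
  moreover have "S \<oplus>\<^bsub>?C\<^esub> T \<in> carrier ?C \<and> eps X B ` (S \<oplus>\<^bsub>?C\<^esub> T) = eps X B ` S \<oplus>\<^bsub>cohomology X H' k\<^esub> eps X B ` T"
    if ST: "S \<in> carrier ?C" "T \<in> carrier ?C" for S T
  proof -
    obtain \<omega> \<eta> where o: "\<omega> \<in> ?Z" "\<eta> \<in> ?Z" "S = coh_class X H k \<omega>" "T = coh_class X H k \<eta>"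
      using ST unfolding carrier_cohomology by (elim imageE)
    then have "\<omega> \<in> forms X" "\<eta> \<in> forms X" by (simp_all add: forms_of_parity_def)
    then have "\<omega> + \<eta> \<in> ?Z"
      using o(1,2) form.subspace_add[OF subspace_forms_of_parity, of \<omega> k \<eta>]
      by (simp add: twisted_d_add del: plus_fun_apply zero_fun_apply)
    then show ?thesis unfolding o(3,4) cohomology_add eps_coh_class eps_add carrier_cohomology by blast
  qed
  moreover have "a \<odot>\<^bsub>?C\<^esub> S \<in> carrier ?C \<and> eps X B ` (a \<odot>\<^bsub>?C\<^esub> S) = a \<odot>\<^bsub>cohomology X H' k\<^esub> eps X B ` S"
    if S: "S \<in> carrier ?C" for a S
  proof -
    obtain \<omega> where o: "\<omega> \<in> ?Z" "S = coh_class X H k \<omega>"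
      using S unfolding carrier_cohomology by (elim imageE)
    then have "\<omega> \<in> forms X" by (simp add: forms_of_parity_def)
    then have "form_scale a \<omega> \<in> ?Z"
      using o(1) form.subspace_scale[OF subspace_forms_of_parity, of \<omega> k a]
      by (simp add: twisted_d_scale del: zero_fun_apply)
    then show ?thesis unfolding o(2) cohomology_smult eps_coh_class eps_scale carrier_cohomology by blast
  qed
  ultimately show ?thesis unfolding space_iso_def by blast
qed

lemma harmonic_supported:
  "harmonic_forms X g B H k \<subseteq> (supported_families X :: ('x, 'k::real_or_complex) form set)"
  unfolding harmonic_forms_def using parity_supported by blast

text \<open>
  Orthonormal bases of the two spaces of harmonic forms correspond under the isometry \<open>\<epsilon>\<^sub>B\<close>, and
  \<open>det_map_wedge_list\<close> carries the products of their classes, and the membership of the products in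
  the determinant line, from one side to the other.
\<close>

lemma unit_volume_elements_eps:
  fixes k g
  defines "f \<equiv> det_map (cohomology X H k) (cohomology X H' k) ((`) (eps X B))"
  shows "(unit_volume_elements X g 0 H' k :: ('x, 'k::real_or_complex) det_coh_elt set) = f ` unit_volume_elements X g B H k"
proof -
  let ?C = "cohomology X H k :: ('k, ('x, 'k) form set) module"
  let ?C' = "cohomology X H' k :: ('k, ('x, 'k) form set) module"
  let ?h = "harmonic_forms X g B H k :: ('x, 'k) form set"
  note iso = cohomology_space_iso[of k, where 'k = 'k]
  have wl: "(wedge_list ?C (map (coh_class X H k) bs) \<in> carrier (det_space ?C) \<longleftrightarrow>
        wedge_list ?C' (map (coh_class X H' k) (map (eps X B) bs)) \<in> carrier (det_space ?C')) \<and>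
      (wedge_list ?C (map (coh_class X H k) bs) \<in> carrier (det_space ?C) \<longrightarrow>
        f (wedge_list ?C (map (coh_class X H k) bs)) = wedge_list ?C' (map (coh_class X H' k) (map (eps X B) bs)))"
    if bs: "set bs \<subseteq> supported_families X" for bs
  proof -
    have "eps X B ` v \<in> carrier ?C' \<longleftrightarrow> v \<in> carrier ?C" if "v \<in> set (map (coh_class X H k) bs)" for v
    proof -
      have "v \<in> Pow (supported_families X)" using that bs coh_class_supported by auto
      then show ?thesis
        unfolding cohomology_carrier_eps
        using inj_on_image_mem_iff[OF eps_image_inj _ cohomology_carrier_supported] by blast
    qed
    then have *: "\<And>v. v \<in> set (map (coh_class X H k) bs) \<Longrightarrow> eps X B ` v \<in> carrier ?C' \<longleftrightarrow> v \<in> carrier ?C" .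
    have m: "map ((`) (eps X B)) (map (coh_class X H k) bs) = map (coh_class X H' k) (map (eps X B) bs)"
      by (simp add: eps_coh_class)
    show ?thesis unfolding f_def
      using det_map_wedge_list[OF iso, of "map (coh_class X H k) bs", OF *] unfolding m by blast
  qed
  have onb: "orthonormal_basis (born_infeld_product X g 0) (harmonic_forms X g 0 H' k) (map (eps X B) bs) \<longleftrightarrow>
      orthonormal_basis (born_infeld_product X g B) ?h bs" if "set bs \<subseteq> supported_families X" for bs
    unfolding harmonic_eps by (rule orthonormal_basis_eps[OF that harmonic_supported])
  have onb_set: "set bs \<subseteq> V" if "orthonormal_basis ip V bs" for ip V and bs :: "('x, 'k) form list"
    using that form.span_superset[of "set bs"] by (auto simp: orthonormal_basis_def)
  show ?thesis
  proof (intro equalityI subsetI)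
    fix \<eta>' assume "\<eta>' \<in> (unit_volume_elements X g 0 H' k :: ('x, 'k) det_coh_elt set)"
    then obtain bs' where \<eta>': "\<eta>' \<in> carrier (det_space ?C')"
      "orthonormal_basis (born_infeld_product X g 0) (harmonic_forms X g 0 H' k) bs'"
      "\<eta>' = wedge_list ?C' (map (coh_class X H' k) bs')"
      unfolding unit_volume_elements_def by blast
    \<comment> \<open>inverses are taken in \<open>?h\<close>, so that \<open>bs\<close> consists of harmonic forms\<close>
    define bs where "bs = map (inv_into ?h (eps X B)) bs'"
    have im: "set bs' \<subseteq> eps X B ` ?h" using onb_set[OF \<eta>'(2)] unfolding harmonic_eps .
    have "b \<in> ?h" if "b \<in> set bs" for b
      using that im inv_into_into[of _ "eps X B" ?h] unfolding bs_def by auto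
    then have bs: "set bs \<subseteq> supported_families X" using harmonic_supported by blast
    have bs': "bs' = map (eps X B) bs"
      using im unfolding bs_def by (simp add: map_idI f_inv_into_f subset_eq)
    have "wedge_list ?C (map (coh_class X H k) bs) \<in> unit_volume_elements X g B H k"
      using wl[OF bs] onb[OF bs] \<eta>' unfolding bs' unit_volume_elements_def by blast
    moreover have "\<eta>' = f (wedge_list ?C (map (coh_class X H k) bs))"
      using wl[OF bs] \<eta>' unfolding bs' by simp
    ultimately show "\<eta>' \<in> f ` unit_volume_elements X g B H k" by blast
  next
    fix \<eta>' assume "\<eta>' \<in> f ` unit_volume_elements X g B H k"
    then obtain bs where bs: "orthonormal_basis (born_infeld_product X g B) ?h bs"
      "wedge_list ?C (map (coh_class X H k) bs) \<in> carrier (det_space ?C)"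
      "\<eta>' = f (wedge_list ?C (map (coh_class X H k) bs))"
      unfolding unit_volume_elements_def by blast
    have s: "set bs \<subseteq> supported_families X" using onb_set[OF bs(1)] harmonic_supported by blast
    show "\<eta>' \<in> unit_volume_elements X g 0 H' k"
      using wl[OF s] onb[OF s] bs unfolding unit_volume_elements_def by auto
  qed
qed

text \<open>
  The real factor is the same for both torsions.  The line of degree 1 enters through its dual, on
  which the induced map is \<open>\<phi> \<mapsto> \<phi> \<circ> f\<^sup>-\<^sup>1\<close>; it maps the inverse of \<open>\<eta>\<close> to the inverse of \<open>f \<eta>\<close>.
\<close>

lemma torsion_eps:
  "(torsion X g 0 H' :: ('x, 'k::real_or_complex) det_elt set) = det_eps X B H H' ` torsion X g B H"
proof -
  define C C' where "C = (\<lambda>k. cohomology X H k :: ('k, ('x, 'k) form set) module)"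
    and "C' = (\<lambda>k. cohomology X H' k :: ('k, ('x, 'k) form set) module)"
  define f where "f = (\<lambda>k. det_map (C k) (C' k) ((`) (eps X B)))"
  define L L' where "L = (\<lambda>k. det_space (C k))" and "L' = (\<lambda>k. det_space (C' k))"
  define M M' where "M = dual_space (L 1)" and "M' = dual_space (L' 1)"
  define F where "F = inverse_dual_map (L 1) (L' 1) (f 1)"
  define r where "r = sqrt (twisted_det TYPE('k) X g B H 0) / sqrt (twisted_det TYPE('k) X g B H 1)"
  have iso: "space_iso (L k) (L' k) (f k)" for k
    unfolding L_def L'_def f_def C_def C'_def by (intro det_space_iso cohomology_space_iso)
  have isoF: "space_iso M M' F"
    unfolding M_def M'_def F_def inverse_dual_map_eq by (intro dual_space_iso space_iso_inv iso)
  have vol: "unit_volume_elements X g 0 H' k = f k ` unit_volume_elements X g B H k" for k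
    unfolding f_def C_def C'_def by (rule unit_volume_elements_eps)
  have vol_in: "\<eta> \<in> carrier (L k)" if "\<eta> \<in> unit_volume_elements X g B H k" for k \<eta>
    using that unfolding L_def C_def unit_volume_elements_def by blast
  have F_eval: "F \<phi> (f 1 \<eta>) = \<phi> \<eta>" if "\<eta> \<in> carrier (L 1)" for \<phi> \<eta>
    using that space_isoD(1,2)[OF iso[of 1]]
    by (simp add: F_def inverse_dual_map_def bij_betw_inv_into_left)
  have det: "det_eps X B H H' (a \<odot>\<^bsub>tensor_space (L 0) M\<^esub> tensor_elt (L 0) M \<eta> \<phi>) =
      a \<odot>\<^bsub>tensor_space (L' 0) M'\<^esub> tensor_elt (L' 0) M' (f 0 \<eta>) (F \<phi>)"
    if "\<eta> \<in> carrier (L 0)" "\<phi> \<in> carrier M" for a \<eta> \<phi>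
    using tensor_map_elt[OF iso isoF that, of a]
    by (simp add: det_eps_def L_def L'_def C_def C'_def f_def F_def M_def M'_def)
  have tors: "torsion X g B H = {(u * of_real r) \<odot>\<^bsub>tensor_space (L 0) M\<^esub> tensor_elt (L 0) M \<eta>0 \<phi> | u \<eta>0 \<eta>1 \<phi>.
      norm u = 1 \<and> \<eta>0 \<in> unit_volume_elements X g B H 0 \<and> \<eta>1 \<in> unit_volume_elements X g B H 1 \<and>
      \<phi> \<in> carrier M \<and> \<phi> \<eta>1 = 1}"
    unfolding torsion_def Let_def det_cohomology_def L_def C_def M_def r_def by simp
  have tors': "torsion X g 0 H' = {(u * of_real r) \<odot>\<^bsub>tensor_space (L' 0) M'\<^esub> tensor_elt (L' 0) M' \<eta>0 \<phi> | u \<eta>0 \<eta>1 \<phi>.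
      norm u = 1 \<and> \<eta>0 \<in> f 0 ` unit_volume_elements X g B H 0 \<and> \<eta>1 \<in> f 1 ` unit_volume_elements X g B H 1 \<and>
      \<phi> \<in> carrier M' \<and> \<phi> \<eta>1 = 1}"
    unfolding torsion_def Let_def det_cohomology_def L'_def C'_def M'_def r_def twisted_det_eps vol [symmetric] by simp
  have M': "carrier M' = F ` carrier M" using space_isoD(1)[OF isoF] by (simp add: bij_betw_def)
  show ?thesis
  proof (intro equalityI subsetI)
    fix t assume "t \<in> (torsion X g 0 H' :: ('x, 'k) det_elt set)"
    then obtain u \<eta>0 \<eta>1 \<phi> where t: "t = (u * of_real r) \<odot>\<^bsub>tensor_space (L' 0) M'\<^esub> tensor_elt (L' 0) M' (f 0 \<eta>0) (F \<phi>)"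
      "norm u = 1" "\<eta>0 \<in> unit_volume_elements X g B H 0" "\<eta>1 \<in> unit_volume_elements X g B H 1"
      "\<phi> \<in> carrier M" "F \<phi> (f 1 \<eta>1) = 1"
      unfolding tors' M' by blast
    have "t = det_eps X B H H' ((u * of_real r) \<odot>\<^bsub>tensor_space (L 0) M\<^esub> tensor_elt (L 0) M \<eta>0 \<phi>)"
      unfolding t(1) by (rule det[OF vol_in[OF t(3)] t(5), symmetric])
    moreover have "\<phi> \<eta>1 = 1" using t(6) F_eval[OF vol_in[OF t(4)]] by simp
    ultimately show "t \<in> det_eps X B H H' ` torsion X g B H"
      unfolding tors using t by blast
  next
    fix t assume "t \<in> det_eps X B H H' ` (torsion X g B H :: ('x, 'k) det_elt set)"
    then obtain u \<eta>0 \<eta>1 \<phi> where t: "t = det_eps X B H H' ((u * of_real r) \<odot>\<^bsub>tensor_space (L 0) M\<^esub> tensor_elt (L 0) M \<eta>0 \<phi>)"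
      "norm u = 1" "\<eta>0 \<in> unit_volume_elements X g B H 0" "\<eta>1 \<in> unit_volume_elements X g B H 1"
      "\<phi> \<in> carrier M" "\<phi> \<eta>1 = 1"
      unfolding tors by blast
    have "t = (u * of_real r) \<odot>\<^bsub>tensor_space (L' 0) M'\<^esub> tensor_elt (L' 0) M' (f 0 \<eta>0) (F \<phi>)"
      unfolding t(1) by (rule det[OF vol_in[OF t(3)] t(5)])
    moreover have "F \<phi> (f 1 \<eta>1) = 1" using t(6) F_eval[OF vol_in[OF t(4)]] by simp
    ultimately show "t \<in> torsion X g 0 H'"
      unfolding tors' M' using t by blast
  qed
qed

end

lemma torsion_subset_det_cohomology: "torsion X g B H \<subseteq> carrier (det_cohomology X H)"
  unfolding torsion_def Let_def det_cohomology_def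
  by (auto intro!: tensor_smult_in tensor_elt_in)

theorem corollary3p11:
  fixes X :: "'x mfd" and g :: "'x metric_tensor" and B H H' :: "('x, real) form"
  assumes "compact_oriented_manifold X"
    and "riemannian_metric X g"
    and "B \<in> forms_of_degree X 2"
    and "H \<in> forms_of_degree X 3"
    and "ext_deriv X H = 0"
    and "H' = H - ext_deriv X B"
  shows "(torsion X g 0 H' :: ('x, 'k::real_or_complex) det_elt set) =
           det_eps X B H H' ` torsion X g B H \<and>
         (torsion X g 0 H' :: ('x, 'k) det_elt set) \<subseteq> carrier (det_cohomology X H')"
proof -
  interpret twist X B H H'
    by unfold_locales (use assms in \<open>simp_all add: forms_of_degree_def\<close>)
  show ?thesis using torsion_eps torsion_subset_det_cohomology by blast
qed

end
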